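(* Let $\mathfrak g=\mathfrak{so}_{2r+1}$, $\mathfrak{sp}_{2r}$ or $\mathfrak{so}_{2r}$, and let $h_1,\dots,h_r$ be the basis of the Cartan subalgebra $\mathfrak h$ dual to the orthonormal basis $\varepsilon_1,\dots,\varepsilon_r$ of $\mathfrak h^*$ (so $h_i=F_{ii}$). With respect to the form $\langle x,y\rangle=\frac12\mathrm{tr}_V(xy)$ let $\gamma=\sum_b b\otimes b^*$. Let $$y=\begin{cases}2r,&\mathfrak g=\mathfrak{so}_{2r+1},\\2r+1,&\mathfrak g=\mathfrak{sp}_{2r},\\2r-1,&\mathfrak g=\mathfrak{so}_{2r},\end{cases}\qquad \epsilon=\begin{cases}1,&\mathfrak g=\mathfrak{so}_{2r+1},\\-1,&\mathfrak g=\mathfrak{sp}_{2r},\\1,&\mathfrak g=\mathfrak{so}_{2r},\end{cases}\qquad V=L(\varepsilon_1),$$ and let $z_V^{(\ell)}$ be the central elements in $U\mathfrak g$ defined by $$z_V^{(\ell)}=\epsilon\,(\mathrm{id}\otimes \mathrm{tr}_V)\big((\tfrac12y+\gamma)^\ell\big),\qquad\text{and write}\quad z_V(u)=\sum_{\ell\in\mathbb Z_{\ge0}}z_V^{(\ell)}u^{-\ell}.$$ Then $$\pi_0\big(z_V(u)+\epsilon u-\tfrac12\big)=(\epsilon u+\tfrac12)\,\frac{u+\frac12y-r}{u-\frac12y+r}\;\sigma_\rho\left(\prod_{i=1}^r\frac{(u+h_i+\frac12)}{(u+h_i-\frac12)}\,\frac{(u-h_i+\frac12)}{(u-h_i-\frac12)}\right),$$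 where $\sigma_\rho$ is the algebra automorphism given by $\sigma_\rho(h_i)=h_i+\langle\rho,\varepsilon_i\rangle$ and $\pi_0$ is the Harish-Chandra isomorphism on $Z(U\mathfrak g)$.
   Context: Setup. $V=\mathbb C^N$ ($N=2r+1,2r,2r$ for $\mathfrak{so}_{2r+1},\mathfrak{sp}_{2r},\mathfrak{so}_{2r}$) has basis $\{v_i\mid i\in\hat V\}$, with $\hat V=\{-r,\dots,-1,0,1,\dots,r\}$ for $\mathfrak{so}_{2r+1}$ and $\hat V=\{-r,\dots,-1,1,\dots,r\}$ otherwise, and a nondegenerate bilinear form with $(v_1,v_2)=\epsilon(v_2,v_1)$ whose matrix $J$ is antidiagonal, with entries $1$ in the upper half and $\epsilon$ in the lower half. $\mathfrak g=\{x\in\mathfrak{gl}_N\mid x^tJ+Jx=0\}$ is spanned by $F_{ij}=E_{ij}-\theta_{ij}E_{-j,-i}$ ($i,j\in\hat V$), where $\theta_{ij}=1$ for $\mathfrak{so}$ and $\theta_{ij}=\mathrm{sgn}(i)\mathrm{sgn}(j)$ for $\mathfrak{sp}_{2r}$. $\mathfrak h$ has basis $F_{11},\dots,F_{rr}$, and $\varepsilon_i\in\mathfrak h^*$ is defined by $\varepsilon_i(F_{jj})=\delta_{ij}$; both bases are orthonormal for the form $\langle x,y\rangle=\frac12\mathrm{tr}_V(xy)$ and the induced form on $\mathfrak h^*$. Here $V=L(\varepsilon_1)$ is the defining module. $\{b\}$ is a basis of $\mathfrak g$, $\{b^*\}$ the dual basis, so $\gamma=\frac12\sum_{i,j\in\hat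 V}F_{ij}\otimes F_{ji}\in U\mathfrak g\otimes U\mathfrak g$. $\mathrm{id}\otimes\mathrm{tr}_V$ takes the trace of the second tensor factor acting on $V$. Positive roots: $\{\varepsilon_i\pm\varepsilon_j\mid 1\le i<j\le r\}$ together with $\{\varepsilon_i\}$ for $\mathfrak{so}_{2r+1}$, $\{2\varepsilon_i\}$ for $\mathfrak{sp}_{2r}$, nothing more for $\mathfrak{so}_{2r}$. $\rho$ is the half-sum of positive roots: $2\rho=\sum_{i=1}^r(y-2i+1)\varepsilon_i$. Harish-Chandra isomorphism. With triangular decomposition $\mathfrak g=\mathfrak n^-\oplus\mathfrak h\oplus\mathfrak n^+$ and $U\mathfrak g=U^-\otimes U_0\otimes U^+$, $U_0=U\mathfrak h=\mathbb C[h_1,\dots,h_r]$, let $\pi_0=\varepsilon^-\otimes\mathrm{id}\otimes\varepsilon^+:U\mathfrak g\to U_0$, where $\varepsilon^\pm:U^\pm\to\mathbb C$ are the algebra homomorphisms killing $\mathfrak n^\pm$. Its restriction to $Z(U\mathfrak g)$ is an algebra isomorphism $Z(U\mathfrak g)\to\sigma_\rho(U_0^{W_0})$ ($W_0$ the Weyl group), and $z\in Z(U\mathfrak g)$ acts on the irreducible highest weight module $L(\mu)$ by $\mathrm{ev}_\mu(\pi_0(z))$, where $\mathrm{ev}_\mu(h)=\mu(h)$. $u$ is a formal variable; $\pi_0$ and $\sigma_\rho$ are applied coefficientwise and rational functions in $u$ are expanded as series in $u^{-1}$. *)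

theory Defs
  imports
    "HOL-Algebra.QuotRing"
    "HOL-Algebra.Generated_Rings"
    "HOL-Library.Poly_Mapping"
    "HOL-Library.Product_Plus"
    "HOL-Computational_Algebra.Formal_Laurent_Series"
    Complex_Main
begin

section \<open>The classical Lie algebras\<close>

text \<open>\<open>SO_odd\<close>, \<open>SP\<close>, \<open>SO_even\<close> with rank parameter \<open>r\<close> stand for
  $so_{2r+1}$, $sp_{2r}$, $so_{2r}$.\<close>

datatype lie_kind = SO_odd | SP | SO_even

definition hatV :: "lie_kind \<Rightarrow> nat \<Rightarrow> int set" where
  "hatV L r = (if L = SO_odd then {- int r..int r} else {- int r..int r} - {0})"

definition y_val :: "lie_kind \<Rightarrow> nat \<Rightarrow> complex" where
  "y_val L r = (case L of SO_odd \<Rightarrow> 2 * of_nat r | SP \<Rightarrow> 2 * of_nat r + 1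
                        | SO_even \<Rightarrow> 2 * of_nat r - 1)"

definition eps_val :: "lie_kind \<Rightarrow> complex" where
  "eps_val L = (case L of SO_odd \<Rightarrow> 1 | SP \<Rightarrow> - 1 | SO_even \<Rightarrow> 1)"

text \<open>An endomorphism of \<open>V\<close> is its matrix in the basis \<open>v\<^sub>i\<close> (\<open>i \<in> hatV L r\<close>), extended by
  \<open>0\<close> to all integer indices.\<close>

type_synonym cmat = "int \<Rightarrow> int \<Rightarrow> complex"

definition gl :: "lie_kind \<Rightarrow> nat \<Rightarrow> cmat set" where
  "gl L r = {x. \<forall>i j. i \<notin> hatV L r \<or> j \<notin> hatV L r \<longrightarrow> x i j = 0}"

definition mmul :: "lie_kind \<Rightarrow> nat \<Rightarrow> cmat \<Rightarrow> cmat \<Rightarrow> cmat" where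
  "mmul L r x y = (\<lambda>i j. \<Sum>k\<in>hatV L r. x i k * y k j)"

definition mone :: "lie_kind \<Rightarrow> nat \<Rightarrow> cmat" where
  "mone L r = (\<lambda>i j. if i = j \<and> i \<in> hatV L r then 1 else 0)"

definition mtrace :: "lie_kind \<Rightarrow> nat \<Rightarrow> cmat \<Rightarrow> complex" where
  "mtrace L r x = (\<Sum>i\<in>hatV L r. x i i)"

definition madd :: "cmat \<Rightarrow> cmat \<Rightarrow> cmat" where
  "madd x y = (\<lambda>i j. x i j + y i j)"

definition mscale :: "complex \<Rightarrow> cmat \<Rightarrow> cmat" where
  "mscale c x = (\<lambda>i j. c * x i j)"

definition mtransp :: "cmat \<Rightarrow> cmat" where
  "mtransp x = (\<lambda>i j. x j i)"

definition mlincomb :: "cmat set \<Rightarrow> (cmat \<Rightarrow> complex) \<Rightarrow> cmat" where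
  "mlincomb S c = (\<lambda>i j. \<Sum>s\<in>S. c s * s i j)"

definition mspan :: "cmat set \<Rightarrow> cmat set" where
  "mspan S = {mlincomb T c | T c. finite T \<and> T \<subseteq> S}"

definition mbracket :: "lie_kind \<Rightarrow> nat \<Rightarrow> cmat \<Rightarrow> cmat \<Rightarrow> cmat" where
  "mbracket L r x y = (\<lambda>i j. mmul L r x y i j - mmul L r y x i j)"

text \<open>The antidiagonal Gram matrix \<open>J\<close>: rows with negative index form the upper half.
  The middle row of \<open>SO_odd\<close> has entry \<open>1\<close>, which equals \<open>\<epsilon>\<close> there.\<close>

definition Jmat :: "lie_kind \<Rightarrow> nat \<Rightarrow> cmat" where
  "Jmat L r = (\<lambda>i j. if i \<in> hatV L r \<and> j = - i then (if i \<le> 0 then 1 else eps_val L) else 0)"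

definition lie :: "lie_kind \<Rightarrow> nat \<Rightarrow> cmat set" where
  "lie L r = {x \<in> gl L r.
     madd (mmul L r (mtransp x) (Jmat L r)) (mmul L r (Jmat L r) x) = (\<lambda>i j. 0)}"

definition Emat :: "int \<Rightarrow> int \<Rightarrow> cmat" where
  "Emat i j = (\<lambda>k l. if k = i \<and> l = j then 1 else 0)"

definition theta :: "lie_kind \<Rightarrow> int \<Rightarrow> int \<Rightarrow> complex" where
  "theta L i j = (if L = SP then of_int (sgn i * sgn j) else 1)"

definition Fmat :: "lie_kind \<Rightarrow> int \<Rightarrow> int \<Rightarrow> cmat" where
  "Fmat L i j = (\<lambda>k l. Emat i j k l - theta L i j * Emat (- j) (- i) k l)"

definition lie_form :: "lie_kind \<Rightarrow> nat \<Rightarrow> cmat \<Rightarrow> cmat \<Rightarrow> complex" where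
  "lie_form L r x y = mtrace L r (mmul L r x y) / 2"

definition is_lie_basis :: "lie_kind \<Rightarrow> nat \<Rightarrow> cmat set \<Rightarrow> bool" where
  "is_lie_basis L r B \<longleftrightarrow> finite B \<and> B \<subseteq> lie L r \<and> lie L r \<subseteq> mspan B \<and>
     (\<forall>c. mlincomb B c = (\<lambda>i j. 0) \<longrightarrow> (\<forall>b\<in>B. c b = 0))"

definition is_dual_basis :: "lie_kind \<Rightarrow> nat \<Rightarrow> cmat set \<Rightarrow> (cmat \<Rightarrow> cmat) \<Rightarrow> bool" where
  "is_dual_basis L r B bstar \<longleftrightarrow> bstar ` B \<subseteq> lie L r \<and>
     (\<forall>a\<in>B. \<forall>b\<in>B. lie_form L r a (bstar b) = (if a = b then 1 else 0))"


section \<open>Roots and \<open>\<rho>\<close>\<close>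

text \<open>A weight \<open>\<Sum>i. \<lambda> i \<cdot> \<epsilon>\<^sub>i\<close> is its coefficient function, supported in \<open>{1..r}\<close>.  In these
  coordinates the value of the weight at \<open>h\<^sub>i = F\<^sub>i\<^sub>i\<close> is \<open>\<lambda> i\<close>.\<close>

type_synonym weight = "nat \<Rightarrow> complex"

definition epsw :: "nat \<Rightarrow> weight" where
  "epsw i = (\<lambda>k. if k = i then 1 else 0)"

definition pos_roots :: "lie_kind \<Rightarrow> nat \<Rightarrow> weight set" where
  "pos_roots L r =
     {\<lambda>k. epsw i k + epsw j k | i j. 1 \<le> i \<and> i < j \<and> j \<le> r} \<union>
     {\<lambda>k. epsw i k - epsw j k | i j. 1 \<le> i \<and> i < j \<and> j \<le> r} \<union>
     (case L of SO_odd \<Rightarrow> {epsw i | i. 1 \<le> i \<and> i \<le> r}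
              | SP \<Rightarrow> {\<lambda>k. 2 * epsw i k | i. 1 \<le> i \<and> i \<le> r}
              | SO_even \<Rightarrow> {})"

definition rho :: "lie_kind \<Rightarrow> nat \<Rightarrow> weight" where
  "rho L r = (\<lambda>k. (\<Sum>\<alpha>\<in>pos_roots L r. \<alpha> k) / 2)"

definition weight_form :: "nat \<Rightarrow> weight \<Rightarrow> weight \<Rightarrow> complex" where
  "weight_form r \<kappa> \<mu> = (\<Sum>k=1..r. \<kappa> k * \<mu> k)"

definition root_space :: "lie_kind \<Rightarrow> nat \<Rightarrow> weight \<Rightarrow> cmat set" where
  "root_space L r \<alpha> = {x \<in> lie L r.
     \<forall>k\<in>{1..r}. mbracket L r (Fmat L (int k) (int k)) x = mscale (\<alpha> k) x}"

definition n_plus :: "lie_kind \<Rightarrow> nat \<Rightarrow> cmat set" where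
  "n_plus L r = mspan (\<Union>\<alpha>\<in>pos_roots L r. root_space L r \<alpha>)"

definition n_minus :: "lie_kind \<Rightarrow> nat \<Rightarrow> cmat set" where
  "n_minus L r = mspan (\<Union>\<alpha>\<in>pos_roots L r. root_space L r (\<lambda>k. - \<alpha> k))"


section \<open>The universal enveloping algebra\<close>

text \<open>Words, with concatenation written additively, because the convolution product of
  \<open>_ \<Rightarrow>\<^sub>0 _\<close> is taken along \<open>+\<close> of the exponents.  Hence \<open>'a word \<Rightarrow>\<^sub>0 complex\<close> is the free
  associative unital algebra on \<open>'a\<close>.\<close>

datatype 'a word = Word (letters: "'a list")

instantiation word :: (type) monoid_add
begin

definition zero_word :: "'a word" where "zero_word = Word []"

definition plus_word :: "'a word \<Rightarrow> 'a word \<Rightarrow> 'a word" where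
  "plus_word v w = Word (letters v @ letters w)"

instance
  by standard (simp_all add: zero_word_def plus_word_def)

end

type_synonym free_alg = "cmat word \<Rightarrow>\<^sub>0 complex"
type_synonym free_alg2 = "(cmat word \<times> cmat word) \<Rightarrow>\<^sub>0 complex"

definition free_on :: "lie_kind \<Rightarrow> nat \<Rightarrow> free_alg ring" where
  "free_on L r = \<lparr>carrier = {a. \<forall>w\<in>Poly_Mapping.keys a. set (letters w) \<subseteq> lie L r},
     monoid.mult = (*), one = 1, zero = 0, add = (+)\<rparr>"

definition const :: "complex \<Rightarrow> ('k::zero \<Rightarrow>\<^sub>0 complex)" where
  "const c = Poly_Mapping.single 0 c"

definition gen :: "cmat \<Rightarrow> free_alg" where
  "gen x = Poly_Mapping.single (Word [x]) 1"

text \<open>The first two families of relations identify the quotient of the free algebra on the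
  underlying set of the Lie algebra with its tensor algebra.\<close>

definition U_rels :: "lie_kind \<Rightarrow> nat \<Rightarrow> free_alg set" where
  "U_rels L r =
     {gen (madd x y) - gen x - gen y | x y. x \<in> lie L r \<and> y \<in> lie L r} \<union>
     {gen (mscale c x) - const c * gen x | c x. x \<in> lie L r} \<union>
     {gen x * gen y - gen y * gen x - gen (mbracket L r x y) | x y. x \<in> lie L r \<and> y \<in> lie L r}"

definition U_ideal :: "lie_kind \<Rightarrow> nat \<Rightarrow> free_alg set" where
  "U_ideal L r = genideal (free_on L r) (U_rels L r)"

definition U :: "lie_kind \<Rightarrow> nat \<Rightarrow> free_alg set ring" where
  "U L r = free_on L r Quot U_ideal L r"

definition U_class :: "lie_kind \<Rightarrow> nat \<Rightarrow> free_alg \<Rightarrow> free_alg set" where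
  "U_class L r a = U_ideal L r +>\<^bsub>free_on L r\<^esub> a"

definition U_scalar :: "lie_kind \<Rightarrow> nat \<Rightarrow> complex \<Rightarrow> free_alg set" where
  "U_scalar L r c = U_class L r (const c)"

definition U_gen :: "lie_kind \<Rightarrow> nat \<Rightarrow> cmat \<Rightarrow> free_alg set" where
  "U_gen L r x = U_class L r (gen x)"


section \<open>The algebra \<open>U \<otimes> U\<close> and the partial trace\<close>

text \<open>With \<open>T\<close> the free algebra and \<open>U = T/I\<close>, the monoid algebra of pairs of words is
  \<open>T \<otimes> T\<close>, and \<open>U \<otimes> U\<close> is its quotient by \<open>I \<otimes> T + T \<otimes> I\<close>.\<close>

definition free2_on :: "lie_kind \<Rightarrow> nat \<Rightarrow> free_alg2 ring" where
  "free2_on L r = \<lparr>carrier = {t. \<forall>(v, w)\<in>Poly_Mapping.keys t. set (letters v) \<subseteq> lie L r \<and> set (letters w) \<subseteq> lie L r},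
     monoid.mult = (*), one = 1, zero = 0, add = (+)\<rparr>"

definition tens :: "free_alg \<Rightarrow> free_alg \<Rightarrow> free_alg2" where
  "tens a b = (\<Sum>v\<in>Poly_Mapping.keys a. \<Sum>w\<in>Poly_Mapping.keys b.
     Poly_Mapping.single (v, w) (Poly_Mapping.lookup a v * Poly_Mapping.lookup b w))"

definition UU_ideal :: "lie_kind \<Rightarrow> nat \<Rightarrow> free_alg2 set" where
  "UU_ideal L r = genideal (free2_on L r)
     ({tens a 1 | a. a \<in> U_ideal L r} \<union> {tens 1 a | a. a \<in> U_ideal L r})"

definition UU :: "lie_kind \<Rightarrow> nat \<Rightarrow> free_alg2 set ring" where
  "UU L r = free2_on L r Quot UU_ideal L r"

definition UU_class :: "lie_kind \<Rightarrow> nat \<Rightarrow> free_alg2 \<Rightarrow> free_alg2 set" where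
  "UU_class L r t = UU_ideal L r +>\<^bsub>free2_on L r\<^esub> t"

definition gamma :: "lie_kind \<Rightarrow> nat \<Rightarrow> cmat set \<Rightarrow> (cmat \<Rightarrow> cmat) \<Rightarrow> free_alg2 set" where
  "gamma L r B bstar = UU_class L r (\<Sum>b\<in>B. tens (gen b) (gen (bstar b)))"

definition word_on_V :: "lie_kind \<Rightarrow> nat \<Rightarrow> cmat word \<Rightarrow> cmat" where
  "word_on_V L r w = foldr (mmul L r) (letters w) (mone L r)"

text \<open>The map \<open>id \<otimes> tr\<^sub>V\<close>, first on \<open>T \<otimes> T\<close> and then induced on the quotients.\<close>

definition free_id_tr :: "lie_kind \<Rightarrow> nat \<Rightarrow> free_alg2 \<Rightarrow> free_alg" where
  "free_id_tr L r t = (\<Sum>(v, w)\<in>Poly_Mapping.keys t.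
     Poly_Mapping.single v (Poly_Mapping.lookup t (v, w) * mtrace L r (word_on_V L r w)))"

definition id_tr :: "lie_kind \<Rightarrow> nat \<Rightarrow> free_alg2 set \<Rightarrow> free_alg set" where
  "id_tr L r A = the_elem ((\<lambda>t. U_class L r (free_id_tr L r t)) ` A)"

definition zV :: "lie_kind \<Rightarrow> nat \<Rightarrow> cmat set \<Rightarrow> (cmat \<Rightarrow> cmat) \<Rightarrow> nat \<Rightarrow> free_alg set" where
  "zV L r B bstar l = U_scalar L r (eps_val L) \<otimes>\<^bsub>U L r\<^esub>
     id_tr L r ((UU_class L r (const (y_val L r / 2)) \<oplus>\<^bsub>UU L r\<^esub> gamma L r B bstar) [^]\<^bsub>UU L r\<^esub> l)"


section \<open>The Harish-Chandra projection\<close>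

text \<open>\<open>U\<^sub>0 = \<complex>[h\<^sub>1, \<dots>, h\<^sub>r]\<close> consists of the polynomials in the variables \<open>1, \<dots>, r\<close>.\<close>

type_synonym hpoly = "(nat \<Rightarrow>\<^sub>0 nat) \<Rightarrow>\<^sub>0 complex"

definition U0 :: "nat \<Rightarrow> hpoly set" where
  "U0 r = {p. \<forall>m\<in>Poly_Mapping.keys p. Poly_Mapping.keys m \<subseteq> {1..r}}"

definition hvar :: "nat \<Rightarrow> hpoly" where
  "hvar i = Poly_Mapping.single (Poly_Mapping.single i 1) 1"

definition U0_to_U :: "lie_kind \<Rightarrow> nat \<Rightarrow> hpoly \<Rightarrow> free_alg set" where
  "U0_to_U L r p = U_class L r (\<Sum>m\<in>Poly_Mapping.keys p. const (Poly_Mapping.lookup p m) *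
     prod_list (map (\<lambda>i. gen (Fmat L (int i) (int i)) ^ Poly_Mapping.lookup m i) [1..<Suc r]))"

definition U_subalg :: "lie_kind \<Rightarrow> nat \<Rightarrow> cmat set \<Rightarrow> free_alg set set" where
  "U_subalg L r S = generate_ring (U L r) (range (U_scalar L r) \<union> U_gen L r ` S)"

definition is_augmentation :: "lie_kind \<Rightarrow> nat \<Rightarrow> cmat set \<Rightarrow> (free_alg set \<Rightarrow> complex) \<Rightarrow> bool" where
  "is_augmentation L r S e \<longleftrightarrow>
     (\<forall>a\<in>U_subalg L r S. \<forall>b\<in>U_subalg L r S.
        e (a \<oplus>\<^bsub>U L r\<^esub> b) = e a + e b \<and> e (a \<otimes>\<^bsub>U L r\<^esub> b) = e a * e b) \<and>
     (\<forall>c. e (U_scalar L r c) = c) \<and>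
     (\<forall>x\<in>S. e (U_gen L r x) = 0)"

text \<open>An augmentation is determined on \<open>U_subalg L r S\<close>, and \<open>\<pi>\<^sub>0\<close> below on the carrier of
  \<open>U L r\<close>; the choice operator only fixes irrelevant values elsewhere.\<close>

definition aug :: "lie_kind \<Rightarrow> nat \<Rightarrow> cmat set \<Rightarrow> free_alg set \<Rightarrow> complex" where
  "aug L r S = (SOME e. is_augmentation L r S e)"

definition is_pi0 :: "lie_kind \<Rightarrow> nat \<Rightarrow> (free_alg set \<Rightarrow> hpoly) \<Rightarrow> bool" where
  "is_pi0 L r f \<longleftrightarrow>
     f ` carrier (U L r) \<subseteq> U0 r \<and>
     (\<forall>a\<in>carrier (U L r). \<forall>b\<in>carrier (U L r). f (a \<oplus>\<^bsub>U L r\<^esub> b) = f a + f b) \<and>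
     (\<forall>c. \<forall>a\<in>carrier (U L r). f (U_scalar L r c \<otimes>\<^bsub>U L r\<^esub> a) = const c * f a) \<and>
     (\<forall>a\<in>U_subalg L r (n_minus L r). \<forall>p\<in>U0 r. \<forall>b\<in>U_subalg L r (n_plus L r).
        f (a \<otimes>\<^bsub>U L r\<^esub> U0_to_U L r p \<otimes>\<^bsub>U L r\<^esub> b) =
          const (aug L r (n_minus L r) a) * p * const (aug L r (n_plus L r) b))"

definition pi0 :: "lie_kind \<Rightarrow> nat \<Rightarrow> free_alg set \<Rightarrow> hpoly" where
  "pi0 L r = (SOME f. is_pi0 L r f)"

text \<open>The algebra endomorphism of the polynomial ring substituting
  \<open>h\<^sub>i + \<langle>\<rho>, \<epsilon>\<^sub>i\<rangle>\<close> for \<open>h\<^sub>i\<close>.\<close>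

definition sigma_rho :: "lie_kind \<Rightarrow> nat \<Rightarrow> hpoly \<Rightarrow> hpoly" where
  "sigma_rho L r p = (\<Sum>m\<in>Poly_Mapping.keys p. const (Poly_Mapping.lookup p m) *
     (\<Prod>i\<in>Poly_Mapping.keys m. (hvar i + const (weight_form r (rho L r) (epsw i))) ^ Poly_Mapping.lookup m i))"


section \<open>Series in \<open>u\<^sup>-\<^sup>1\<close>\<close>

text \<open>Series in \<open>u\<^sup>-\<^sup>1\<close> over the polynomial ring are formal Laurent series whose indeterminate is
  \<open>u\<^sup>-\<^sup>1\<close>, so the coefficient at index \<open>n\<close> is that of \<open>u\<^sup>-\<^sup>n\<close> and \<open>u\<close> is \<open>fls_X_inv\<close>.
  Series over \<open>U L r\<close>, which is a ring record and not a type, are coefficient functions with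
  the same indexing.\<close>

abbreviation u :: "hpoly fls" where "u \<equiv> fls_X_inv"

definition hc :: "complex \<Rightarrow> hpoly fls" where
  "hc c = fls_const (const c)"

definition hv :: "nat \<Rightarrow> hpoly fls" where
  "hv i = fls_const (hvar i)"

text \<open>Expansion in \<open>u\<^sup>-\<^sup>1\<close> of a quotient whose denominator is monic in \<open>u\<close>.  The parameter \<open>1\<close>
  of \<^const>\<open>fps_right_inverse\<close> is the inverse of the leading coefficient.\<close>

definition monic_div :: "hpoly fls \<Rightarrow> hpoly fls \<Rightarrow> hpoly fls" where
  "monic_div f g = f * fls_right_inverse g 1"

definition sigma_rho_series :: "lie_kind \<Rightarrow> nat \<Rightarrow> hpoly fls \<Rightarrow> hpoly fls" where
  "sigma_rho_series L r f = Abs_fls (\<lambda>n. sigma_rho L r (fls_nth f n))"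

definition pi0_series :: "lie_kind \<Rightarrow> nat \<Rightarrow> (int \<Rightarrow> free_alg set) \<Rightarrow> hpoly fls" where
  "pi0_series L r c = Abs_fls (\<lambda>n. pi0 L r (c n))"

definition zV_series :: "lie_kind \<Rightarrow> nat \<Rightarrow> cmat set \<Rightarrow> (cmat \<Rightarrow> cmat) \<Rightarrow> int \<Rightarrow> free_alg set" where
  "zV_series L r B bstar n = (if n \<ge> 0 then zV L r B bstar (nat n) else \<zero>\<^bsub>U L r\<^esub>)"

text \<open>The series \<open>c\<^sub>1 u + c\<^sub>0\<close> over \<open>U L r\<close>.\<close>

definition lin_series :: "lie_kind \<Rightarrow> nat \<Rightarrow> complex \<Rightarrow> complex \<Rightarrow> int \<Rightarrow> free_alg set" where
  "lin_series L r c1 c0 n = U_scalar L r (if n = - 1 then c1 else if n = 0 then c0 else 0)"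

end

theory Submission
  imports Defs "Jordan_Normal_Form.Determinant"
begin

text \<open>The projection sends \<open>n\<^sup>- U + U n\<^sup>+\<close> to zero, and this already determines the images of the
  traces.  As a matrix over \<open>U\<close>, the element \<open>y/2 + \<gamma>\<close> is \<open>M\<close> with the entries
  \<open>M\<^sub>i\<^sub>j = y/2 \<delta>\<^sub>i\<^sub>j + F\<^sub>j\<^sub>i\<close> (\<open>dual_basis_expansion\<close>), and \<open>z\<^sub>V\<^sup>(\<^sup>l\<^sup>)\<close> is \<open>\<epsilon>\<close> times the trace of \<open>M\<^sup>l\<close>.  In
  the diagonal entry \<open>\<Sum>\<^sub>k M\<^sub>i\<^sub>k (M\<^sup>l)\<^sub>k\<^sub>i\<close> of the next power, order the indices
  \<open>1, \<dots>, r, 0, -r, \<dots>, -1\<close>.  If \<open>k\<close> comes after \<open>i\<close>, then \<open>F\<^sub>k\<^sub>i\<close> is in \<open>n\<^sup>-\<close> and the term is projected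
  to zero.  If \<open>k\<close> comes before \<open>i\<close>, then \<open>F\<^sub>k\<^sub>i\<close> is in \<open>n\<^sup>+\<close>, it can be replaced by its commutator
  with \<open>(M\<^sup>l)\<^sub>k\<^sub>i\<close>, and as \<open>\<gamma>\<close> is invariant (\<open>cpow_invariant\<close>) this is a multiple of
  \<open>(M\<^sup>l)\<^sub>k\<^sub>k - (M\<^sup>l)\<^sub>i\<^sub>i\<close>.  So the projections of the diagonal entries satisfy a triangular recursion
  (\<open>hc_fun_cpow\<close>).

  For the generating series \<open>t\<^sub>i\<close> of the projected diagonal entries of \<open>(u - M)\<^sup>-\<^sup>1\<close>, the recursion is a
  triangular linear system (\<open>tser_rec\<close>).  With \<open>l\<^sub>i = h\<^sub>i + \<rho>\<^sub>i\<close>, the partial sums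
  \<open>P\<^sub>j = 1 + t\<^sub>1 + \<dots> + t\<^sub>j\<close> satisfy \<open>(u - l\<^sub>j - 1/2) P\<^sub>j = (u - l\<^sub>j + 1/2) P\<^sub>j\<^sub>-\<^sub>1\<close>, which gives one half of
  the product (\<open>Pser_step\<close>).  For negative indices the coefficient of \<open>F\<^sub>j\<^sub>,\<^sub>-\<^sub>j\<close> disturbs
  this pattern: the partial sums \<open>Q\<^sub>j\<close> up to the index \<open>-j\<close> obey a recursion that also contains \<open>t\<^sub>j\<close>.
  However, \<open>Y\<^sub>j = \<epsilon> u Q\<^sub>j\<^sub>+\<^sub>1 - P\<^sub>j/2\<close> again satisfies a product recursion
  (\<open>Yser_step\<close>), and \<open>Y\<^sub>0\<close> is the projection of \<open>z\<^sub>V(u) + \<epsilon> u - 1/2\<close>.  The remaining factor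
  comes from \<open>Y\<^sub>r\<close> (\<open>Yser_middle\<close>).

  The projection itself is defined by a choice, so it has to be shown that a linear map with its
  properties exists and that it is unique.  Uniqueness follows from
  \<open>U = U\<^sup>- U\<^sub>0 U\<^sup>+\<close>, by sorting words modulo shorter words (\<open>tri_word\<close>).  For existence no basis of \<open>U\<close>
  is needed.  On a highest weight module, the projection is the matrix coefficient of the
  highest weight vector.  As a function on the group, this is a product of powers of the leading
  principal minors of the matrix of the defining representation, where the exponents are differences of
  the coordinates \<open>h\<^sub>i\<close> of the highest weight.
  Its derivatives at the identity make sense for formal exponents.  A function on the group is
  represented here by a function on words of elements of the Lie algebra, and the product of
  functions by the shuffle product.  The minors are eigenvectors of the two-sided
  derivatives along the triangular subalgebras, hence so is the product of their powers
  (\<open>Dl_hcf\<close>, \<open>Dr_hcf\<close>), and it respects the defining relations of \<open>U\<close> (\<open>compat_hcf\<close>).\<close>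

section \<open>The shuffle algebra\<close>

text \<open>A function \<open>F\<close> on a Lie group gives a function on the words in its Lie algebra: the value at
  \<open>x\<^sub>1 \<dots> x\<^sub>n\<close> is the mixed derivative of \<open>F\<close> at the identity along \<open>x\<^sub>1, \<dots>, x\<^sub>n\<close>.  By the Leibniz rule, multiplication of functions becomes the shuffle product: the
  value on \<open>w\<close> is the sum over all ways to split \<open>w\<close> into two complementary subwords.  The
  algebra below does this without a group.\<close>

typedef ('a, 'b) shuf = "UNIV :: ('a list \<Rightarrow> 'b) set"
  morphisms ev Shuf by simp

lemma ev_Shuf [simp]: "ev (Shuf f) = f"
  by (simp add: Shuf_inverse)

lemma shuf_eqI: "(\<And>w. ev f w = ev g w) \<Longrightarrow> f = g"
  by (metis ev_inverse ext)

lemma shuf_eq_iff: "f = g \<longleftrightarrow> (\<forall>w. ev f w = ev g w)"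
  by (auto intro: shuf_eqI)

primrec shmul :: "'a list \<Rightarrow> ('a list \<Rightarrow> 'b::comm_ring_1) \<Rightarrow> ('a list \<Rightarrow> 'b) \<Rightarrow> 'b" where
  "shmul [] f g = f [] * g []"
| "shmul (x # w) f g = shmul w (\<lambda>v. f (x # v)) g + shmul w f (\<lambda>v. g (x # v))"

lemma shmul_commute: "shmul w f g = shmul w g f"
  by (induction w arbitrary: f g) (simp_all add: mult.commute add.commute)

lemma shmul_add_left: "shmul w (\<lambda>v. f v + g v) h = shmul w f h + shmul w g h"
  by (induction w arbitrary: f g h) (simp_all add: algebra_simps)

lemma shmul_scale_left: "shmul w (\<lambda>v. c * f v) h = c * shmul w f h"
  by (induction w arbitrary: f h) (simp_all add: algebra_simps)

lemma shmul_zero_left: "shmul w (\<lambda>v. 0) h = 0"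
  using shmul_scale_left[of w 0 "\<lambda>v. 0" h] by simp

lemma shmul_add_right: "shmul w h (\<lambda>v. f v + g v) = shmul w h f + shmul w h g"
  by (simp add: shmul_commute[of w h] shmul_add_left)

lemma shmul_const_left: "shmul w (\<lambda>v. if v = [] then c else 0) f = c * f w"
  by (induction w arbitrary: f) (simp_all add: shmul_zero_left)

lemma shmul_assoc: "shmul w (\<lambda>v. shmul v f g) h = shmul w f (\<lambda>v. shmul v g h)"
  by (induction w arbitrary: f g h)
     (simp_all add: shmul_add_left shmul_add_right algebra_simps)

lemma shmul_append:
  "shmul (w @ [x]) f g = shmul w (\<lambda>v. f (v @ [x])) g + shmul w f (\<lambda>v. g (v @ [x]))"
  by (induction w arbitrary: f g) (simp_all add: algebra_simps)

instantiation shuf :: (type, comm_ring_1) comm_ring_1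
begin

definition zero_shuf :: "('a, 'b) shuf" where "zero_shuf = Shuf (\<lambda>w. 0)"
definition one_shuf :: "('a, 'b) shuf" where "one_shuf = Shuf (\<lambda>w. if w = [] then 1 else 0)"
definition plus_shuf :: "('a, 'b) shuf \<Rightarrow> ('a, 'b) shuf \<Rightarrow> ('a, 'b) shuf" where
  "plus_shuf f g = Shuf (\<lambda>w. ev f w + ev g w)"
definition minus_shuf :: "('a, 'b) shuf \<Rightarrow> ('a, 'b) shuf \<Rightarrow> ('a, 'b) shuf" where
  "minus_shuf f g = Shuf (\<lambda>w. ev f w - ev g w)"
definition uminus_shuf :: "('a, 'b) shuf \<Rightarrow> ('a, 'b) shuf" where
  "uminus_shuf f = Shuf (\<lambda>w. - ev f w)"
definition times_shuf :: "('a, 'b) shuf \<Rightarrow> ('a, 'b) shuf \<Rightarrow> ('a, 'b) shuf" where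
  "times_shuf f g = Shuf (\<lambda>w. shmul w (ev f) (ev g))"

instance
proof
  fix a b c :: "('a, 'b) shuf"
  show "a * b * c = a * (b * c)"
    by (rule shuf_eqI) (simp add: times_shuf_def shmul_assoc)
  show "a * b = b * a"
    by (rule shuf_eqI) (simp add: times_shuf_def shmul_commute)
  show "1 * a = a"
    by (rule shuf_eqI) (simp add: times_shuf_def one_shuf_def shmul_const_left)
  show "(a + b) * c = a * c + b * c"
    by (rule shuf_eqI) (simp add: times_shuf_def plus_shuf_def shmul_add_left)
  show "(0::('a, 'b) shuf) \<noteq> 1"
  proof
    assume "(0::('a, 'b) shuf) = 1"
    then have "ev (0::('a, 'b) shuf) [] = ev (1::('a, 'b) shuf) []" by simp
    then show False by (simp add: zero_shuf_def one_shuf_def)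
  qed
qed (rule shuf_eqI, simp add: plus_shuf_def zero_shuf_def minus_shuf_def uminus_shuf_def algebra_simps)+

end

lemma ev_zero [simp]: "ev 0 w = 0" by (simp add: zero_shuf_def)
lemma ev_one: "ev 1 w = (if w = [] then 1 else 0)" by (simp add: one_shuf_def)
lemma ev_add [simp]: "ev (f + g) w = ev f w + ev g w" by (simp add: plus_shuf_def)
lemma ev_diff [simp]: "ev (f - g) w = ev f w - ev g w" by (simp add: minus_shuf_def)
lemma ev_minus [simp]: "ev (- f) w = - ev f w" by (simp add: uminus_shuf_def)
lemma ev_sum [simp]: "ev (sum f A) w = (\<Sum>a\<in>A. ev (f a) w)"
  by (induction A rule: infinite_finite_induct) simp_all
lemma ev_mult: "ev (f * g) w = shmul w (ev f) (ev g)" by (simp add: times_shuf_def)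
lemma ev_mult_Nil [simp]: "ev (f * g) [] = ev f [] * ev g []" by (simp add: ev_mult)
lemma ev_prod_Nil: "ev (prod f A) [] = (\<Prod>a\<in>A. ev (f a) [])"
  by (induction A rule: infinite_finite_induct) (simp_all add: ev_one)

definition scal :: "'b \<Rightarrow> ('a, 'b::comm_ring_1) shuf" where
  "scal c = Shuf (\<lambda>w. if w = [] then c else 0)"

lemma ev_scal: "ev (scal c) w = (if w = [] then c else 0)" by (simp add: scal_def)

lemma ev_scal_mult [simp]: "ev (scal c * f) w = c * ev f w"
  by (simp add: ev_mult scal_def shmul_const_left)

lemma scal_0 [simp]: "scal 0 = 0"
  by (rule shuf_eqI) (simp add: ev_scal)
lemma scal_1 [simp]: "scal 1 = 1"
  by (rule shuf_eqI) (simp add: ev_scal ev_one)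
lemma scal_add: "scal (a + b) = scal a + scal b"
  by (rule shuf_eqI) (simp add: ev_scal)
lemma scal_mult: "scal (a * b) = scal a * scal b"
  by (rule shuf_eqI) (simp add: ev_scal)
lemma scal_sum: "scal (sum f A) = (\<Sum>a\<in>A. scal (f a))"
  by (induction A rule: infinite_finite_induct) (simp_all add: scal_add)

text \<open>The derivatives along \<open>x\<close> from the two sides of the group.  Both are derivations of the shuffle
  product.\<close>

definition Dl :: "'a \<Rightarrow> ('a, 'b) shuf \<Rightarrow> ('a, 'b) shuf" where
  "Dl x f = Shuf (\<lambda>w. ev f (x # w))"

definition Dr :: "'a \<Rightarrow> ('a, 'b) shuf \<Rightarrow> ('a, 'b) shuf" where
  "Dr x f = Shuf (\<lambda>w. ev f (w @ [x]))"

lemma ev_Dl [simp]: "ev (Dl x f) w = ev f (x # w)" by (simp add: Dl_def)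
lemma ev_Dr [simp]: "ev (Dr x f) w = ev f (w @ [x])" by (simp add: Dr_def)

definition derivation :: "('c::comm_ring_1 \<Rightarrow> 'c) \<Rightarrow> bool" where
  "derivation D \<longleftrightarrow> (\<forall>f g. D (f + g) = D f + D g) \<and> (\<forall>f g. D (f * g) = D f * g + f * D g)"

lemma derivation_Dl: "derivation (Dl x :: ('a, 'b::comm_ring_1) shuf \<Rightarrow> _)"
  unfolding derivation_def by (auto intro!: shuf_eqI simp: ev_mult Dl_def)

lemma derivation_Dr: "derivation (Dr x :: ('a, 'b::comm_ring_1) shuf \<Rightarrow> _)"
  unfolding derivation_def by (auto intro!: shuf_eqI simp: ev_mult Dr_def shmul_append)

lemma Dl_scal_mult: "Dl x (scal c * f) = scal c * Dl x f"
  by (rule shuf_eqI) simp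
lemma Dr_scal_mult: "Dr x (scal c * f) = scal c * Dr x f"
  by (rule shuf_eqI) simp

context
  fixes D :: "'c::comm_ring_1 \<Rightarrow> 'c"
  assumes D: "derivation D"
begin

lemma derivation_add: "D (f + g) = D f + D g" using D by (auto simp: derivation_def)
lemma derivation_mult: "D (f * g) = D f * g + f * D g" using D by (auto simp: derivation_def)
lemma derivation_0: "D 0 = 0" using derivation_add[of 0 0] by simp
lemma derivation_1: "D 1 = 0" using derivation_mult[of 1 1] by simp
lemma derivation_minus: "D (- f) = - D f"
  by (metis add.right_inverse derivation_0 derivation_add minus_unique)
lemma derivation_diff: "D (f - g) = D f - D g"
  by (metis derivation_add derivation_minus diff_conv_add_uminus)
lemma derivation_sum: "D (sum f A) = (\<Sum>a\<in>A. D (f a))"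
  by (induction A rule: infinite_finite_induct) (simp_all add: derivation_0 derivation_add)
lemma derivation_of_nat: "D (of_nat n) = 0"
  by (induction n) (simp_all add: derivation_0 derivation_add derivation_1)
lemma derivation_of_int: "D (of_int n) = 0"
  by (cases n) (auto simp only: of_int_minus of_int_of_nat_eq derivation_of_nat derivation_minus minus_zero)

lemma derivation_power: "D (f ^ Suc n) = of_nat (Suc n) * f ^ n * D f"
proof (induction n)
  case (Suc n)
  have "D (f ^ Suc (Suc n)) = D f * f ^ Suc n + f * (of_nat (Suc n) * f ^ n * D f)"
    by (subst power_Suc, subst derivation_mult, subst Suc) simp
  then show ?case by (simp add: algebra_simps)
qed simp

lemma derivation_prod:
  "finite A \<Longrightarrow> D (\<Prod>a\<in>A. f a) = (\<Sum>a\<in>A. \<Prod>b\<in>A. if b = a then D (f a) else f b)"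
proof (induction A rule: finite_induct)
  case empty
  then show ?case by (simp add: derivation_1)
next
  case (insert x A)
  have 1: "(\<Prod>b\<in>A. if b = x then D (f x) else f b) = (\<Prod>b\<in>A. f b)"
    using insert by (intro prod.cong) auto
  have 2: "(\<Sum>a\<in>A. (if x = a then D (f a) else f x) * (\<Prod>b\<in>A. if b = a then D (f a) else f b))
         = f x * (\<Sum>a\<in>A. \<Prod>b\<in>A. if b = a then D (f a) else f b)"
    unfolding sum_distrib_left using insert by (intro sum.cong) auto
  show ?case using insert by (simp add: derivation_mult 1 2)
qed

text \<open>The logarithmic derivative of a product is the sum of the logarithmic derivatives.\<close>

lemma derivation_prod_semi_invariant:
  assumes "\<And>a. a \<in> A \<Longrightarrow> D (f a) = s a * f a"
  shows "D (\<Prod>a\<in>A. f a) = (\<Sum>a\<in>A. s a) * (\<Prod>a\<in>A. f a)"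
  using assms
  by (induction A rule: infinite_finite_induct)
     (simp_all add: derivation_1 derivation_0 derivation_mult algebra_simps)

text \<open>The derivative of the determinant replaces one row at a time by its derivative.  That row
  is a combination of the rows of the matrix, and all terms but the diagonal ones have a
  repeated row.\<close>

lemma derivation_det:
  assumes A: "\<And>i j. i < n \<Longrightarrow> j < n \<Longrightarrow> D (a i j) = (\<Sum>l<n. x i l * a l j)"
  shows "D (det (mat n n (\<lambda>(i, j). a i j))) = (\<Sum>i<n. x i i) * det (mat n n (\<lambda>(i, j). a i j))"
proof -
  let ?P = "{p. p permutes {0..<n}}"
  let ?B = "\<lambda>i l. mat n n (\<lambda>(k, j). if k = i then a l j else a k j)"
  have fin: "finite ?P" by (simp add: finite_permutations)
  have det: "det (mat n n (\<lambda>(k, j). b k j)) = (\<Sum>p\<in>?P. signof p * (\<Prod>k = 0..<n. b k (p k)))"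
    for b :: "nat \<Rightarrow> nat \<Rightarrow> 'c"
  proof -
    have "(\<Prod>k = 0..<n. mat n n (\<lambda>(k, j). b k j) $$ (k, p k)) = (\<Prod>k = 0..<n. b k (p k))"
      if "p permutes {0..<n}" for p
      using that by (intro prod.cong refl) (auto simp: permutes_in_image)
    then show ?thesis unfolding det_def'[OF mat_carrier] by simp
  qed
  have "D (det (mat n n (\<lambda>(i, j). a i j)))
      = D (\<Sum>p\<in>?P. signof p * (\<Prod>i = 0..<n. a i (p i)))"
    by (simp only: det)
  also have "\<dots> = (\<Sum>p\<in>?P. signof p * D (\<Prod>i = 0..<n. a i (p i)))"
    by (simp add: derivation_sum derivation_mult derivation_of_int)
  also have "\<dots> = (\<Sum>p\<in>?P. \<Sum>i = 0..<n. \<Sum>l<n. x i l *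
      (signof p * (\<Prod>k = 0..<n. if k = i then a l (p k) else a k (p k))))"
  proof (rule sum.cong[OF refl])
    fix p assume p: "p \<in> ?P"
    have pr: "(\<Prod>k = 0..<n. if k = i then b else a k (p k)) = b * (\<Prod>k\<in>{0..<n}-{i}. a k (p k))"
      if "i < n" for b i
    proof -
      have "(\<Prod>k = 0..<n. if k = i then b else a k (p k)) =
        b * (\<Prod>k\<in>{0..<n}-{i}. if k = i then b else a k (p k))"
        using that by (subst prod.remove[of _ i]) auto
      also have "(\<Prod>k\<in>{0..<n}-{i}. if k = i then b else a k (p k)) = (\<Prod>k\<in>{0..<n}-{i}. a k (p k))"
        by (intro prod.cong) auto
      finally show ?thesis .
    qed
    have pr': "(\<Prod>k = 0..<n. if k = i then a l (p k) else a k (p k)) = a l (p i) * (\<Prod>k\<in>{0..<n}-{i}. a k (p k))"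
      if "i < n" for i l
      by (subst pr[OF that, of "a l (p i)", symmetric], rule prod.cong) auto
    have "D (\<Prod>i = 0..<n. a i (p i)) = (\<Sum>i = 0..<n. D (a i (p i)) * (\<Prod>k\<in>{0..<n}-{i}. a k (p k)))"
      by (subst derivation_prod) (auto intro!: sum.cong simp: pr)
    also have "\<dots> = (\<Sum>i = 0..<n. (\<Sum>l<n. x i l * a l (p i)) * (\<Prod>k\<in>{0..<n}-{i}. a k (p k)))"
      using p A by (intro sum.cong) (auto simp: permutes_in_image)
    finally show "signof p * D (\<Prod>i = 0..<n. a i (p i)) = (\<Sum>i = 0..<n. \<Sum>l<n. x i l *
      (signof p * (\<Prod>k = 0..<n. if k = i then a l (p k) else a k (p k))))"
      by (simp only: sum_distrib_left sum_distrib_right, intro sum.cong refl)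
         (auto simp: pr' mult_ac)
  qed
  also have "\<dots> = (\<Sum>i = 0..<n. \<Sum>l<n. x i l * det (?B i l))"
    unfolding det sum_distrib_left
    by (subst sum.swap, rule sum.cong[OF refl], subst sum.swap) simp
  also have "\<dots> = (\<Sum>i = 0..<n. \<Sum>l<n. if l = i then x i i * det (mat n n (\<lambda>(i, j). a i j)) else 0)"
  proof (intro sum.cong refl)
    fix i l assume il: "i \<in> {0..<n}" "l \<in> {..<n}"
    have "det (?B i l) = 0" if "l \<noteq> i"
      using il that by (intro det_identical_rows[of _ n i l]) auto
    moreover have "?B i i = mat n n (\<lambda>(i, j). a i j)" by (rule cong_mat) auto
    ultimately show "x i l * det (?B i l) = (if l = i then x i i * det (mat n n (\<lambda>(i, j). a i j)) else 0)"
      by auto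
  qed
  also have "\<dots> = (\<Sum>i<n. x i i) * det (mat n n (\<lambda>(i, j). a i j))"
    by (simp add: sum_distrib_right atLeast0LessThan)
  finally show ?thesis .
qed

end

section \<open>Powers with a formal exponent\<close>

lemma shmul_eq_0_short:
  assumes "\<And>v. length v < i \<Longrightarrow> f v = 0" "\<And>v. length v < j \<Longrightarrow> g v = 0" "length w < i + j"
  shows "shmul w f g = 0"
  using assms
proof (induction w arbitrary: f g i j)
  case Nil
  then show ?case by (cases i) auto
next
  case (Cons x w)
  have "shmul w (\<lambda>v. f (x # v)) g = 0"
    by (rule Cons.IH[of "i - 1" _ j]) (use Cons.prems in auto)
  moreover have "shmul w f (\<lambda>v. g (x # v)) = 0"
    by (rule Cons.IH[of i _ "j - 1"]) (use Cons.prems in auto)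
  ultimately show ?case by simp
qed

lemma ev_power_short:
  assumes "ev p [] = 0" "length w < j"
  shows "ev (p ^ j) w = 0"
  using assms(2)
proof (induction j arbitrary: w)
  case (Suc j)
  then show ?case
    using assms(1) by (auto simp: ev_mult intro: shmul_eq_0_short[where i = 1 and j = j])
qed simp

text \<open>The binomial series of a power \<open>p\<^sup>g\<close> with \<open>c\<^sub>j\<close> in the role of the binomial coefficient of \<open>g\<close> over
  \<open>j\<close>.  It is finite on every word, because \<open>(p - 1)\<^sup>j\<close> vanishes on words shorter than \<open>j\<close>
  if \<open>p\<close> has the value 1 on the empty word.\<close>

definition spow :: "(nat \<Rightarrow> 'b::comm_ring_1) \<Rightarrow> ('a, 'b) shuf \<Rightarrow> ('a, 'b) shuf" where
  "spow c p = Shuf (\<lambda>w. \<Sum>j\<le>length w. c j * ev ((p - 1) ^ j) w)"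

lemma ev_spow:
  assumes "ev p [] = 1" "length w \<le> n"
  shows "ev (spow c p) w = ev (\<Sum>j\<le>n. scal (c j) * (p - 1) ^ j) w"
proof -
  have "(\<Sum>j\<le>n. c j * ev ((p - 1) ^ j) w) = (\<Sum>j\<le>length w. c j * ev ((p - 1) ^ j) w)"
    using assms by (intro sum.mono_neutral_right) (auto simp: ev_power_short ev_one)
  then show ?thesis by (simp add: spow_def)
qed

lemma ev_spow_Nil: "ev p [] = 1 \<Longrightarrow> c 0 = 1 \<Longrightarrow> ev (spow c p) [] = 1"
  by (simp add: spow_def ev_one)

text \<open>If \<open>p\<close> is multiplied by \<open>t\<close>, then \<open>p\<^sup>g\<close> is multiplied by \<open>t g\<close>.  The assumption on \<open>c\<close> is the recursion
  of the binomial coefficients, and \<open>\<sigma>\<close> lengthens words by one letter, so the partial sum to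
  \<open>n + 1\<close> decides the derivative on words of length \<open>n\<close>; its last term vanishes there.\<close>

lemma spow_semi_invariant:
  fixes D :: "('a, 'b::comm_ring_1) shuf \<Rightarrow> ('a, 'b) shuf"
  assumes D: "derivation D" "\<And>a f. D (scal a * f) = scal a * D f"
    and shift: "\<And>f w. ev (D f) w = ev f (\<sigma> w)" "\<And>w. length (\<sigma> w) = Suc (length w)"
    and p: "ev p [] = 1" "D p = scal t * p"
    and c: "\<And>j. of_nat (Suc j) * c (Suc j) + of_nat j * c j = g * c j"
  shows "D (spow c p) = scal (t * g) * spow c p"
proof (rule shuf_eqI)
  fix w :: "'a list"
  define q n where "q = p - 1" and "n = length w"
  have Dq: "D q = scal t * (1 + q)"
    by (simp add: q_def derivation_diff[OF D(1)] derivation_1[OF D(1)] p)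
  have scn: "scal (of_nat k) = (of_nat k :: ('a, 'b) shuf)" for k
    by (induction k) (simp_all add: scal_add)
  let ?T = "\<Sum>j\<le>n. scal (of_nat (Suc j) * c (Suc j)) * q ^ j"
  have "D (\<Sum>j\<le>Suc n. scal (c j) * q ^ j) = (\<Sum>j\<le>Suc n. scal (c j) * D (q ^ j))"
    by (simp add: derivation_sum[OF D(1)] D(2) derivation_add[OF D(1)])
  also have "\<dots> = (\<Sum>j\<le>n. scal (c (Suc j)) * D (q ^ Suc j))"
    by (subst sum.atMost_Suc_shift) (simp add: derivation_1[OF D(1)])
  also have "\<dots> = (\<Sum>j\<le>n. scal t * (scal (of_nat (Suc j) * c (Suc j)) * q ^ j
      + scal (of_nat (Suc j) * c (Suc j)) * q ^ Suc j))"
    by (intro sum.cong refl)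
       (simp only: derivation_power[OF D(1)] Dq scal_mult scn, simp add: algebra_simps)
  also have "\<dots> = scal t * (?T + (\<Sum>j\<le>n. scal (of_nat (Suc j) * c (Suc j)) * q ^ Suc j))"
    by (simp only: sum_distrib_left[symmetric] sum.distrib)
  also have "(\<Sum>j\<le>n. scal (of_nat (Suc j) * c (Suc j)) * q ^ Suc j)
      = (\<Sum>j\<le>Suc n. scal (of_nat j * c j) * q ^ j)"
    by (subst sum.atMost_Suc_shift) simp
  also have "\<dots> = (\<Sum>j\<le>n. scal (of_nat j * c j) * q ^ j) + scal (of_nat (Suc n) * c (Suc n)) * q ^ Suc n"
    by simp
  also have "?T + ((\<Sum>j\<le>n. scal (of_nat j * c j) * q ^ j) + scal (of_nat (Suc n) * c (Suc n)) * q ^ Suc n)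
     = (\<Sum>j\<le>n. scal (g * c j) * q ^ j) + scal (of_nat (Suc n) * c (Suc n)) * q ^ Suc n"
    by (simp only: add.assoc[symmetric] sum.distrib[symmetric] distrib_right[symmetric]
        scal_add[symmetric] c)
  finally have E: "D (\<Sum>j\<le>Suc n. scal (c j) * q ^ j) = scal t * ((\<Sum>j\<le>n. scal (g * c j) * q ^ j)
     + scal (of_nat (Suc n) * c (Suc n)) * q ^ Suc n)" .
  have short: "ev (q ^ Suc n) w = 0"
    by (rule ev_power_short) (simp_all add: q_def p ev_one n_def)
  have "ev (D (spow c p)) w = ev (D (\<Sum>j\<le>Suc n. scal (c j) * q ^ j)) w"
    unfolding shift(1) q_def using p(1) by (intro ev_spow) (auto simp: shift(2) n_def)
  also have "\<dots> = t * ev (\<Sum>j\<le>n. scal (g * c j) * q ^ j) w"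
    unfolding E ev_scal_mult ev_add short by simp
  also have "\<dots> = t * g * ev (\<Sum>j\<le>n. scal (c j) * q ^ j) w"
    unfolding ev_sum ev_scal_mult sum_distrib_left by (intro sum.cong refl) (simp add: mult_ac)
  also have "\<dots> = t * g * ev (spow c p) w"
    unfolding q_def using p(1) by (subst ev_spow[of _ _ n]) (auto simp: n_def)
  finally show "ev (D (spow c p)) w = ev (scal (t * g) * spow c p) w" by simp
qed

section \<open>Functionals compatible with the relations of the enveloping algebra\<close>

text \<open>A functional that satisfies this for all \<open>v\<close> vanishes on \<open>a \<rho> b\<close> for all words \<open>a\<close>, \<open>b\<close>
  and all defining relations \<open>\<rho>\<close> of the enveloping algebra.  The relations are
  primitive for the coproduct dual to the shuffle product, which is why these functionals form a
  subalgebra.\<close>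

definition compat :: "lie_kind \<Rightarrow> nat \<Rightarrow> cmat list \<Rightarrow> (cmat, hpoly) shuf \<Rightarrow> bool" where
  "compat L r v f \<longleftrightarrow>
    (\<forall>x y w. ev f (v @ x # y # w) - ev f (v @ y # x # w) = ev f (v @ mbracket L r x y # w)) \<and>
    (\<forall>x y w. ev f (v @ madd x y # w) = ev f (v @ x # w) + ev f (v @ y # w)) \<and>
    (\<forall>x c w. ev f (v @ mscale c x # w) = const c * ev f (v @ x # w))"

lemma compat_Nil: "compat L r [] f \<longleftrightarrow>
   (\<forall>x y. Dl y (Dl x f) - Dl x (Dl y f) = Dl (mbracket L r x y) f) \<and>
   (\<forall>x y. Dl (madd x y) f = Dl x f + Dl y f) \<and>
   (\<forall>x c. Dl (mscale c x) f = scal (const c) * Dl x f)"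
  unfolding compat_def shuf_eq_iff ev_diff ev_add ev_scal_mult ev_Dl append_Nil by (rule refl)

lemma compat_Cons: "compat L r (x # v) f \<longleftrightarrow> compat L r v (Dl x f)"
  by (simp add: compat_def)

lemma compatD:
  assumes "compat L r v f"
  shows "ev f (v @ mbracket L r x y # w) = ev f (v @ x # y # w) - ev f (v @ y # x # w)"
    and "ev f (v @ madd x y # w) = ev f (v @ x # w) + ev f (v @ y # w)"
    and "ev f (v @ mscale c x # w) = const c * ev f (v @ x # w)"
  using assms unfolding compat_def by metis+

lemma compatI:
  assumes "\<And>x y w. ev f (v @ mbracket L r x y # w) = ev f (v @ x # y # w) - ev f (v @ y # x # w)"
    and "\<And>x y w. ev f (v @ madd x y # w) = ev f (v @ x # w) + ev f (v @ y # w)"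
    and "\<And>x c w. ev f (v @ mscale c x # w) = const c * ev f (v @ x # w)"
  shows "compat L r v f"
  unfolding compat_def using assms by metis

lemma compat_add: "compat L r v f \<Longrightarrow> compat L r v g \<Longrightarrow> compat L r v (f + g)"
  by (rule compatI) (simp_all only: ev_add compatD distrib_left add_diff_add add.assoc add.left_commute)

lemma compat_scal: "compat L r v f \<Longrightarrow> compat L r v (scal c * f)"
  by (rule compatI) (simp_all only: ev_scal_mult compatD right_diff_distrib distrib_left mult.left_commute)

lemma compat_0: "compat L r v 0"
  unfolding compat_def by auto

lemma compat_1: "compat L r v 1"
  unfolding compat_def by (auto simp: ev_one)

lemma compat_sum: "(\<And>a. a \<in> A \<Longrightarrow> compat L r v (f a)) \<Longrightarrow> compat L r v (sum f A)"
  by (induction A rule: infinite_finite_induct) (auto intro: compat_add compat_0)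

lemma compat_mult:
  assumes "\<And>v. compat L r v f" "\<And>v. compat L r v g"
  shows "compat L r v (f * g)"
  using assms
proof (induction v arbitrary: f g)
  case Nil
  note d = derivation_mult[OF derivation_Dl] derivation_add[OF derivation_Dl]
  have f: "\<And>x y. Dl (mbracket L r x y) f = Dl y (Dl x f) - Dl x (Dl y f)"
    "\<And>x y. Dl (madd x y) f = Dl x f + Dl y f" "\<And>x c. Dl (mscale c x) f = scal (const c) * Dl x f"
    using Nil(1)[of "[]"] unfolding compat_Nil by auto
  have g: "\<And>x y. Dl (mbracket L r x y) g = Dl y (Dl x g) - Dl x (Dl y g)"
    "\<And>x y. Dl (madd x y) g = Dl x g + Dl y g" "\<And>x c. Dl (mscale c x) g = scal (const c) * Dl x g"
    using Nil(2)[of "[]"] unfolding compat_Nil by auto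
  show ?case
    unfolding compat_Nil by (auto simp: d f g algebra_simps)
next
  case (Cons x v)
  have "\<And>v. compat L r v (Dl x f)" "\<And>v. compat L r v (Dl x g)"
    using Cons.prems by (simp_all flip: compat_Cons)
  then show ?case
    unfolding compat_Cons derivation_mult[OF derivation_Dl]
    using Cons by (intro compat_add) auto
qed

lemma compat_power: "(\<And>v. compat L r v f) \<Longrightarrow> compat L r v (f ^ n)"
  by (induction n arbitrary: v) (auto intro: compat_1 compat_mult)

lemma compat_prod: "(\<And>a v. a \<in> A \<Longrightarrow> compat L r v (f a)) \<Longrightarrow> compat L r v (prod f A)"
  by (induction A arbitrary: v rule: infinite_finite_induct) (auto intro: compat_1 compat_mult)

lemma compat_diff_1: "compat L r v f \<Longrightarrow> compat L r v (f - 1)"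
  by (rule compatI) (simp_all add: compatD ev_one algebra_simps)

lemma compat_spow:
  assumes "\<And>v. compat L r v p" "ev p [] = 1"
  shows "compat L r v (spow c p)"
proof -
  define q where "q n = (\<Sum>j\<le>n. scal (c j) * (p - 1) ^ j)" for n
  have q: "compat L r v (q n)" for n
    unfolding q_def using assms(1)
    by (intro compat_sum compat_scal compat_power compat_diff_1)
  have ev: "ev (spow c p) w = ev (q n) w" if "length w \<le> n" for w n
    unfolding q_def using assms(2) that by (rule ev_spow)
  show ?thesis
  proof (rule compatI)
    fix x y :: cmat and w :: "cmat list" and a
    let ?n = "length v + length w + 2"
    show "ev (spow c p) (v @ mbracket L r x y # w)
        = ev (spow c p) (v @ x # y # w) - ev (spow c p) (v @ y # x # w)"
      by (subst (1 2 3) ev[of _ ?n]) (simp_all add: compatD(1)[OF q])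
    show "ev (spow c p) (v @ madd x y # w) = ev (spow c p) (v @ x # w) + ev (spow c p) (v @ y # w)"
      by (subst (1 2 3) ev[of _ ?n]) (simp_all add: compatD(2)[OF q])
    show "ev (spow c p) (v @ mscale a x # w) = const a * ev (spow c p) (v @ x # w)"
      by (subst (1 2) ev[of _ ?n]) (simp_all add: compatD(3)[OF q])
  qed
qed

section \<open>Matrix coefficients and their minors\<close>

lemma const_0 [simp]: "const 0 = 0" by (simp add: const_def)
lemma const_1 [simp]: "const 1 = 1" by (simp add: const_def)
lemma const_add: "const (a + b) = const a + const b" by (simp add: const_def single_add)
lemma const_minus: "const (- a) = - const a" by (simp add: const_def single_uminus)
lemma const_diff: "const (a - b) = const a - const b" by (simp add: const_def single_diff)
lemma const_mult: "(const (a * b) :: 'k::monoid_add \<Rightarrow>\<^sub>0 complex) = const a * const b"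
  by (simp add: const_def mult_single)
lemma const_sum: "const (sum f A) = (\<Sum>a\<in>A. const (f a))"
  by (induction A rule: infinite_finite_induct) (simp_all add: const_add)
lemma const_of_nat: "(const (of_nat n) :: 'k::monoid_add \<Rightarrow>\<^sub>0 complex) = of_nat n"
  by (simp add: const_def)

lemma finite_hatV [simp]: "finite (hatV L r)" by (simp add: hatV_def)

lemma hatV_uminus [simp]: "- i \<in> hatV L r \<longleftrightarrow> i \<in> hatV L r"
  by (auto simp: hatV_def)

lemma hatV_pos: "1 \<le> i \<Longrightarrow> i \<le> int r \<Longrightarrow> i \<in> hatV L r"
  by (auto simp: hatV_def)

lemma mmul_assoc: "mmul L r (mmul L r x y) z = mmul L r x (mmul L r y z)"
  unfolding mmul_def
  by (intro ext, simp only: sum_distrib_left sum_distrib_right mult.assoc, rule sum.swap)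

lemma mmul_mone_right: "j \<in> hatV L r \<Longrightarrow> mmul L r x (mone L r) i j = x i j"
  by (simp add: mmul_def mone_def if_distrib[where f = "\<lambda>t. _ * t"] cong: if_cong)

lemma mmul_mone_left: "i \<in> hatV L r \<Longrightarrow> mmul L r (mone L r) x i j = x i j"
  by (simp add: mmul_def mone_def if_distrib[where f = "\<lambda>t. t * _"] cong: if_cong)

lemma foldr_mmul:
  assumes "i \<in> hatV L r"
  shows "foldr (mmul L r) w y i j = (\<Sum>l\<in>hatV L r. foldr (mmul L r) w (mone L r) i l * y l j)"
proof -
  have "foldr (mmul L r) w y i j = mmul L r (foldr (mmul L r) w (mone L r)) y i j"
    using assms
  proof (induction w arbitrary: i)
    case Nil
    then show ?case by (simp add: mmul_mone_left)
  next
    case (Cons x w)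
    have "foldr (mmul L r) (x # w) y i j = (\<Sum>k\<in>hatV L r. x i k * foldr (mmul L r) w y k j)"
      by (simp add: mmul_def)
    also have "\<dots> = (\<Sum>k\<in>hatV L r. x i k * mmul L r (foldr (mmul L r) w (mone L r)) y k j)"
      using Cons.IH by simp
    also have "\<dots> = mmul L r x (mmul L r (foldr (mmul L r) w (mone L r)) y) i j"
      by (simp add: mmul_def)
    finally show ?case by (simp add: mmul_assoc)
  qed
  then show ?thesis by (simp add: mmul_def)
qed

definition mcoeff :: "lie_kind \<Rightarrow> nat \<Rightarrow> int \<Rightarrow> int \<Rightarrow> (cmat, hpoly) shuf" where
  "mcoeff L r i j = Shuf (\<lambda>w. const (word_on_V L r (Word w) i j))"

lemma Dl_mcoeff: "Dl x (mcoeff L r i j) = (\<Sum>l\<in>hatV L r. scal (const (x i l)) * mcoeff L r l j)"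
  by (rule shuf_eqI) (simp add: mcoeff_def word_on_V_def mmul_def const_sum const_mult)

lemma Dr_mcoeff:
  assumes "i \<in> hatV L r" "j \<in> hatV L r"
  shows "Dr x (mcoeff L r i j) = (\<Sum>l\<in>hatV L r. scal (const (x l j)) * mcoeff L r i l)"
proof (rule shuf_eqI)
  fix w
  have "word_on_V L r (Word (w @ [x])) i j
      = (\<Sum>l\<in>hatV L r. foldr (mmul L r) w (mone L r) i l * mmul L r x (mone L r) l j)"
    unfolding word_on_V_def word.sel foldr_append foldr_Cons foldr_Nil o_apply id_apply
    by (rule foldr_mmul[OF assms(1)])
  then show "ev (Dr x (mcoeff L r i j)) w = ev (\<Sum>l\<in>hatV L r. scal (const (x l j)) * mcoeff L r i l) w"
    unfolding ev_Dr ev_sum ev_scal_mult mcoeff_def ev_Shuf word_on_V_def word.sel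
      mmul_mone_right[OF assms(2)]
    by (simp only: const_sum const_mult mult.commute)
qed

lemma compat_mcoeff: "compat L r v (mcoeff L r i j)"
proof (induction v arbitrary: i)
  case (Cons x v)
  then show ?case
    unfolding compat_Cons Dl_mcoeff by (intro compat_sum compat_scal)
next
  case Nil
  have DD: "Dl y (Dl x (mcoeff L r i j)) = (\<Sum>m\<in>hatV L r. scal (const (mmul L r x y i m)) * mcoeff L r m j)" for x y
    unfolding Dl_mcoeff derivation_sum[OF derivation_Dl] Dl_scal_mult mmul_def
      sum_distrib_left const_sum const_mult scal_sum scal_mult sum_distrib_right mult.assoc
    by (rule sum.swap)
  show ?case
    unfolding compat_Nil
  proof (intro conjI allI)
    fix x y c
    show "Dl y (Dl x (mcoeff L r i j)) - Dl x (Dl y (mcoeff L r i j)) = Dl (mbracket L r x y) (mcoeff L r i j)"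
      unfolding DD unfolding Dl_mcoeff mbracket_def
      by (rule shuf_eqI) (simp add: const_diff left_diff_distrib sum_subtractf)
    show "Dl (madd x y) (mcoeff L r i j) = Dl x (mcoeff L r i j) + Dl y (mcoeff L r i j)"
      unfolding Dl_mcoeff madd_def
      by (simp add: const_add scal_add distrib_right sum.distrib)
    show "Dl (mscale c x) (mcoeff L r i j) = scal (const c) * Dl x (mcoeff L r i j)"
      unfolding Dl_mcoeff mscale_def
      by (simp add: const_mult scal_mult sum_distrib_left mult.assoc)
  qed
qed

definition minor :: "lie_kind \<Rightarrow> nat \<Rightarrow> nat \<Rightarrow> (cmat, hpoly) shuf" where
  "minor L r k = det (mat k k (\<lambda>(i, j). mcoeff L r (int (Suc i)) (int (Suc j))))"

lemma ev_minor_Nil: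
  assumes "k \<le> r"
  shows "ev (minor L r k) [] = 1"
proof -
  interpret comm_ring_hom "\<lambda>f :: (cmat, hpoly) shuf. ev f []"
    by unfold_locales (simp_all add: ev_one)
  have "ev (minor L r k) [] = det (map_mat (\<lambda>f. ev f []) (mat k k (\<lambda>(i, j). mcoeff L r (int (Suc i)) (int (Suc j)))))"
    by (simp add: minor_def)
  also have "map_mat (\<lambda>f. ev f []) (mat k k (\<lambda>(i, j). mcoeff L r (int (Suc i)) (int (Suc j)))) = (1\<^sub>m k :: hpoly mat)"
    using assms by (intro eq_matI) (auto simp: mcoeff_def word_on_V_def mone_def hatV_pos)
  finally show ?thesis by simp
qed

lemma compat_det:
  assumes "\<And>i j v. i < k \<Longrightarrow> j < k \<Longrightarrow> compat L r v (a i j)"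
  shows "compat L r v (det (mat k k (\<lambda>(i, j). a i j)))"
proof -
  have s: "compat L r v (signof p * f)" if "compat L r v f" for v f and p :: "nat \<Rightarrow> nat"
  proof (cases "sign p = 1")
    case True
    then show ?thesis using that by simp
  next
    case False
    then have "sign p = -1" by (metis sign_def)
    then have "signof p * f = scal (-1) * f"
      by (intro shuf_eqI) simp
    then show ?thesis using compat_scal[OF that] by simp
  qed
  show ?thesis
    unfolding det_def'[OF mat_carrier]
    by (intro compat_sum s compat_prod) (auto simp: assms permutes_in_image)
qed

lemma compat_minor: "compat L r v (minor L r k)"
  unfolding minor_def by (intro compat_det compat_mcoeff)

lemma sum_over_block:
  assumes "k \<le> r" "\<And>l. l \<in> hatV L r \<Longrightarrow> l \<notin> {1..int k} \<Longrightarrow> f l = 0"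
  shows "(\<Sum>l\<in>hatV L r. f l) = (\<Sum>l<k. f (int (Suc l)))"
proof -
  have "(\<Sum>l\<in>hatV L r. f l) = (\<Sum>l\<in>{1..int k}. f l)"
    using assms by (intro sum.mono_neutral_right) (auto simp: hatV_pos)
  also have "\<dots> = (\<Sum>l<k. f (int (Suc l)))"
    by (rule sum.reindex_bij_witness[where i = "\<lambda>l. int (Suc l)" and j = "\<lambda>l. nat l - 1"]) auto
  finally show ?thesis .
qed

text \<open>The derivative multiplies the matrix of coefficients by \<open>x\<close> from the left, and by assumption the
  first \<open>k\<close> rows are only mixed among themselves.\<close>

lemma Dl_minor:
  assumes "k \<le> r" "\<And>i l. i \<in> {1..int k} \<Longrightarrow> l \<in> hatV L r \<Longrightarrow> l \<notin> {1..int k} \<Longrightarrow> x i l = 0"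
  shows "Dl x (minor L r k) = scal (const (\<Sum>i=1..k. x (int i) (int i))) * minor L r k"
proof -
  have "Dl x (minor L r k) = (\<Sum>i<k. scal (const (x (int (Suc i)) (int (Suc i))))) * minor L r k"
    unfolding minor_def
  proof (rule derivation_det[OF derivation_Dl,
        where x = "\<lambda>i l. scal (const (x (int (Suc i)) (int (Suc l))))"])
    fix i j assume "i < k" "j < k"
    then show "Dl x (mcoeff L r (int (Suc i)) (int (Suc j))) =
       (\<Sum>l<k. scal (const (x (int (Suc i)) (int (Suc l)))) * mcoeff L r (int (Suc l)) (int (Suc j)))"
      unfolding Dl_mcoeff using assms by (intro sum_over_block) auto
  qed
  moreover have "(\<Sum>i=1..k. x (int i) (int i)) = (\<Sum>i<k. x (int (Suc i)) (int (Suc i)))"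
    by (rule sum.reindex_bij_witness[where i = Suc and j = "\<lambda>i. i - 1"]) auto
  ultimately show ?thesis by (simp add: const_sum scal_sum)
qed

text \<open>The same for columns, where \<open>x\<close> acts from the right.\<close>

lemma Dr_minor:
  assumes "k \<le> r" "\<And>j l. j \<in> {1..int k} \<Longrightarrow> l \<in> hatV L r \<Longrightarrow> l \<notin> {1..int k} \<Longrightarrow> x l j = 0"
  shows "Dr x (minor L r k) = scal (const (\<Sum>i=1..k. x (int i) (int i))) * minor L r k"
proof -
  have T: "minor L r k = det (mat k k (\<lambda>(i, j). mcoeff L r (int (Suc j)) (int (Suc i))))"
    unfolding minor_def
    by (subst det_transpose[symmetric, OF mat_carrier], rule arg_cong[where f = det], rule eq_matI) auto
  have "Dr x (minor L r k) = (\<Sum>i<k. scal (const (x (int (Suc i)) (int (Suc i))))) * minor L r k"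
    unfolding T
  proof (rule derivation_det[OF derivation_Dr,
        where x = "\<lambda>i l. scal (const (x (int (Suc l)) (int (Suc i))))"])
    fix i j assume ij: "i < k" "j < k"
    then have h: "int (Suc j) \<in> hatV L r" "int (Suc i) \<in> hatV L r"
      using assms(1) by (auto simp: hatV_def)
    show "Dr x (mcoeff L r (int (Suc j)) (int (Suc i))) =
       (\<Sum>l<k. scal (const (x (int (Suc l)) (int (Suc i)))) * mcoeff L r (int (Suc j)) (int (Suc l)))"
      unfolding Dr_mcoeff[OF h] by (intro sum_over_block[OF assms(1)]) (use assms(2) ij in auto)
  qed
  moreover have "(\<Sum>i=1..k. x (int i) (int i)) = (\<Sum>i<k. x (int (Suc i)) (int (Suc i)))"
    by (rule sum.reindex_bij_witness[where i = Suc and j = "\<lambda>i. i - 1"]) auto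
  ultimately show ?thesis by (simp add: const_sum scal_sum)
qed

section \<open>The Harish-Chandra functional\<close>

text \<open>The binomial coefficient of \<open>g\<close> over \<open>j\<close>.\<close>

definition hbin :: "hpoly \<Rightarrow> nat \<Rightarrow> hpoly" where
  "hbin g j = const (1 / fact j) * (\<Prod>i<j. g - of_nat i)"

lemma hbin_0: "hbin g 0 = 1"
  by (simp add: hbin_def)

lemma hbin_rec: "of_nat (Suc j) * hbin g (Suc j) + of_nat j * hbin g j = g * hbin g j"
proof -
  have "of_nat (Suc j) * const (1 / fact (Suc j)) = (const (1 / fact j) :: hpoly)"
    by (simp only: const_of_nat[symmetric] const_mult[symmetric]) (simp add: fact_Suc divide_simps del: of_nat_Suc)
  then have "of_nat (Suc j) * hbin g (Suc j) = hbin g j * (g - of_nat j)"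
    unfolding hbin_def by (simp add: mult.assoc[symmetric] del: of_nat_Suc)
  then show ?thesis by (simp add: algebra_simps)
qed

text \<open>The minor of size \<open>k\<close> has the weight \<open>\<epsilon>\<^sub>1 + \<dots> + \<epsilon>\<^sub>k\<close>.  These are the coefficients that give a
  weight with coordinates \<open>h\<^sub>1, \<dots>, h\<^sub>r\<close>.\<close>

definition fund_exp :: "nat \<Rightarrow> nat \<Rightarrow> hpoly" where
  "fund_exp r k = (if k < r then hvar k - hvar (Suc k) else hvar k)"

lemma sum_fund_exp: "1 \<le> j \<Longrightarrow> j \<le> r \<Longrightarrow> (\<Sum>k=j..r. fund_exp r k) = hvar j"
proof (induction "r - j" arbitrary: j)
  case 0
  then have "j = r" by simp
  then show ?case by (simp add: fund_exp_def)
next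
  case (Suc n)
  then have "(\<Sum>k=Suc j..r. fund_exp r k) = hvar (Suc j)"
    by (intro Suc.hyps(1)) auto
  then show ?case using Suc by (simp add: sum.atLeast_Suc_atMost fund_exp_def)
qed

text \<open>The matrix coefficient of the highest weight vector of the formal weight with coordinates
  \<open>h\<^sub>1, \<dots>, h\<^sub>r\<close>: a product of formal powers of minors.\<close>

definition hcf :: "lie_kind \<Rightarrow> nat \<Rightarrow> (cmat, hpoly) shuf" where
  "hcf L r = (\<Prod>k=1..r. spow (hbin (fund_exp r k)) (minor L r k))"

text \<open>The position of \<open>v\<^sub>i\<close> in the order \<open>1, \<dots>, r, 0, -r, \<dots>, -1\<close>, along which the weights of the
  basis vectors decrease.  Positive root vectors are strictly upper triangular for this order.\<close>

definition pos :: "nat \<Rightarrow> int \<Rightarrow> int" where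
  "pos r i = (if i > 0 then i else if i = 0 then int r + 1 else 2 * int r + 2 + i)"

lemma pos_block:
  assumes "i \<in> {1..int k}" "l \<in> hatV L r" "l \<notin> {1..int k}" "k \<le> r"
  shows "pos r i < pos r l"
proof -
  have "- int r \<le> l" using assms(2) by (auto simp: hatV_def split: if_splits)
  then show ?thesis using assms by (auto simp: pos_def)
qed

lemma ev_hcf_Nil: "ev (hcf L r) [] = 1"
  unfolding hcf_def ev_prod_Nil
  by (intro prod.neutral) (auto intro!: ev_spow_Nil simp: ev_minor_Nil hbin_0)

lemma compat_hcf: "compat L r v (hcf L r)"
  unfolding hcf_def by (intro compat_prod compat_spow compat_minor) (auto simp: ev_minor_Nil)

text \<open>The minor of size \<open>k\<close> contributes \<open>(x\<^sub>1\<^sub>1 + \<dots> + x\<^sub>k\<^sub>k)(h\<^sub>k - h\<^sub>k\<^sub>+\<^sub>1)\<close>, and summation by parts leaves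
  \<open>x\<^sub>1\<^sub>1 h\<^sub>1 + \<dots> + x\<^sub>r\<^sub>r h\<^sub>r\<close>.\<close>

lemma Dl_hcf:
  assumes "\<And>i j. i \<in> hatV L r \<Longrightarrow> j \<in> hatV L r \<Longrightarrow> x i j \<noteq> 0 \<Longrightarrow> pos r j \<le> pos r i"
  shows "Dl x (hcf L r) = scal (\<Sum>j=1..r. const (x (int j) (int j)) * hvar j) * hcf L r"
proof -
  let ?t = "\<lambda>k. \<Sum>i=1..k. x (int i) (int i)"
  have "Dl x (hcf L r) = (\<Sum>k=1..r. scal (const (?t k) * fund_exp r k)) * hcf L r"
    unfolding hcf_def
  proof (rule derivation_prod_semi_invariant[OF derivation_Dl])
    fix k assume k: "k \<in> {1..r}"
    have m: "Dl x (minor L r k) = scal (const (?t k)) * minor L r k"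
    proof (rule Dl_minor)
      fix i l assume "i \<in> {1..int k}" "l \<in> hatV L r" "l \<notin> {1..int k}"
      then show "x i l = 0"
        using assms[of i l] k pos_block[of i k l L r] hatV_pos[of i r L] by (cases "x i l = 0") auto
    qed (use k in auto)
    show "Dl x (spow (hbin (fund_exp r k)) (minor L r k)) =
      scal (const (?t k) * fund_exp r k) * spow (hbin (fund_exp r k)) (minor L r k)"
      by (rule spow_semi_invariant[OF derivation_Dl Dl_scal_mult ev_Dl _ _ m hbin_rec])
         (use k in \<open>auto simp: ev_minor_Nil\<close>)
  qed
  also have "(\<Sum>k=1..r. scal (const (?t k) * fund_exp r k))
      = scal (\<Sum>k=1..r. \<Sum>j=1..k. const (x (int j) (int j)) * fund_exp r k)"
    by (simp add: scal_sum const_sum sum_distrib_right)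
  also have "(\<Sum>k=1..r. \<Sum>j=1..k. const (x (int j) (int j)) * fund_exp r k)
      = (\<Sum>j=1..r. \<Sum>k=j..r. const (x (int j) (int j)) * fund_exp r k)"
    unfolding sum.Sigma[OF finite_atLeastAtMost ballI[OF finite_atLeastAtMost]]
    by (rule sum.reindex_bij_witness[where i = "\<lambda>(a, b). (b, a)" and j = "\<lambda>(a, b). (b, a)"]) auto
  also have "\<dots> = (\<Sum>j=1..r. const (x (int j) (int j)) * hvar j)"
    by (intro sum.cong refl) (simp add: sum_fund_exp flip: sum_distrib_left)
  finally show ?thesis .
qed

lemma Dr_hcf:
  assumes "\<And>i j. i \<in> hatV L r \<Longrightarrow> j \<in> hatV L r \<Longrightarrow> x i j \<noteq> 0 \<Longrightarrow> pos r i < pos r j"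
  shows "Dr x (hcf L r) = 0"
proof -
  have "Dr x (hcf L r) = (\<Sum>k=1..r. scal (const 0 * fund_exp r k)) * hcf L r"
    unfolding hcf_def
  proof (rule derivation_prod_semi_invariant[OF derivation_Dr])
    fix k assume k: "k \<in> {1..r}"
    have "Dr x (minor L r k) = scal (const (\<Sum>i=1..k. x (int i) (int i))) * minor L r k"
    proof (rule Dr_minor)
      fix j l assume "j \<in> {1..int k}" "l \<in> hatV L r" "l \<notin> {1..int k}"
      then show "x l j = 0"
        using assms[of l j] k pos_block[of j k l L r] hatV_pos[of j r L] by (cases "x l j = 0") auto
    qed (use k in auto)
    also have "(\<Sum>i=1..k. x (int i) (int i)) = 0"
    proof (intro sum.neutral ballI)
      fix i assume "i \<in> {1..k}"
      then show "x (int i) (int i) = 0"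
        using assms[of "int i" "int i"] k hatV_pos[of "int i" r L] by (cases "x (int i) (int i) = 0") auto
    qed
    finally have m: "Dr x (minor L r k) = scal (const 0) * minor L r k" .
    show "Dr x (spow (hbin (fund_exp r k)) (minor L r k)) =
      scal (const 0 * fund_exp r k) * spow (hbin (fund_exp r k)) (minor L r k)"
      by (rule spow_semi_invariant[OF derivation_Dr Dr_scal_mult ev_Dr _ _ m hbin_rec])
         (use k in \<open>auto simp: ev_minor_Nil\<close>)
  qed
  then show ?thesis by simp
qed

section \<open>The classical Lie algebras and their root vectors\<close>

lemma theta_mult:
  "i \<in> hatV L r \<Longrightarrow> j \<in> hatV L r \<Longrightarrow> k \<in> hatV L r \<Longrightarrow> theta L i k * theta L k j = theta L i j"
  by (auto simp: theta_def hatV_def sgn_if)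

lemma theta_self: "i \<in> hatV L r \<Longrightarrow> j \<in> hatV L r \<Longrightarrow> theta L i j * theta L i j = 1"
  by (auto simp: theta_def hatV_def sgn_if)

lemma theta_uminus: "theta L (- j) (- i) = theta L i j"
  by (simp add: theta_def)

lemma gl_0: "x \<in> gl L r \<Longrightarrow> i \<notin> hatV L r \<or> j \<notin> hatV L r \<Longrightarrow> x i j = 0"
  by (auto simp: gl_def)

text \<open>The antidiagonal form turns the transpose into the reflection at the antidiagonal, with the signs
  \<open>\<theta>\<close>.\<close>

lemma lie_iff:
  "x \<in> lie L r \<longleftrightarrow> x \<in> gl L r \<and>
     (\<forall>i\<in>hatV L r. \<forall>j\<in>hatV L r. x i j = - theta L i j * x (- j) (- i))"
proof (cases "x \<in> gl L r")
  case gl: True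
  define s where "s i = (if i \<le> (0::int) then 1 else eps_val L)" for i
  have s2: "s i * s i = 1" for i
    by (cases L) (auto simp: s_def eps_val_def)
  have st: "s (- j) * s (- i) = theta L i j" if "i \<in> hatV L r" "j \<in> hatV L r" for i j
    using that by (cases L) (auto simp: s_def theta_def eps_val_def hatV_def sgn_if)
  have J: "Jmat L r a b = (if b = - a then (if a \<in> hatV L r then s a else 0) else 0)" for a b
    by (simp add: Jmat_def s_def)
  have 1: "mmul L r (mtransp x) (Jmat L r) a b = (if b \<in> hatV L r then x (- b) a * s (- b) else 0)" for a b
  proof -
    have "mmul L r (mtransp x) (Jmat L r) a b = (\<Sum>k\<in>hatV L r. if k = - b then x (- b) a * s (- b) else 0)"
      unfolding mmul_def mtransp_def J
    proof (rule sum.cong)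
      fix k assume "k \<in> hatV L r"
      then show "x k a * (if b = - k then if k \<in> hatV L r then s k else 0 else 0)
          = (if k = - b then x (- b) a * s (- b) else 0)"
        by (cases "k = - b") (simp, metis minus_minus mult_zero_right)
    qed simp
    then show ?thesis by simp
  qed
  have 2: "mmul L r (Jmat L r) x a b = (if a \<in> hatV L r then s a * x (- a) b else 0)" for a b
    unfolding mmul_def J by (simp add: if_distrib[where f = "\<lambda>t. t * _"] cong: if_cong)
  have eq: "x (- b) a * s (- b) + s a * x (- a) b = 0 \<longleftrightarrow> x (- a) b = - theta L (- a) b * x (- b) a"
    if "a \<in> hatV L r" "b \<in> hatV L r" for a b
  proof -
    have "x (- b) a * s (- b) + s a * x (- a) b = 0 \<longleftrightarrow>
        s a * (x (- b) a * s (- b) + s a * x (- a) b) = 0"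
      using s2[of a] by (metis mult_eq_0_iff zero_neq_one)
    also have "s a * (x (- b) a * s (- b) + s a * x (- a) b)
        = (s (- b) * s a) * x (- b) a + (s a * s a) * x (- a) b"
      by (simp add: algebra_simps)
    also have "\<dots> = x (- a) b + theta L (- a) b * x (- b) a"
      using s2[of a] st[of "- a" b] that by simp
    finally show ?thesis by (simp add: add_eq_0_iff2)
  qed
  have "x \<in> lie L r \<longleftrightarrow> (\<forall>a b. mmul L r (mtransp x) (Jmat L r) a b + mmul L r (Jmat L r) x a b = 0)"
    using gl by (simp add: lie_def madd_def fun_eq_iff)
  also have "\<dots> \<longleftrightarrow> (\<forall>a\<in>hatV L r. \<forall>b\<in>hatV L r. x (- a) b = - theta L (- a) b * x (- b) a)"
    unfolding 1 2
  proof (intro iffI ballI allI)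
    fix a b
    assume H: "\<forall>a b. (if b \<in> hatV L r then x (- b) a * s (- b) else 0) +
        (if a \<in> hatV L r then s a * x (- a) b else 0) = 0" and ab: "a \<in> hatV L r" "b \<in> hatV L r"
    show "x (- a) b = - theta L (- a) b * x (- b) a"
      using H[rule_format, of b a] ab eq[OF ab] by simp
  next
    fix a b
    assume H: "\<forall>a\<in>hatV L r. \<forall>b\<in>hatV L r. x (- a) b = - theta L (- a) b * x (- b) a"
    show "(if b \<in> hatV L r then x (- b) a * s (- b) else 0) +
        (if a \<in> hatV L r then s a * x (- a) b else 0) = 0"
    proof (cases "a \<in> hatV L r \<and> b \<in> hatV L r")
      case True
      then show ?thesis using H[rule_format, of a b] eq[of a b] by simp
    next
      case False
      then show ?thesis using gl_0[OF gl] by auto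
    qed
  qed
  also have "\<dots> \<longleftrightarrow> (\<forall>i\<in>hatV L r. \<forall>j\<in>hatV L r. x i j = - theta L i j * x (- j) (- i))"
  proof (intro iffI ballI)
    fix i j
    assume H: "\<forall>a\<in>hatV L r. \<forall>b\<in>hatV L r. x (- a) b = - theta L (- a) b * x (- b) a"
      and ij: "i \<in> hatV L r" "j \<in> hatV L r"
    show "x i j = - theta L i j * x (- j) (- i)"
      using H[rule_format, of "- i" j] ij by simp
  next
    fix a b
    assume H: "\<forall>i\<in>hatV L r. \<forall>j\<in>hatV L r. x i j = - theta L i j * x (- j) (- i)"
      and ij: "a \<in> hatV L r" "b \<in> hatV L r"
    show "x (- a) b = - theta L (- a) b * x (- b) a"
      using H[rule_format, of "- a" b] ij by simp
  qed
  finally show ?thesis using gl by simp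
qed (simp add: lie_def)

lemma lie_sym: "x \<in> lie L r \<Longrightarrow> i \<in> hatV L r \<Longrightarrow> j \<in> hatV L r \<Longrightarrow> x i j = - theta L i j * x (- j) (- i)"
  unfolding lie_iff by blast

lemma lie_gl: "x \<in> lie L r \<Longrightarrow> x \<in> gl L r"
  by (simp add: lie_def)

lemma lie_madd: "x \<in> lie L r \<Longrightarrow> y \<in> lie L r \<Longrightarrow> madd x y \<in> lie L r"
  unfolding lie_iff
proof (intro conjI ballI)
  assume *: "x \<in> gl L r \<and> (\<forall>i\<in>hatV L r. \<forall>j\<in>hatV L r. x i j = - theta L i j * x (- j) (- i))"
    "y \<in> gl L r \<and> (\<forall>i\<in>hatV L r. \<forall>j\<in>hatV L r. y i j = - theta L i j * y (- j) (- i))"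
  then show "madd x y \<in> gl L r" by (auto simp: gl_def madd_def)
  fix i j assume "i \<in> hatV L r" "j \<in> hatV L r"
  then have "x i j = - theta L i j * x (- j) (- i)" "y i j = - theta L i j * y (- j) (- i)"
    using * by blast+
  then show "madd x y i j = - theta L i j * madd x y (- j) (- i)"
    unfolding madd_def distrib_left by (rule arg_cong2)
qed

lemma lie_mscale: "x \<in> lie L r \<Longrightarrow> mscale c x \<in> lie L r"
  unfolding lie_iff
proof (intro conjI ballI)
  assume *: "x \<in> gl L r \<and> (\<forall>i\<in>hatV L r. \<forall>j\<in>hatV L r. x i j = - theta L i j * x (- j) (- i))"
  then show "mscale c x \<in> gl L r" by (auto simp: gl_def mscale_def)
  fix i j assume "i \<in> hatV L r" "j \<in> hatV L r"
  then have "x i j = - theta L i j * x (- j) (- i)"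
    using * by blast
  then show "mscale c x i j = - theta L i j * mscale c x (- j) (- i)"
    unfolding mscale_def mult.left_commute[of _ c] by (rule arg_cong)
qed

lemma lie_zero: "(\<lambda>i j. 0) \<in> lie L r"
  by (simp add: lie_iff gl_def)

lemma lie_mmul_sym:
  assumes x: "x \<in> lie L r" and y: "y \<in> lie L r" and ij: "i \<in> hatV L r" "j \<in> hatV L r"
  shows "mmul L r x y i j = theta L i j * mmul L r y x (- j) (- i)"
proof -
  have "mmul L r x y i j = (\<Sum>k\<in>hatV L r. theta L i j * (y (- j) (- k) * x (- k) (- i)))"
    unfolding mmul_def
  proof (rule sum.cong)
    fix k assume k: "k \<in> hatV L r"
    have "x i k * y k j = (theta L i k * theta L k j) * (y (- j) (- k) * x (- k) (- i))"
      using lie_sym[OF x ij(1) k] lie_sym[OF y k ij(2)] by simp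
    then show "x i k * y k j = theta L i j * (y (- j) (- k) * x (- k) (- i))"
      using theta_mult[OF ij k] by simp
  qed simp
  also have "\<dots> = (\<Sum>k\<in>hatV L r. theta L i j * (y (- j) k * x k (- i)))"
    by (rule sum.reindex_bij_witness[where i = uminus and j = uminus]) auto
  finally show ?thesis by (simp add: mmul_def sum_distrib_left)
qed

lemma lie_mbracket: "x \<in> lie L r \<Longrightarrow> y \<in> lie L r \<Longrightarrow> mbracket L r x y \<in> lie L r"
proof -
  assume xy: "x \<in> lie L r" "y \<in> lie L r"
  have gl: "mmul L r a b \<in> gl L r" if "a \<in> gl L r" "b \<in> gl L r" for a b
    using that by (auto simp: gl_def mmul_def intro!: sum.neutral)
  show ?thesis
    unfolding lie_iff
  proof (intro conjI ballI)
    show "mbracket L r x y \<in> gl L r"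
    proof -
      have "mmul L r x y \<in> gl L r" "mmul L r y x \<in> gl L r"
        using gl lie_gl xy by blast+
      then show ?thesis unfolding gl_def mbracket_def by simp
    qed
    fix i j assume ij: "i \<in> hatV L r" "j \<in> hatV L r"
    show "mbracket L r x y i j = - theta L i j * mbracket L r x y (- j) (- i)"
      unfolding mbracket_def lie_mmul_sym[OF xy ij] lie_mmul_sym[OF xy(2,1) ij] by (simp add: algebra_simps)
  qed
qed

lemma Fmat_lie: "i \<in> hatV L r \<Longrightarrow> j \<in> hatV L r \<Longrightarrow> Fmat L i j \<in> lie L r"
  unfolding lie_iff
proof (intro conjI ballI)
  assume ij: "i \<in> hatV L r" "j \<in> hatV L r"
  show "Fmat L i j \<in> gl L r"
    using ij by (auto simp: gl_def Fmat_def Emat_def)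
  fix k l assume "k \<in> hatV L r" "l \<in> hatV L r"
  have e1: "Emat i j (- l) (- k) = Emat (- j) (- i) k l"
    unfolding Emat_def by (rule if_cong) (auto simp: minus_equation_iff[of l] minus_equation_iff[of k])
  have e2: "Emat (- j) (- i) (- l) (- k) = Emat i j k l"
    unfolding Emat_def by (rule if_cong) auto
  consider "k = i \<and> l = j" | "k = - j \<and> l = - i" | "Emat i j k l = 0 \<and> Emat (- j) (- i) k l = 0"
    unfolding Emat_def by argo
  then have "Emat i j k l - theta L i j * Emat (- j) (- i) k l
      = - theta L k l * (Emat (- j) (- i) k l - theta L i j * Emat i j k l)"
  proof cases
    case 1
    then show ?thesis using theta_self[OF ij] by (simp add: right_diff_distrib mult.assoc[symmetric])
  next
    case 2
    then have "theta L k l = theta L i j" by (simp add: theta_uminus)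
    then show ?thesis using theta_self[OF ij] by (simp add: right_diff_distrib mult.assoc[symmetric])
  qed simp
  then show "Fmat L i j k l = - theta L k l * Fmat L i j (- l) (- k)"
    unfolding Fmat_def e1 e2 .
qed

lemma mspan_base: "x \<in> S \<Longrightarrow> x \<in> mspan S"
  unfolding mspan_def mlincomb_def by (auto intro!: exI[of _ "{x}"] exI[of _ "\<lambda>_. 1"])

lemma mspan_zero: "(\<lambda>i j. 0) \<in> mspan S"
  unfolding mspan_def mlincomb_def by (auto intro!: exI[of _ "{}"])

lemma mspan_madd: "x \<in> mspan S \<Longrightarrow> y \<in> mspan S \<Longrightarrow> madd x y \<in> mspan S"
proof -
  assume "x \<in> mspan S" "y \<in> mspan S"
  then obtain A c B d where A: "x = mlincomb A c" "finite A" "A \<subseteq> S" and B: "y = mlincomb B d" "finite B" "B \<subseteq> S"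
    by (auto simp: mspan_def)
  let ?e = "\<lambda>s. (if s \<in> A then c s else 0) + (if s \<in> B then d s else 0)"
  have "madd x y = mlincomb (A \<union> B) ?e"
  proof (intro ext)
    fix i j
    have "(\<Sum>s\<in>A \<union> B. ?e s * s i j) = (\<Sum>s\<in>A \<union> B. (if s \<in> A then c s * s i j else 0)) + (\<Sum>s\<in>A \<union> B. (if s \<in> B then d s * s i j else 0))"
      unfolding sum.distrib[symmetric] by (intro sum.cong) (auto simp: distrib_right)
    also have "\<dots> = (\<Sum>s\<in>A. c s * s i j) + (\<Sum>s\<in>B. d s * s i j)"
      using A B by (simp add: sum.If_cases Int_absorb1)
    finally show "madd x y i j = mlincomb (A \<union> B) ?e i j"
      by (simp add: madd_def mlincomb_def A B)
  qed
  then show ?thesis using A B by (auto simp: mspan_def)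
qed

lemma mspan_mscale: "x \<in> mspan S \<Longrightarrow> mscale c x \<in> mspan S"
proof -
  assume "x \<in> mspan S"
  then obtain A d where A: "x = mlincomb A d" "finite A" "A \<subseteq> S"
    by (auto simp: mspan_def)
  have "mscale c x = mlincomb A (\<lambda>s. c * d s)"
    by (simp add: A mscale_def mlincomb_def sum_distrib_left mult.assoc)
  then show ?thesis using A by (auto simp: mspan_def)
qed

lemma mspan_sum:
  assumes "finite A" "\<And>a. a \<in> A \<Longrightarrow> f a \<in> mspan S"
  shows "(\<lambda>i j. \<Sum>a\<in>A. c a * f a i j) \<in> mspan S"
  using assms
proof (induction A rule: finite_induct)
  case empty
  then show ?case using mspan_zero by simp
next
  case (insert a A)
  then have "madd (mscale (c a) (f a)) (\<lambda>i j. \<Sum>a\<in>A. c a * f a i j) \<in> mspan S"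
    by (intro mspan_madd mspan_mscale) auto
  then show ?case using insert by (simp add: madd_def mscale_def)
qed

lemma mspan_induct:
  assumes "x \<in> mspan S" "\<And>s. s \<in> S \<Longrightarrow> P s" "P (\<lambda>i j. 0)"
    "\<And>x y. P x \<Longrightarrow> P y \<Longrightarrow> P (madd x y)" "\<And>c x. P x \<Longrightarrow> P (mscale c x)"
  shows "P x"
proof -
  obtain A d where A: "x = mlincomb A d" "finite A" "A \<subseteq> S"
    using assms(1) by (auto simp: mspan_def)
  have "P (mlincomb A d)"
    using A(2,3)
  proof (induction A rule: finite_induct)
    case empty
    then show ?case using assms(3) by (simp add: mlincomb_def)
  next
    case (insert a A)
    then have "P (mscale (d a) a)" "P (mlincomb A d)"
      using assms(2)[of a] assms(5) by auto
    then have "P (madd (mscale (d a) a) (mlincomb A d))"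
      by (rule assms(4))
    also have "madd (mscale (d a) a) (mlincomb A d) = mlincomb (insert a A) d"
      using insert by (simp add: madd_def mscale_def mlincomb_def)
    finally show ?case .
  qed
  then show ?thesis by (simp add: A)
qed

definition wt :: "int \<Rightarrow> weight" where
  "wt i = (if i > 0 then epsw (nat i) else if i < 0 then (\<lambda>k. - epsw (nat (- i)) k) else (\<lambda>k. 0))"

lemma wt_uminus: "wt (- i) k = - wt i k"
  by (simp add: wt_def)

lemma Fmat_diag: "k \<ge> 1 \<Longrightarrow> Fmat L (int k) (int k) i j = (if i = j then wt i k else 0)"
  by (auto simp: Fmat_def Emat_def wt_def epsw_def theta_def)

lemma mbracket_cartan:
  assumes "k \<ge> 1" "x \<in> gl L r"
  shows "mbracket L r (Fmat L (int k) (int k)) x i j = (wt i k - wt j k) * x i j"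
proof -
  have "mmul L r (Fmat L (int k) (int k)) x i j = (\<Sum>l\<in>hatV L r. if l = i then wt i k * x i j else 0)"
    unfolding mmul_def Fmat_diag[OF assms(1)] by (intro sum.cong) auto
  moreover have "mmul L r x (Fmat L (int k) (int k)) i j = (\<Sum>l\<in>hatV L r. if l = j then wt j k * x i j else 0)"
    unfolding mmul_def Fmat_diag[OF assms(1)] by (intro sum.cong) auto
  ultimately show ?thesis
    using gl_0[OF assms(2), of i j] by (simp add: mbracket_def algebra_simps)
qed

text \<open>Pairing with the weight \<open>\<Sum>k. (r + 1 - k) \<epsilon>\<^sub>k\<close> is positive on positive roots and
  decreases along the order of the basis of \<open>V\<close>.\<close>

definition hgt :: "nat \<Rightarrow> weight \<Rightarrow> real" where
  "hgt r \<alpha> = (\<Sum>k=1..r. (real r + 1 - real k) * Re (\<alpha> k))"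

lemma hgt_epsw: "1 \<le> i \<Longrightarrow> i \<le> r \<Longrightarrow> hgt r (epsw i) = real r + 1 - real i"
  by (simp add: hgt_def epsw_def if_distrib[where f = Re] if_distrib[where f = "\<lambda>t. _ * t"] cong: if_cong)

lemma hgt_add: "hgt r (\<lambda>k. a k + b k) = hgt r a + hgt r b"
  by (simp add: hgt_def distrib_left sum.distrib)
lemma hgt_diff: "hgt r (\<lambda>k. a k - b k) = hgt r a - hgt r b"
  by (simp add: hgt_def right_diff_distrib sum_subtractf)
lemma hgt_minus: "hgt r (\<lambda>k. - a k) = - hgt r a"
  by (simp add: hgt_def sum_negf)

lemma hgt_pos_roots:
  assumes "\<alpha> \<in> pos_roots L r"
  shows "hgt r \<alpha> > 0"
proof -
  consider i j where "1 \<le> i" "i < j" "j \<le> r" "\<alpha> = (\<lambda>k. epsw i k + epsw j k)"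
    | i j where "1 \<le> i" "i < j" "j \<le> r" "\<alpha> = (\<lambda>k. epsw i k - epsw j k)"
    | i where "1 \<le> i" "i \<le> r" "\<alpha> = epsw i"
    | i where "1 \<le> i" "i \<le> r" "\<alpha> = (\<lambda>k. 2 * epsw i k)"
    using assms unfolding pos_roots_def by (cases L) (simp_all, blast+)
  then show ?thesis
  proof cases
    case (1 i j)
    then show ?thesis unfolding 1 hgt_add by (simp add: hgt_epsw)
  next
    case (2 i j)
    then show ?thesis unfolding 2 hgt_diff by (simp add: hgt_epsw)
  next
    case (3 i)
    then show ?thesis by (simp add: hgt_epsw)
  next
    case (4 i)
    have "\<alpha> = (\<lambda>k. epsw i k + epsw i k)" unfolding 4 by (simp add: fun_eq_iff)
    then have "hgt r \<alpha> = hgt r (epsw i) + hgt r (epsw i)" by (simp only: hgt_add)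
    then show ?thesis using 4(1,2) by (simp add: hgt_epsw)
  qed
qed

lemma hgt_wt: "i \<in> hatV L r \<Longrightarrow> hgt r (wt i) = real r + 1 - real_of_int (pos r i)"
proof -
  assume i: "i \<in> hatV L r"
  consider "i > 0" | "i = 0" | "i < 0" by linarith
  then show ?thesis
  proof cases
    case 1
    then have "nat i \<ge> 1" "nat i \<le> r" using i by (auto simp: hatV_def split: if_splits)
    then show ?thesis using 1 by (simp add: wt_def pos_def hgt_epsw)
  next
    case 2
    then show ?thesis by (simp add: wt_def pos_def hgt_def)
  next
    case 3
    then have "nat (- i) \<ge> 1" "nat (- i) \<le> r" using i by (auto simp: hatV_def split: if_splits)
    then show ?thesis using 3 by (simp add: wt_def pos_def hgt_epsw hgt_minus)
  qed
qed

text \<open>The entry at \<open>(i, j)\<close> of a matrix has the weight of \<open>v\<^sub>i\<close> minus the weight of \<open>v\<^sub>j\<close>, so a root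
  vector can have it only if its root agrees with this difference.\<close>

lemma root_space_weight:
  assumes "x \<in> root_space L r \<alpha>" "x i j \<noteq> 0"
  shows "hgt r \<alpha> = hgt r (\<lambda>k. wt i k - wt j k)"
  unfolding hgt_def
proof (rule sum.cong)
  fix k assume k: "k \<in> {1..r}"
  have "mbracket L r (Fmat L (int k) (int k)) x i j = \<alpha> k * x i j"
    using assms(1) k by (simp add: root_space_def mscale_def)
  moreover have "mbracket L r (Fmat L (int k) (int k)) x i j = (wt i k - wt j k) * x i j"
    using assms(1) k by (intro mbracket_cartan) (auto simp: root_space_def lie_gl)
  ultimately show "(real r + 1 - real k) * Re (\<alpha> k) = (real r + 1 - real k) * Re (wt i k - wt j k)"
    using assms(2) by simp
qed simp

lemma mspan_root_spaces:
  assumes "x \<in> mspan (\<Union>\<alpha>\<in>A. root_space L r (f \<alpha>))"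
  shows "x \<in> lie L r"
  by (rule mspan_induct[OF assms]) (auto simp: root_space_def lie_zero lie_madd lie_mscale)

lemma n_plus_lie: "x \<in> n_plus L r \<Longrightarrow> x \<in> lie L r"
  unfolding n_plus_def by (rule mspan_root_spaces)

lemma n_minus_lie: "x \<in> n_minus L r \<Longrightarrow> x \<in> lie L r"
  unfolding n_minus_def by (rule mspan_root_spaces)

text \<open>Positive roots have positive height, and the height of \<open>v\<^sub>i\<close> is \<open>r + 1\<close> minus the position of \<open>i\<close>.\<close>

lemma n_plus_upper:
  assumes "x \<in> n_plus L r" "x i j \<noteq> 0"
  shows "pos r i < pos r j"
proof -
  have "\<forall>i j. x i j \<noteq> 0 \<longrightarrow> pos r i < pos r j"
    using assms(1) unfolding n_plus_def
  proof (rule mspan_induct)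
    fix s assume "s \<in> (\<Union>\<alpha>\<in>pos_roots L r. root_space L r \<alpha>)"
    then obtain \<alpha> where \<alpha>: "\<alpha> \<in> pos_roots L r" "s \<in> root_space L r \<alpha>" by auto
    show "\<forall>i j. s i j \<noteq> 0 \<longrightarrow> pos r i < pos r j"
    proof (intro allI impI)
      fix i j assume ij: "s i j \<noteq> 0"
      then have "i \<in> hatV L r" "j \<in> hatV L r"
        using \<alpha>(2) gl_0[of s L r i j] by (auto simp: root_space_def lie_gl)
      then show "pos r i < pos r j"
        using root_space_weight[OF \<alpha>(2) ij] hgt_pos_roots[OF \<alpha>(1)] by (simp add: hgt_diff hgt_wt)
    qed
  qed (auto simp: madd_def mscale_def, metis add.right_neutral)
  then show ?thesis using assms(2) by blast
qed

lemma n_minus_lower: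
  assumes "x \<in> n_minus L r" "x i j \<noteq> 0"
  shows "pos r j < pos r i"
proof -
  have "\<forall>i j. x i j \<noteq> 0 \<longrightarrow> pos r j < pos r i"
    using assms(1) unfolding n_minus_def
  proof (rule mspan_induct)
    fix s assume "s \<in> (\<Union>\<alpha>\<in>pos_roots L r. root_space L r (\<lambda>k. - \<alpha> k))"
    then obtain \<alpha> where \<alpha>: "\<alpha> \<in> pos_roots L r" "s \<in> root_space L r (\<lambda>k. - \<alpha> k)" by auto
    show "\<forall>i j. s i j \<noteq> 0 \<longrightarrow> pos r j < pos r i"
    proof (intro allI impI)
      fix i j assume ij: "s i j \<noteq> 0"
      then have "i \<in> hatV L r" "j \<in> hatV L r"
        using \<alpha>(2) gl_0[of s L r i j] by (auto simp: root_space_def lie_gl)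
      then show "pos r j < pos r i"
        using root_space_weight[OF \<alpha>(2) ij] hgt_pos_roots[OF \<alpha>(1)] by (simp add: hgt_diff hgt_wt hgt_minus)
    qed
  qed (auto simp: madd_def mscale_def, metis add.right_neutral)
  then show ?thesis using assms(2) by blast
qed

lemma Fmat_root_space:
  assumes ij: "i \<in> hatV L r" "j \<in> hatV L r"
    and \<alpha>: "\<And>k. k \<in> {1..r} \<Longrightarrow> \<alpha> k = wt i k - wt j k"
  shows "Fmat L i j \<in> root_space L r \<alpha>"
  unfolding root_space_def
proof (intro CollectI conjI ballI ext)
  show "Fmat L i j \<in> lie L r" by (rule Fmat_lie[OF ij])
  fix k a b assume k: "k \<in> {1..r}"
  have "mbracket L r (Fmat L (int k) (int k)) (Fmat L i j) a b = (wt a k - wt b k) * Fmat L i j a b"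
    using k Fmat_lie[OF ij] by (intro mbracket_cartan) (auto simp: lie_gl)
  also have "\<dots> = (wt i k - wt j k) * Fmat L i j a b"
    by (auto simp: Fmat_def Emat_def wt_uminus)
  finally show "mbracket L r (Fmat L (int k) (int k)) (Fmat L i j) a b = mscale (\<alpha> k) (Fmat L i j) a b"
    using \<alpha>[OF k] by (simp add: mscale_def)
qed

lemma wt_diff_pos_root:
  assumes ij: "i \<in> hatV L r" "j \<in> hatV L r" and lt: "pos r i < pos r j" and "Fmat L i j \<noteq> (\<lambda>a b. 0)"
  shows "(\<lambda>k. wt i k - wt j k) \<in> pos_roots L r"
proof -
  have F0: "L = SP" if "i = - j"
  proof (rule ccontr)
    assume "L \<noteq> SP"
    then have "Fmat L i j = (\<lambda>a b. 0)" using that by (auto simp: Fmat_def Emat_def theta_def)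
    then show False using assms(4) by simp
  qed
  have b: "- int r \<le> i" "i \<le> int r" "- int r \<le> j" "j \<le> int r" "i = 0 \<or> j = 0 \<Longrightarrow> L = SO_odd"
    using ij by (auto simp: hatV_def split: if_splits)
  have P1: "(\<lambda>k. epsw a k - epsw b k) \<in> pos_roots L r" if "1 \<le> a" "a < b" "b \<le> r" for a b
    using that unfolding pos_roots_def by blast
  have P2: "(\<lambda>k. epsw a k + epsw b k) \<in> pos_roots L r" if "1 \<le> a" "a < b" "b \<le> r" for a b
    using that unfolding pos_roots_def by blast
  have P2': "(\<lambda>k. epsw a k + epsw b k) \<in> pos_roots L r" if "1 \<le> a" "a \<le> r" "1 \<le> b" "b \<le> r" "a \<noteq> b" for a b
    using P2[of a b] P2[of b a] that by (cases "a < b") (auto simp: add.commute)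
  have P3: "epsw a \<in> pos_roots L r" if "1 \<le> a" "a \<le> r" "L = SO_odd" for a
    using that unfolding pos_roots_def by auto
  have P4: "(\<lambda>k. epsw a k + epsw a k) \<in> pos_roots L r" if "1 \<le> a" "a \<le> r" "L = SP" for a
  proof -
    have "(\<lambda>k. epsw a k + epsw a k) = (\<lambda>k. 2 * epsw a k)" by auto
    then show ?thesis using that unfolding pos_roots_def by auto
  qed
  consider (pp) "i > 0" "j > 0" | (p0) "i > 0" "j = 0" | (pn) "i > 0" "j < 0" | (on) "i = 0" "j < 0"
    | (nn) "i < 0" "j < 0" | (bad) "i \<le> 0 \<and> j > 0 \<or> i \<le> 0 \<and> j = 0"
    by linarith
  then show ?thesis
  proof cases
    case pp
    then show ?thesis using P1[of "nat i" "nat j"] b lt by (simp add: wt_def pos_def)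
  next
    case p0
    then show ?thesis using P3[of "nat i"] b by (simp add: wt_def)
  next
    case pn
    show ?thesis
    proof (cases "i = - j")
      case True
      then show ?thesis using pn P4[of "nat i"] F0 b by (simp add: wt_def)
    next
      case False
      then show ?thesis using pn P2'[of "nat i" "nat (- j)"] b by (auto simp: wt_def)
    qed
  next
    case on
    then show ?thesis using P3[of "nat (- j)"] b by (simp add: wt_def)
  next
    case nn
    then show ?thesis using P1[of "nat (- j)" "nat (- i)"] b lt by (simp add: wt_def pos_def)
  next
    case bad
    then show ?thesis using lt b by (auto simp: pos_def split: if_splits)
  qed
qed

lemma Fmat_n_plus:
  assumes ij: "i \<in> hatV L r" "j \<in> hatV L r" and lt: "pos r i < pos r j"
  shows "Fmat L i j \<in> n_plus L r"
proof (cases "Fmat L i j = (\<lambda>a b. 0)")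
  case True
  then show ?thesis by (simp add: n_plus_def mspan_zero)
next
  case False
  then show ?thesis
    unfolding n_plus_def
    by (intro mspan_base UN_I[OF wt_diff_pos_root[OF ij lt]] Fmat_root_space[OF ij]) auto
qed

lemma Fmat_n_minus:
  assumes ij: "i \<in> hatV L r" "j \<in> hatV L r" and lt: "pos r j < pos r i"
  shows "Fmat L i j \<in> n_minus L r"
proof (cases "Fmat L i j = (\<lambda>a b. 0)")
  case True
  then show ?thesis by (simp add: n_minus_def mspan_zero)
next
  case False
  have "Fmat L j i \<noteq> (\<lambda>a b. 0)"
  proof
    assume "Fmat L j i = (\<lambda>a b. 0)"
    moreover have "Fmat L i j a b = Fmat L j i b a" for a b
    proof -
      have "theta L i j = theta L j i" by (simp add: theta_def mult.commute)
      then show ?thesis unfolding Fmat_def Emat_def by (simp only: conj_commute)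
    qed
    ultimately have "Fmat L i j = (\<lambda>a b. 0)"
      by (intro ext) simp
    then show False using False by contradiction
  qed
  then show ?thesis
    unfolding n_minus_def
    by (intro mspan_base UN_I[OF wt_diff_pos_root[OF ij(2,1) lt]] Fmat_root_space[OF ij]) auto
qed

lemma pos_inj: "i \<in> hatV L r \<Longrightarrow> j \<in> hatV L r \<Longrightarrow> pos r i = pos r j \<Longrightarrow> i = j"
  by (auto simp: pos_def hatV_def split: if_splits)

definition cartan :: "lie_kind \<Rightarrow> nat \<Rightarrow> cmat set" where
  "cartan L r = (\<lambda>k. Fmat L (int k) (int k)) ` {1..r}"

lemma cartan_lie: "x \<in> cartan L r \<Longrightarrow> x \<in> lie L r"
  by (auto simp: cartan_def intro!: Fmat_lie hatV_pos)

text \<open>The triangular decomposition, from \<open>x = \<Sum>i j. x\<^sub>i\<^sub>j/2 \<cdot> F\<^sub>i\<^sub>j\<close>.\<close>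

lemma lie_triangular:
  assumes "x \<in> lie L r"
  shows "x \<in> mspan (n_minus L r \<union> cartan L r \<union> n_plus L r)"
proof -
  let ?S = "n_minus L r \<union> cartan L r \<union> n_plus L r"
  have F: "Fmat L i j \<in> mspan ?S" if ij: "i \<in> hatV L r" "j \<in> hatV L r" for i j
  proof -
    consider "pos r i < pos r j" | "pos r j < pos r i" | "i = j"
      using pos_inj[OF ij] by linarith
    then show ?thesis
    proof cases
      case 1
      then show ?thesis using Fmat_n_plus[OF ij] by (auto intro: mspan_base)
    next
      case 2
      then show ?thesis using Fmat_n_minus[OF ij] by (auto intro: mspan_base)
    next
      case 3
      consider "i > 0" | "i = 0" | "i < 0" by linarith
      then show ?thesis
      proof cases
        assume "i > 0"
        then have i: "nat i \<in> {1..r}" "int (nat i) = i" using ij by (auto simp: hatV_def split: if_splits)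
        have "Fmat L (int (nat i)) (int (nat i)) \<in> cartan L r"
          unfolding cartan_def using i(1) by (rule imageI)
        then have "Fmat L i j \<in> cartan L r" using i(2) 3 by simp
        then show ?thesis by (auto intro: mspan_base)
      next
        assume i: "i = 0"
        then have "L = SO_odd" using ij by (simp add: hatV_def split: if_splits)
        then have "Fmat L i j = (\<lambda>a b. 0)"
          using 3 i by (simp add: Fmat_def Emat_def theta_def fun_eq_iff)
        then show ?thesis by (simp add: mspan_zero)
      next
        assume i: "i < 0"
        then have n: "nat (- i) \<in> {1..r}" "int (nat (- i)) = - i" using ij by (auto simp: hatV_def split: if_splits)
        have "Fmat L (int (nat (- i))) (int (nat (- i))) \<in> cartan L r"
          unfolding cartan_def using n(1) by (rule imageI)
        then have "Fmat L (- i) (- i) \<in> mspan ?S" unfolding n(2) by (intro mspan_base) simp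
        then have "mscale (- 1) (Fmat L (- i) (- i)) \<in> mspan ?S" by (rule mspan_mscale)
        moreover have "mscale (- 1) (Fmat L (- i) (- i)) = Fmat L i j"
        proof -
          have "theta L i i = 1" "theta L (- i) (- i) = 1" using i by (simp_all add: theta_def)
          then show ?thesis unfolding 3[symmetric] by (simp add: mscale_def Fmat_def fun_eq_iff)
        qed
        ultimately show ?thesis by simp
      qed
    qed
  qed
  have "x a b = (\<Sum>p\<in>hatV L r \<times> hatV L r. (x (fst p) (snd p) / 2) * Fmat L (fst p) (snd p) a b)" for a b
  proof (cases "a \<in> hatV L r \<and> b \<in> hatV L r")
    case True
    have "(\<Sum>p\<in>hatV L r \<times> hatV L r. (x (fst p) (snd p) / 2) * Fmat L (fst p) (snd p) a b)
      = (\<Sum>p\<in>hatV L r \<times> hatV L r. (if p = (a, b) then x a b / 2 else 0) +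
          (if p = (- b, - a) then - theta L a b * x (- b) (- a) / 2 else 0))"
    proof (rule sum.cong[OF refl])
      fix p :: "int \<times> int"
      obtain i j where p: "p = (i, j)" by (cases p)
      have E1: "Emat i j a b = (if p = (a, b) then 1 else 0)"
        unfolding Emat_def p by (rule if_cong) auto
      have E2: "Emat (- j) (- i) a b = (if p = (- b, - a) then 1 else 0)"
        unfolding Emat_def p by (rule if_cong) (auto simp: equation_minus_iff)
      have A: "x i j / 2 * (if p = (a, b) then 1 else 0) = (if p = (a, b) then x a b / 2 else 0)"
        by (simp add: p)
      have B: "x i j / 2 * (theta L i j * (if p = (- b, - a) then 1 else 0))
          = (if p = (- b, - a) then x (- b) (- a) / 2 * theta L a b else 0)"
        by (simp add: p theta_uminus)
      show "x (fst p) (snd p) / 2 * Fmat L (fst p) (snd p) a b =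
          (if p = (a, b) then x a b / 2 else 0) +
          (if p = (- b, - a) then - theta L a b * x (- b) (- a) / 2 else 0)"
      proof -
        have "x i j / 2 * Fmat L i j a b = (if p = (a, b) then x a b / 2 else 0)
            - (if p = (- b, - a) then x (- b) (- a) / 2 * theta L a b else 0)"
          unfolding Fmat_def E1 E2 right_diff_distrib A B ..
        also have "\<dots> = (if p = (a, b) then x a b / 2 else 0) +
          (if p = (- b, - a) then - theta L a b * x (- b) (- a) / 2 else 0)"
          by simp
        finally show ?thesis by (simp only: p fst_conv snd_conv)
      qed
    qed
    also have "\<dots> = x a b"
      using True lie_sym[OF assms, of a b] by (simp add: sum.distrib)
    finally show ?thesis by simp
  next
    case False
    then have "x a b = 0"
      using gl_0[OF lie_gl[OF assms]] by blast
    moreover have "(\<Sum>p\<in>hatV L r \<times> hatV L r. (x (fst p) (snd p) / 2) * Fmat L (fst p) (snd p) a b) = 0"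
    proof (intro sum.neutral ballI)
      fix p assume "p \<in> hatV L r \<times> hatV L r"
      then have "Fmat L (fst p) (snd p) \<in> gl L r" by (intro lie_gl Fmat_lie) auto
      then have "Fmat L (fst p) (snd p) a b = 0" using False gl_0 by blast
      then show "(x (fst p) (snd p) / 2) * Fmat L (fst p) (snd p) a b = 0" by simp
    qed
    ultimately show ?thesis by simp
  qed
  then have "x = (\<lambda>a b. \<Sum>p\<in>hatV L r \<times> hatV L r. (x (fst p) (snd p) / 2) * Fmat L (fst p) (snd p) a b)"
    by (intro ext)
  also have "\<dots> \<in> mspan ?S"
    by (intro mspan_sum) (auto intro: F)
  finally show ?thesis .
qed

section \<open>Rings given by a subring of a type\<close>

definition type_ring :: "'a::ring_1 set \<Rightarrow> 'a ring" where
  "type_ring C = \<lparr>carrier = C, monoid.mult = (*), one = 1, zero = 0, add = (+)\<rparr>"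

definition is_subring :: "'a::ring_1 set \<Rightarrow> bool" where
  "is_subring C \<longleftrightarrow> 0 \<in> C \<and> 1 \<in> C \<and> (\<forall>a\<in>C. - a \<in> C) \<and> (\<forall>a\<in>C. \<forall>b\<in>C. a + b \<in> C \<and> a * b \<in> C)"

lemma ring_type_ring:
  assumes "is_subring C"
  shows "ring (type_ring C)"
proof (rule ringI)
  show "abelian_group (type_ring C)"
    using assms
    by (intro abelian_groupI) (auto simp: type_ring_def is_subring_def add.assoc add.commute intro!: bexI[of _ "- _"])
  show "monoid (type_ring C)"
    using assms by (intro monoidI) (auto simp: type_ring_def is_subring_def mult.assoc)
qed (auto simp: type_ring_def algebra_simps)

lemma a_inv_type_ring:
  assumes "is_subring C" "a \<in> C"
  shows "\<ominus>\<^bsub>type_ring C\<^esub> a = - a"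
proof -
  interpret ring "type_ring C" by (rule ring_type_ring[OF assms(1)])
  show ?thesis
    using assms by (intro minus_equality) (auto simp: type_ring_def is_subring_def)
qed

lemma type_ring_idealI:
  assumes "is_subring C" "I \<subseteq> C" "0 \<in> I" "\<And>a b. a \<in> I \<Longrightarrow> b \<in> I \<Longrightarrow> a + b \<in> I" "\<And>a. a \<in> I \<Longrightarrow> - a \<in> I"
    "\<And>a x. a \<in> I \<Longrightarrow> x \<in> C \<Longrightarrow> x * a \<in> I" "\<And>a x. a \<in> I \<Longrightarrow> x \<in> C \<Longrightarrow> a * x \<in> I"
  shows "ideal I (type_ring C)"
proof (rule idealI)
  interpret ring "type_ring C" by (rule ring_type_ring[OF assms(1)])
  show "ring (type_ring C)" ..
  show "subgroup I (add_monoid (type_ring C))"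
  proof (rule group.subgroupI)
    show "group (add_monoid (type_ring C))" by (rule add.group_axioms)
    fix a assume a: "a \<in> I"
    have "inv\<^bsub>add_monoid (type_ring C)\<^esub> a = - a"
      using a_inv_type_ring[OF assms(1), of a] a assms(2) by (auto simp: a_inv_def)
    then show "inv\<^bsub>add_monoid (type_ring C)\<^esub> a \<in> I" using assms(5)[OF a] by simp
  qed (use assms in \<open>auto simp: type_ring_def\<close>)
qed (use assms in \<open>auto simp: type_ring_def\<close>)

lemma type_ring_idealD:
  assumes "is_subring C" "ideal I (type_ring C)"
  shows "I \<subseteq> C" "0 \<in> I" "\<And>a b. a \<in> I \<Longrightarrow> b \<in> I \<Longrightarrow> a + b \<in> I" "\<And>a. a \<in> I \<Longrightarrow> - a \<in> I"
    "\<And>a b. a \<in> I \<Longrightarrow> b \<in> I \<Longrightarrow> a - b \<in> I"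
    "\<And>a x. a \<in> I \<Longrightarrow> x \<in> C \<Longrightarrow> x * a \<in> I" "\<And>a x. a \<in> I \<Longrightarrow> x \<in> C \<Longrightarrow> a * x \<in> I"
proof -
  interpret ideal I "type_ring C" by (rule assms(2))
  show sub: "I \<subseteq> C" using a_subset by (simp add: type_ring_def)
  show "0 \<in> I" using additive_subgroup.zero_closed[OF is_additive_subgroup] by (simp add: type_ring_def)
  show add: "a + b \<in> I" if "a \<in> I" "b \<in> I" for a b
    using additive_subgroup.a_closed[OF is_additive_subgroup that] by (simp add: type_ring_def)
  show neg: "- a \<in> I" if "a \<in> I" for a
  proof -
    have "\<ominus>\<^bsub>type_ring C\<^esub> a \<in> I"
      by (rule additive_subgroup.a_inv_closed[OF is_additive_subgroup that])
    moreover have "\<ominus>\<^bsub>type_ring C\<^esub> a = - a"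
      using that sub by (intro a_inv_type_ring[OF assms(1)]) auto
    ultimately show ?thesis by (simp only:)
  qed
  show "a - b \<in> I" if "a \<in> I" "b \<in> I" for a b
    using add[OF that(1) neg[OF that(2)]] by simp
  show "x * a \<in> I" if "a \<in> I" "x \<in> C" for a x
    using I_l_closed[of a x] that by (simp add: type_ring_def)
  show "a * x \<in> I" if "a \<in> I" "x \<in> C" for a x
    using I_r_closed[of a x] that by (simp add: type_ring_def)
qed

lemma type_ring_coset: "I +>\<^bsub>type_ring C\<^esub> a = {h + a | h. h \<in> I}"
  by (auto simp: a_r_coset_def' type_ring_def)

lemma type_ring_coset_eq_iff:
  assumes "is_subring C" "ideal I (type_ring C)"
  shows "I +>\<^bsub>type_ring C\<^esub> a = I +>\<^bsub>type_ring C\<^esub> b \<longleftrightarrow> a - b \<in> I"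
proof
  note I = type_ring_idealD[OF assms]
  assume eq: "I +>\<^bsub>type_ring C\<^esub> a = I +>\<^bsub>type_ring C\<^esub> b"
  have "a \<in> {h + a | h. h \<in> I}" using I(2) by (intro CollectI exI[of _ 0]) simp
  also have "{h + a | h. h \<in> I} = {h + b | h. h \<in> I}" using eq unfolding type_ring_coset .
  finally obtain h where "a = h + b" "h \<in> I" by blast
  then show "a - b \<in> I" by simp
next
  note I = type_ring_idealD[OF assms]
  assume ab: "a - b \<in> I"
  show "I +>\<^bsub>type_ring C\<^esub> a = I +>\<^bsub>type_ring C\<^esub> b"
    unfolding type_ring_coset
  proof (intro equalityI subsetI)
    fix z assume "z \<in> {h + a | h. h \<in> I}"
    then obtain h where "h \<in> I" "z = h + a" by auto
    then have "z = (h + (a - b)) + b" "h + (a - b) \<in> I" using I(3)[OF _ ab] by simp_all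
    then show "z \<in> {h + b | h. h \<in> I}" by (intro CollectI exI conjI)
  next
    fix z assume "z \<in> {h + b | h. h \<in> I}"
    then obtain h where "h \<in> I" "z = h + b" by auto
    then have "z = (h - (a - b)) + a" "h - (a - b) \<in> I" using I(5)[OF _ ab] by simp_all
    then show "z \<in> {h + a | h. h \<in> I}" by (intro CollectI exI conjI)
  qed
qed

text \<open>The elements all of whose two-sided multiples have an additive property form a two-sided
  ideal.\<close>

lemma genideal_induct:
  assumes C: "is_subring C" "S \<subseteq> C" and a: "a \<in> genideal (type_ring C) S"
    and P: "P 0" "\<And>a b. P a \<Longrightarrow> P b \<Longrightarrow> P (a + b)" "\<And>u s v. u \<in> C \<Longrightarrow> v \<in> C \<Longrightarrow> s \<in> S \<Longrightarrow> P (u * s * v)"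
  shows "P a"
proof -
  interpret ring "type_ring C" by (rule ring_type_ring[OF C(1)])
  note c = C(1)[unfolded is_subring_def]
  define K where "K = {a \<in> C. \<forall>u\<in>C. \<forall>v\<in>C. P (u * a * v)}"
  have "ideal K (type_ring C)"
  proof (rule type_ring_idealI[OF C(1)])
    show "K \<subseteq> C" by (auto simp: K_def)
    show "0 \<in> K" using c P(1) by (simp add: K_def)
    show "a + b \<in> K" if "a \<in> K" "b \<in> K" for a b
      using that c P(2) by (simp add: K_def distrib_left distrib_right)
    show "- a \<in> K" if "a \<in> K" for a
    proof -
      have "P (u * (- a) * v)" if uv: "u \<in> C" "v \<in> C" for u v
      proof -
        have "P ((- u) * a * v)" using \<open>a \<in> K\<close> uv c unfolding K_def by blast
        then show ?thesis by simp
      qed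
      then show ?thesis using that c by (simp add: K_def)
    qed
    show "x * a \<in> K" if "a \<in> K" "x \<in> C" for a x
    proof -
      have "P (u * (x * a) * v)" if uv: "u \<in> C" "v \<in> C" for u v
      proof -
        have "P ((u * x) * a * v)" using \<open>a \<in> K\<close> \<open>x \<in> C\<close> uv c unfolding K_def by blast
        then show ?thesis by (simp add: mult.assoc)
      qed
      then show ?thesis using that c by (simp add: K_def)
    qed
    show "a * x \<in> K" if "a \<in> K" "x \<in> C" for a x
    proof -
      have "P (u * (a * x) * v)" if uv: "u \<in> C" "v \<in> C" for u v
      proof -
        have "P (u * a * (x * v))" using \<open>a \<in> K\<close> \<open>x \<in> C\<close> uv c unfolding K_def by blast
        then show ?thesis by (simp add: mult.assoc)
      qed
      then show ?thesis using that c by (simp add: K_def)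
    qed
  qed
  moreover have "S \<subseteq> K" using C(2) P(3) by (auto simp: K_def)
  ultimately have "a \<in> K" using genideal_minimal a by blast
  then have "P (1 * a * 1)" using c unfolding K_def by blast
  then show ?thesis by simp
qed

section \<open>Linear extension from a basis\<close>

lemma poly_mapping_induct_keys [consumes 1, case_names zero single add]:
  assumes "Poly_Mapping.keys a \<subseteq> A" "P 0" "\<And>k c. k \<in> A \<Longrightarrow> P (Poly_Mapping.single k c)"
    "\<And>a b. P a \<Longrightarrow> P b \<Longrightarrow> P (a + b)"
  shows "P (a :: 'k \<Rightarrow>\<^sub>0 'c::comm_monoid_add)"
proof -
  have sum: "P (\<Sum>k\<in>B. Poly_Mapping.single k (c k))" if "finite B" "B \<subseteq> A" for B and c :: "'k \<Rightarrow> 'c"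
    using that by (induction B rule: finite_induct) (auto intro: assms)
  have "a = (\<Sum>k\<in>Poly_Mapping.keys a. Poly_Mapping.single k (Poly_Mapping.lookup a k))"
    by (rule poly_mapping_eqI) (auto simp: lookup_sum lookup_single when_def in_keys_iff)
  then show ?thesis using sum[OF finite_keys assms(1)] by metis
qed

lemmas poly_mapping_induct = poly_mapping_induct_keys[OF subset_UNIV, case_names zero single add]

definition lext :: "(complex \<Rightarrow> 'v::ring) \<Rightarrow> ('k \<Rightarrow> 'v) \<Rightarrow> ('k \<Rightarrow>\<^sub>0 complex) \<Rightarrow> 'v" where
  "lext s f a = (\<Sum>k\<in>Poly_Mapping.keys a. s (Poly_Mapping.lookup a k) * f k)"

lemma lext_superset:
  assumes "s 0 = 0" "finite A" "Poly_Mapping.keys a \<subseteq> A"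
  shows "lext s f a = (\<Sum>k\<in>A. s (Poly_Mapping.lookup a k) * f k)"
  unfolding lext_def using assms by (intro sum.mono_neutral_left) (auto simp: in_keys_iff)

lemma lext_0 [simp]: "lext s f 0 = 0"
  by (simp add: lext_def)

lemma lext_single: "s 0 = 0 \<Longrightarrow> lext s f (Poly_Mapping.single k c) = s c * f k"
  by (simp add: lext_def)

lemma lext_add:
  assumes "s 0 = 0" "\<And>a b. s (a + b) = s a + s b"
  shows "lext s f (a + b) = lext s f a + lext s f b"
proof -
  let ?A = "Poly_Mapping.keys a \<union> Poly_Mapping.keys b"
  have "lext s f (a + b) = (\<Sum>k\<in>?A. s (Poly_Mapping.lookup (a + b) k) * f k)"
    using assms(1) by (rule lext_superset) (auto dest: subsetD[OF Poly_Mapping.keys_add])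
  moreover have "lext s f a = (\<Sum>k\<in>?A. s (Poly_Mapping.lookup a k) * f k)"
    using assms(1) by (rule lext_superset) auto
  moreover have "lext s f b = (\<Sum>k\<in>?A. s (Poly_Mapping.lookup b k) * f k)"
    using assms(1) by (rule lext_superset) auto
  ultimately show ?thesis
    by (simp add: lookup_add assms(2) distrib_right sum.distrib)
qed

section \<open>Free algebra and enveloping algebra\<close>

definition FA :: "lie_kind \<Rightarrow> nat \<Rightarrow> free_alg set" where
  "FA L r = {a. \<forall>w\<in>Poly_Mapping.keys a. set (letters w) \<subseteq> lie L r}"

lemma free_on_eq: "free_on L r = type_ring (FA L r)"
  by (simp add: free_on_def type_ring_def FA_def)

lemma Word_plus: "Word v + Word w = Word (v @ w)"
  by (simp add: plus_word_def)

lemma Word_Nil: "Word [] = 0"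
  by (simp add: zero_word_def)

lemma letters_plus: "letters (v + w) = letters v @ letters w"
  by (simp add: plus_word_def)

lemma letters_0: "letters 0 = []"
  by (simp add: zero_word_def)

lemma FA_subring: "is_subring (FA L r)"
  unfolding is_subring_def
proof (intro conjI ballI)
  fix a b assume ab: "a \<in> FA L r" "b \<in> FA L r"
  show "- a \<in> FA L r" using ab(1) by (simp add: FA_def in_keys_iff)
  show "a + b \<in> FA L r" using ab subsetD[OF Poly_Mapping.keys_add[of a b]] by (auto simp: FA_def)
  show "a * b \<in> FA L r"
    unfolding FA_def
  proof (intro CollectI ballI)
    fix w assume "w \<in> Poly_Mapping.keys (a * b)"
    then obtain u v where "w = u + v" "u \<in> Poly_Mapping.keys a" "v \<in> Poly_Mapping.keys b"
      using subsetD[OF keys_mult[of a b]] by blast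
    then show "set (letters w) \<subseteq> lie L r" using ab by (auto simp: FA_def letters_plus)
  qed
qed (auto simp: FA_def letters_0)

lemma FA_0 [simp]: "0 \<in> FA L r" and FA_1 [simp]: "1 \<in> FA L r"
  and FA_uminus [simp]: "a \<in> FA L r \<Longrightarrow> - a \<in> FA L r"
  and FA_add [simp]: "a \<in> FA L r \<Longrightarrow> b \<in> FA L r \<Longrightarrow> a + b \<in> FA L r"
  and FA_mult [simp]: "a \<in> FA L r \<Longrightarrow> b \<in> FA L r \<Longrightarrow> a * b \<in> FA L r"
  using FA_subring[of L r] by (auto simp: is_subring_def)

lemma FA_diff [simp]: "a \<in> FA L r \<Longrightarrow> b \<in> FA L r \<Longrightarrow> a - b \<in> FA L r"
  using FA_add[of a L r "- b"] by simp

lemma FA_sum: "(\<And>x. x \<in> A \<Longrightarrow> f x \<in> FA L r) \<Longrightarrow> sum f A \<in> FA L r"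
  by (induction A rule: infinite_finite_induct) auto

lemma FA_power [simp]: "a \<in> FA L r \<Longrightarrow> a ^ n \<in> FA L r"
  by (induction n) auto

lemma FA_prod_list: "(\<And>x. x \<in> set xs \<Longrightarrow> f x \<in> FA L r) \<Longrightarrow> prod_list (map f xs) \<in> FA L r"
  by (induction xs) auto

lemma FA_single: "set (letters w) \<subseteq> lie L r \<Longrightarrow> Poly_Mapping.single w c \<in> FA L r"
  by (auto simp: FA_def split: if_splits)

lemma FA_const [simp]: "const c \<in> FA L r"
  unfolding const_def by (rule FA_single) (simp add: letters_0)

lemma FA_gen [simp]: "x \<in> lie L r \<Longrightarrow> gen x \<in> FA L r"
  unfolding gen_def by (rule FA_single) simp

lemma FA_keys: "a \<in> FA L r \<Longrightarrow> Poly_Mapping.keys a \<subseteq> {w. set (letters w) \<subseteq> lie L r}"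
  by (auto simp: FA_def)

lemma U_rels_FA: "U_rels L r \<subseteq> FA L r"
  unfolding U_rels_def by (auto intro!: FA_diff FA_mult FA_gen lie_madd lie_mscale lie_mbracket)

lemma U_ideal_eq: "U_ideal L r = genideal (type_ring (FA L r)) (U_rels L r)"
  by (simp add: U_ideal_def free_on_eq)

lemma ideal_U_ideal: "ideal (U_ideal L r) (type_ring (FA L r))"
proof -
  interpret ring "type_ring (FA L r)" by (rule ring_type_ring[OF FA_subring])
  show ?thesis
    unfolding U_ideal_eq using U_rels_FA by (intro genideal_ideal) (simp add: type_ring_def)
qed

lemmas U_ideal_subset = type_ring_idealD(1)[OF FA_subring ideal_U_ideal]
  and U_ideal_0 = type_ring_idealD(2)[OF FA_subring ideal_U_ideal]
  and U_ideal_add = type_ring_idealD(3)[OF FA_subring ideal_U_ideal]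
  and U_ideal_uminus = type_ring_idealD(4)[OF FA_subring ideal_U_ideal]
  and U_ideal_mult_left = type_ring_idealD(6)[OF FA_subring ideal_U_ideal]
  and U_ideal_mult_right = type_ring_idealD(7)[OF FA_subring ideal_U_ideal]

lemma U_rels_U_ideal: "U_rels L r \<subseteq> U_ideal L r"
proof -
  interpret ring "type_ring (FA L r)" by (rule ring_type_ring[OF FA_subring])
  show ?thesis
    unfolding U_ideal_eq using U_rels_FA by (intro genideal_self) (simp add: type_ring_def)
qed

lemma U_ideal_madd: "x \<in> lie L r \<Longrightarrow> y \<in> lie L r \<Longrightarrow> gen (madd x y) - gen x - gen y \<in> U_ideal L r"
  and U_ideal_mscale: "x \<in> lie L r \<Longrightarrow> gen (mscale c x) - const c * gen x \<in> U_ideal L r"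
  and U_ideal_mbracket: "x \<in> lie L r \<Longrightarrow> y \<in> lie L r \<Longrightarrow>
     gen x * gen y - gen y * gen x - gen (mbracket L r x y) \<in> U_ideal L r"
  by (rule subsetD[OF U_rels_U_ideal], unfold U_rels_def, blast)+

lemma U_class_eq_iff: "U_class L r a = U_class L r b \<longleftrightarrow> a - b \<in> U_ideal L r"
  unfolding U_class_def free_on_eq by (rule type_ring_coset_eq_iff[OF FA_subring ideal_U_ideal])

lemma ring_hom_U_class: "ring_hom_ring (type_ring (FA L r)) (U L r) (U_class L r)"
proof -
  interpret ideal "U_ideal L r" "type_ring (FA L r)" by (rule ideal_U_ideal)
  have "U_class L r = (+>\<^bsub>type_ring (FA L r)\<^esub>) (U_ideal L r)"
    by (rule ext) (simp add: U_class_def free_on_eq)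
  then show ?thesis using rcos_ring_hom_ring by (simp add: U_def free_on_eq)
qed

lemma ring_U: "ring (U L r)"
  using ring_hom_U_class by (rule ring_hom_ring.axioms)

lemma U_class_add: "a \<in> FA L r \<Longrightarrow> b \<in> FA L r \<Longrightarrow> U_class L r a \<oplus>\<^bsub>U L r\<^esub> U_class L r b = U_class L r (a + b)"
  and U_class_mult: "a \<in> FA L r \<Longrightarrow> b \<in> FA L r \<Longrightarrow> U_class L r a \<otimes>\<^bsub>U L r\<^esub> U_class L r b = U_class L r (a * b)"
  and U_class_one: "\<one>\<^bsub>U L r\<^esub> = U_class L r 1"
  and U_class_zero: "\<zero>\<^bsub>U L r\<^esub> = U_class L r 0"
  and U_class_carrier: "a \<in> FA L r \<Longrightarrow> U_class L r a \<in> carrier (U L r)"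
proof -
  interpret h: ring_hom_ring "type_ring (FA L r)" "U L r" "U_class L r" by (rule ring_hom_U_class)
  show "a \<in> FA L r \<Longrightarrow> b \<in> FA L r \<Longrightarrow> U_class L r a \<oplus>\<^bsub>U L r\<^esub> U_class L r b = U_class L r (a + b)"
    using h.hom_add[of a b] by (simp add: type_ring_def)
  show "a \<in> FA L r \<Longrightarrow> b \<in> FA L r \<Longrightarrow> U_class L r a \<otimes>\<^bsub>U L r\<^esub> U_class L r b = U_class L r (a * b)"
    using h.hom_mult[of a b] by (simp add: type_ring_def)
  show "\<one>\<^bsub>U L r\<^esub> = U_class L r 1" using h.hom_one by (simp add: type_ring_def)
  show "\<zero>\<^bsub>U L r\<^esub> = U_class L r 0" using h.hom_zero by (simp add: type_ring_def)
  show "a \<in> FA L r \<Longrightarrow> U_class L r a \<in> carrier (U L r)"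
    using h.hom_closed[of a] by (simp add: type_ring_def)
qed

lemma carrier_U: "carrier (U L r) = U_class L r ` FA L r"
  unfolding U_def FactRing_def free_on_eq
  by (auto simp: A_RCOSETS_def' U_class_def free_on_eq type_ring_def)

lemma U_class_uminus: "a \<in> FA L r \<Longrightarrow> \<ominus>\<^bsub>U L r\<^esub> U_class L r a = U_class L r (- a)"
proof -
  assume a: "a \<in> FA L r"
  interpret ring "U L r" by (rule ring_U)
  show ?thesis
    by (rule minus_equality) (simp_all add: a U_class_add U_class_zero U_class_carrier)
qed

lemma U_ideal_induct:
  assumes "a \<in> U_ideal L r" "P 0" "\<And>a b. P a \<Longrightarrow> P b \<Longrightarrow> P (a + b)"
    "\<And>u s v. u \<in> FA L r \<Longrightarrow> v \<in> FA L r \<Longrightarrow> s \<in> U_rels L r \<Longrightarrow> P (u * s * v)"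
  shows "P a"
  using FA_subring U_rels_FA assms(1)[unfolded U_ideal_eq] by (rule genideal_induct) (fact assms)+

section \<open>The Harish-Chandra functional on the enveloping algebra\<close>

definition hc_fun :: "lie_kind \<Rightarrow> nat \<Rightarrow> free_alg \<Rightarrow> hpoly" where
  "hc_fun L r = lext const (\<lambda>w. ev (hcf L r) (letters w))"

lemma hc_fun_0 [simp]: "hc_fun L r 0 = 0"
  by (simp add: hc_fun_def)

lemma hc_fun_single: "hc_fun L r (Poly_Mapping.single w c) = const c * ev (hcf L r) (letters w)"
  by (simp add: hc_fun_def lext_single)

lemma hc_fun_add: "hc_fun L r (a + b) = hc_fun L r a + hc_fun L r b"
  unfolding hc_fun_def by (rule lext_add) (simp_all add: const_add)

lemma hc_fun_uminus: "hc_fun L r (- a) = - hc_fun L r a"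
  using hc_fun_add[of L r a "- a"] by (simp add: eq_neg_iff_add_eq_0 add.commute)

lemma hc_fun_diff: "hc_fun L r (a - b) = hc_fun L r a - hc_fun L r b"
  using hc_fun_add[of L r a "- b"] by (simp add: hc_fun_uminus)

lemma hc_fun_sum: "hc_fun L r (sum f A) = (\<Sum>x\<in>A. hc_fun L r (f x))"
  by (induction A rule: infinite_finite_induct) (simp_all add: hc_fun_add)

lemma hc_fun_1: "hc_fun L r 1 = 1"
  using hc_fun_single[of L r 0 1] by (simp add: letters_0 ev_hcf_Nil)

lemma const_mult_single: "const c * Poly_Mapping.single w d = (Poly_Mapping.single w (c * d) :: 'k::monoid_add \<Rightarrow>\<^sub>0 complex)"
  by (simp add: const_def mult_single)

lemma single_mult_const: "Poly_Mapping.single w d * const c = (Poly_Mapping.single w (d * c) :: 'k::monoid_add \<Rightarrow>\<^sub>0 complex)"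
  by (simp add: const_def mult_single)

lemma const_commute: "const c * a = (a * const c :: 'k::monoid_add \<Rightarrow>\<^sub>0 complex)"
  by (induction a rule: poly_mapping_induct)
     (simp_all add: const_mult_single single_mult_const mult.commute distrib_left distrib_right)

lemma gen_mult_single: "gen x * Poly_Mapping.single w c = Poly_Mapping.single (Word (x # letters w)) c"
  by (simp add: gen_def mult_single plus_word_def)

lemma single_mult_gen: "Poly_Mapping.single w c * gen x = Poly_Mapping.single (Word (letters w @ [x])) c"
  by (simp add: gen_def mult_single plus_word_def)

lemma hc_fun_const: "hc_fun L r (const c * a) = const c * hc_fun L r a"
  by (induction a rule: poly_mapping_induct)
     (simp_all add: const_mult_single hc_fun_single hc_fun_add distrib_left const_mult mult.assoc)

lemma hc_fun_U_ideal:
  assumes "a \<in> U_ideal L r"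
  shows "hc_fun L r a = 0"
  using assms
proof (rule U_ideal_induct)
  fix u s v :: free_alg
  assume s: "s \<in> U_rels L r"
  have word: "hc_fun L r (Poly_Mapping.single k c * s * Poly_Mapping.single l d) = 0" for k l c d
  proof -
    have g: "hc_fun L r (Poly_Mapping.single k c * gen x * Poly_Mapping.single l d)
        = const (c * d) * ev (hcf L r) (letters k @ x # letters l)" for x
      by (simp add: single_mult_gen mult_single plus_word_def hc_fun_single)
    have gg: "hc_fun L r (Poly_Mapping.single k c * (gen x * gen y) * Poly_Mapping.single l d)
        = const (c * d) * ev (hcf L r) (letters k @ x # y # letters l)" for x y
      by (simp add: single_mult_gen mult.assoc[symmetric] mult_single plus_word_def hc_fun_single)
    have cg: "hc_fun L r (Poly_Mapping.single k c * (const e * gen x) * Poly_Mapping.single l d)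
        = const (c * d) * (const e * ev (hcf L r) (letters k @ x # letters l))" for e x
    proof -
      have "Poly_Mapping.single k c * (const e * gen x) * Poly_Mapping.single l d
          = const e * (Poly_Mapping.single k c * gen x * Poly_Mapping.single l d)"
        by (simp only: mult.assoc[symmetric] const_commute[of e "Poly_Mapping.single k c"])
      then show ?thesis by (simp add: hc_fun_const g mult.left_commute)
    qed
    note rel = compatD[OF compat_hcf]
    from s consider x y where "s = gen (madd x y) - gen x - gen y"
      | e x where "s = gen (mscale e x) - const e * gen x"
      | x y where "s = gen x * gen y - gen y * gen x - gen (mbracket L r x y)"
      unfolding U_rels_def by blast
    then show ?thesis
      by cases (simp_all add: right_diff_distrib left_diff_distrib hc_fun_diff g gg cg rel distrib_left)
  qed
  have "hc_fun L r (u * s * Poly_Mapping.single l d) = 0" for l d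
    by (induction u rule: poly_mapping_induct) (simp_all add: word distrib_right hc_fun_add)
  then show "hc_fun L r (u * s * v) = 0"
    by (induction v rule: poly_mapping_induct) (simp_all add: distrib_left hc_fun_add)
qed (simp_all add: hc_fun_add)

lemma hc_fun_cong: "a - b \<in> U_ideal L r \<Longrightarrow> hc_fun L r a = hc_fun L r b"
  using hc_fun_U_ideal[of "a - b" L r] by (simp add: hc_fun_diff)

lemma hc_fun_gen_mult:
  assumes "Dl x (hcf L r) = scal t * hcf L r"
  shows "hc_fun L r (gen x * a) = t * hc_fun L r a"
proof (induction a rule: poly_mapping_induct)
  case (single k c)
  have "ev (hcf L r) (x # letters k) = t * ev (hcf L r) (letters k)"
    using arg_cong[OF assms, of "\<lambda>f. ev f (letters k)"] by simp
  then show ?case by (simp add: gen_mult_single hc_fun_single mult.left_commute)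
qed (simp_all add: distrib_left hc_fun_add)

lemma hc_fun_n_minus:
  assumes "x \<in> n_minus L r"
  shows "hc_fun L r (gen x * a) = 0"
proof -
  have "Dl x (hcf L r) = scal (\<Sum>j=1..r. const (x (int j) (int j)) * hvar j) * hcf L r"
    using n_minus_lower[OF assms] by (intro Dl_hcf) (auto intro: less_imp_le)
  moreover have "x i i = 0" for i using n_minus_lower[OF assms, of i i] by auto
  ultimately have "Dl x (hcf L r) = scal 0 * hcf L r" by simp
  from hc_fun_gen_mult[OF this] show ?thesis by simp
qed

lemma hc_fun_cartan:
  assumes k: "k \<in> {1..r}"
  shows "hc_fun L r (gen (Fmat L (int k) (int k)) * a) = hvar k * hc_fun L r a"
proof (rule hc_fun_gen_mult)
  note F = Fmat_diag[of k L]
  have "Dl (Fmat L (int k) (int k)) (hcf L r)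
      = scal (\<Sum>j=1..r. const (Fmat L (int k) (int k) (int j) (int j)) * hvar j) * hcf L r"
    using k by (intro Dl_hcf) (auto simp: F split: if_splits)
  also have "(\<Sum>j=1..r. const (Fmat L (int k) (int k) (int j) (int j)) * hvar j) = (\<Sum>j=1..r. if j = k then hvar k else 0)"
    using k by (intro sum.cong) (auto simp: F wt_def epsw_def)
  also have "\<dots> = hvar k" using k by simp
  finally show "Dl (Fmat L (int k) (int k)) (hcf L r) = scal (hvar k) * hcf L r" .
qed

lemma hc_fun_n_plus:
  assumes "x \<in> n_plus L r"
  shows "hc_fun L r (a * gen x) = 0"
proof (induction a rule: poly_mapping_induct)
  case (single k c)
  have "Dr x (hcf L r) = 0"
    using n_plus_upper[OF assms] by (intro Dr_hcf) auto
  from arg_cong[OF this, of "\<lambda>f. ev f (letters k)"]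
  show ?case by (simp add: single_mult_gen hc_fun_single)
qed (simp_all add: distrib_right hc_fun_add)

text \<open>The value does not depend on the representative, since \<open>hc_fun\<close> vanishes on the ideal.\<close>

definition hc_map :: "lie_kind \<Rightarrow> nat \<Rightarrow> free_alg set \<Rightarrow> hpoly" where
  "hc_map L r A = hc_fun L r (SOME a. a \<in> FA L r \<and> U_class L r a = A)"

lemma U_class_someI:
  assumes "a \<in> FA L r"
  shows "(SOME b. b \<in> FA L r \<and> U_class L r b = U_class L r a) - a \<in> U_ideal L r"
proof -
  have "(SOME b. b \<in> FA L r \<and> U_class L r b = U_class L r a) \<in> FA L r
    \<and> U_class L r (SOME b. b \<in> FA L r \<and> U_class L r b = U_class L r a) = U_class L r a"
    by (rule someI[of _ a]) (simp add: assms)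
  then show ?thesis unfolding U_class_eq_iff by blast
qed

lemma hc_map_class: "a \<in> FA L r \<Longrightarrow> hc_map L r (U_class L r a) = hc_fun L r a"
  unfolding hc_map_def by (rule hc_fun_cong) (rule U_class_someI)

section \<open>Augmentations\<close>

lemma word_plus_eq_0: "k + l = 0 \<longleftrightarrow> k = 0 \<and> l = (0 :: 'a word)"
  by (cases k; cases l) (simp add: plus_word_def zero_word_def)

lemma lookup_mult_0: "Poly_Mapping.lookup (a * b) (0 :: 'a word) = Poly_Mapping.lookup a 0 * (Poly_Mapping.lookup b 0 :: complex)"
proof (induction a rule: poly_mapping_induct)
  case (single k c)
  show ?case
    by (induction b rule: poly_mapping_induct)
       (auto simp: mult_single lookup_single when_def word_plus_eq_0 distrib_left lookup_add)
qed (simp_all add: distrib_right lookup_add)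

lemma lookup_gen_0: "Poly_Mapping.lookup (gen x) 0 = 0"
  by (simp add: gen_def lookup_single when_def zero_word_def)

lemma U_ideal_lookup_0:
  assumes "a \<in> U_ideal L r"
  shows "Poly_Mapping.lookup a 0 = 0"
  using assms
proof (rule U_ideal_induct)
  fix u s v :: free_alg
  assume "s \<in> U_rels L r"
  then have "Poly_Mapping.lookup s 0 = 0"
    unfolding U_rels_def by (auto simp: lookup_minus lookup_mult_0 lookup_gen_0)
  then show "Poly_Mapping.lookup (u * s * v) 0 = 0" by (simp add: lookup_mult_0)
qed (simp_all add: lookup_add)

lemma U_subalg_carrier:
  assumes "S \<subseteq> lie L r" "A \<in> U_subalg L r S"
  shows "A \<in> carrier (U L r)"
proof -
  interpret ring "U L r" by (rule ring_U)
  have "range (U_scalar L r) \<union> U_gen L r ` S \<subseteq> carrier (U L r)"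
    using assms(1) by (auto simp: U_scalar_def U_gen_def U_class_carrier)
  then show ?thesis
    using generate_ring_in_carrier assms(2) unfolding U_subalg_def by blast
qed

text \<open>The counit, that is the coefficient of the empty word, restricts to an augmentation of each of the
  subalgebras.\<close>

lemma is_augmentation_aug:
  assumes "S \<subseteq> lie L r"
  shows "is_augmentation L r S (aug L r S)"
proof -
  define e where "e A = Poly_Mapping.lookup (SOME a. a \<in> FA L r \<and> U_class L r a = A) 0" for A
  have e: "e (U_class L r a) = Poly_Mapping.lookup a 0" if "a \<in> FA L r" for a
    using U_ideal_lookup_0[OF U_class_someI[OF that]] by (simp add: e_def lookup_minus)
  have "is_augmentation L r S e"
    unfolding is_augmentation_def
  proof (intro conjI ballI allI)
    fix A B assume "A \<in> U_subalg L r S" "B \<in> U_subalg L r S"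
    then obtain a b where "A = U_class L r a" "a \<in> FA L r" "B = U_class L r b" "b \<in> FA L r"
      using U_subalg_carrier[OF assms] unfolding carrier_U by blast
    then show "e (A \<oplus>\<^bsub>U L r\<^esub> B) = e A + e B" "e (A \<otimes>\<^bsub>U L r\<^esub> B) = e A * e B"
      by (simp_all add: U_class_add U_class_mult e lookup_add lookup_mult_0)
  next
    fix c
    have "e (U_class L r (const c)) = Poly_Mapping.lookup (const c :: free_alg) 0" by (rule e) simp
    then show "e (U_scalar L r c) = c" by (simp add: U_scalar_def const_def lookup_single)
  next
    fix x assume "x \<in> S"
    then have "x \<in> lie L r" using assms by blast
    then show "e (U_gen L r x) = 0" unfolding U_gen_def by (subst e) (simp_all add: lookup_gen_0)
  qed
  then show ?thesis unfolding aug_def by (rule someI[of "is_augmentation L r S"])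
qed

lemma augmentation_uminus:
  assumes S: "S \<subseteq> lie L r" and e: "is_augmentation L r S e" and A: "A \<in> U_subalg L r S"
  shows "e (\<ominus>\<^bsub>U L r\<^esub> A) = - e A"
proof -
  interpret ring "U L r" by (rule ring_U)
  have mA: "\<ominus>\<^bsub>U L r\<^esub> A \<in> U_subalg L r S"
    using A unfolding U_subalg_def by (rule generate_ring.a_inv)
  have "A \<oplus>\<^bsub>U L r\<^esub> (\<ominus>\<^bsub>U L r\<^esub> A) = U_scalar L r 0"
    using U_subalg_carrier[OF S A] by (simp add: r_neg U_scalar_def U_class_zero)
  then have "e A + e (\<ominus>\<^bsub>U L r\<^esub> A) = 0"
    using e A mA unfolding is_augmentation_def by metis
  then show ?thesis by (simp add: eq_neg_iff_add_eq_0 add.commute)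
qed

text \<open>An augmentation is determined by its values on the generators.  A relation \<open>P a c\<close> between
  elements and scalars that is multiplicative and holds for the generators with the values of the
  augmentation therefore holds on the whole subalgebra.\<close>

lemma augmentation_induct:
  assumes S: "S \<subseteq> lie L r" and e: "is_augmentation L r S e" and A: "A \<in> U_subalg L r S"
    and const: "\<And>c. P (const c) c" and gen: "\<And>x. x \<in> S \<Longrightarrow> P (gen x) 0"
    and uminus: "\<And>a c. P a c \<Longrightarrow> P (- a) (- c)"
    and add: "\<And>a b c d. P a c \<Longrightarrow> P b d \<Longrightarrow> P (a + b) (c + d)"
    and mult: "\<And>a b c d. P a c \<Longrightarrow> P b d \<Longrightarrow> P (a * b) (c * d)"
  shows "\<exists>a\<in>FA L r. A = U_class L r a \<and> P a (e A)"
proof -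
  have ec: "e (U_scalar L r c) = c" for c using e by (simp add: is_augmentation_def)
  show ?thesis
    using A unfolding U_subalg_def
  proof (induction rule: generate_ring.induct)
    case one
    have "\<one>\<^bsub>U L r\<^esub> = U_scalar L r 1" by (simp add: U_class_one U_scalar_def)
    then show ?case using ec[of 1] const[of 1] by (intro bexI[of _ 1]) (auto simp: U_class_one)
  next
    case (incl h)
    then consider c where "h = U_scalar L r c" | x where "x \<in> S" "h = U_gen L r x" by auto
    then show ?case
    proof cases
      case (1 c)
      then show ?thesis using ec[of c] const[of c]
        by (intro bexI[of _ "const c"]) (auto simp: U_scalar_def)
    next
      case (2 x)
      then have "e h = 0" using e by (simp add: is_augmentation_def)
      then show ?thesis using 2 S gen[of x]
        by (intro bexI[of _ "gen x"]) (auto simp: U_gen_def)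
    qed
  next
    case (a_inv h)
    then obtain a where a: "a \<in> FA L r" "h = U_class L r a" "P a (e h)" by blast
    have "e (\<ominus>\<^bsub>U L r\<^esub> h) = - e h"
      using a_inv.hyps by (intro augmentation_uminus[OF S e]) (simp add: U_subalg_def)
    then show ?case
      using a uminus by (intro bexI[of _ "- a"]) (auto simp: U_class_uminus)
  next
    case (eng_add h1 h2)
    then obtain a1 a2 where a: "a1 \<in> FA L r" "h1 = U_class L r a1" "P a1 (e h1)"
      "a2 \<in> FA L r" "h2 = U_class L r a2" "P a2 (e h2)" by blast
    have "e (h1 \<oplus>\<^bsub>U L r\<^esub> h2) = e h1 + e h2"
      using e eng_add.hyps unfolding is_augmentation_def U_subalg_def by blast
    then show ?case
      using a add by (intro bexI[of _ "a1 + a2"]) (auto simp: U_class_add)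
  next
    case (eng_mult h1 h2)
    then obtain a1 a2 where a: "a1 \<in> FA L r" "h1 = U_class L r a1" "P a1 (e h1)"
      "a2 \<in> FA L r" "h2 = U_class L r a2" "P a2 (e h2)" by blast
    have "e (h1 \<otimes>\<^bsub>U L r\<^esub> h2) = e h1 * e h2"
      using e eng_mult.hyps unfolding is_augmentation_def U_subalg_def by blast
    then show ?case
      using a mult by (intro bexI[of _ "a1 * a2"]) (auto simp: U_class_mult)
  qed
qed

lemma augmentation_left:
  assumes S: "S \<subseteq> lie L r" and e: "is_augmentation L r S e"
    and kill: "\<And>x b. x \<in> S \<Longrightarrow> hc_fun L r (gen x * b) = 0"
    and A: "A \<in> U_subalg L r S"
  shows "\<exists>a\<in>FA L r. A = U_class L r a \<and> (\<forall>b. hc_fun L r (a * b) = const (e A) * hc_fun L r b)"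
  using S e A
  by (rule augmentation_induct)
     (simp_all add: hc_fun_const kill hc_fun_uminus const_minus distrib_right hc_fun_add const_add
        mult.assoc const_mult)

lemma augmentation_right:
  assumes S: "S \<subseteq> lie L r" and e: "is_augmentation L r S e"
    and kill: "\<And>x b. x \<in> S \<Longrightarrow> hc_fun L r (b * gen x) = 0"
    and A: "A \<in> U_subalg L r S"
  shows "\<exists>a\<in>FA L r. A = U_class L r a \<and> (\<forall>b. hc_fun L r (b * a) = const (e A) * hc_fun L r b)"
  using S e A
proof (rule augmentation_induct)
  show "\<forall>b. hc_fun L r (b * const c) = const c * hc_fun L r b" for c
  proof
    fix b show "hc_fun L r (b * const c) = const c * hc_fun L r b"
      using hc_fun_const[of L r c b] by (simp only: const_commute[of c b])
  qed
  show "\<forall>f. hc_fun L r (f * (a * b)) = const (c * d) * hc_fun L r f"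
    if "\<forall>f. hc_fun L r (f * a) = const c * hc_fun L r f" "\<forall>f. hc_fun L r (f * b) = const d * hc_fun L r f"
    for a b c d
    using that by (simp add: mult.assoc[symmetric] const_mult mult.commute[of "const d"])
qed (simp_all add: kill hc_fun_uminus const_minus distrib_left distrib_right hc_fun_add const_add)

section \<open>Polynomials in the Cartan generators\<close>

abbreviation hgen :: "lie_kind \<Rightarrow> nat \<Rightarrow> free_alg" where
  "hgen L i \<equiv> gen (Fmat L (int i) (int i))"

text \<open>The representative of a polynomial in the free algebra, where the factors of a monomial have to be
  put in an order.\<close>

definition cartan_poly :: "lie_kind \<Rightarrow> nat \<Rightarrow> hpoly \<Rightarrow> free_alg" where
  "cartan_poly L r = lext const (\<lambda>m. prod_list (map (\<lambda>i. hgen L i ^ Poly_Mapping.lookup m i) [1..<Suc r]))"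

lemma U0_to_U_eq: "U0_to_U L r p = U_class L r (cartan_poly L r p)"
  by (simp add: U0_to_U_def cartan_poly_def lext_def)

lemma Fmat_cartan_lie: "i \<in> {1..r} \<Longrightarrow> Fmat L (int i) (int i) \<in> lie L r"
  by (intro Fmat_lie hatV_pos) auto

lemma FA_cartan_prod: "set xs \<subseteq> {1..r} \<Longrightarrow> prod_list (map (\<lambda>i. hgen L i ^ f i) xs) \<in> FA L r"
  by (rule FA_prod_list) (auto intro!: FA_power FA_gen Fmat_cartan_lie)

lemma FA_cartan_poly: "cartan_poly L r p \<in> FA L r"
  unfolding cartan_poly_def lext_def by (intro FA_sum FA_mult FA_const FA_cartan_prod) auto

lemma hvar_power: "hvar i ^ n = Poly_Mapping.single (Poly_Mapping.single i n) 1"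
  by (induction n) (simp_all add: hvar_def mult_single flip: single_add)

lemma monom_eq_prod_hvar:
  assumes "Poly_Mapping.keys m \<subseteq> A" "finite A"
  shows "(Poly_Mapping.single m 1 :: hpoly) = (\<Prod>i\<in>A. hvar i ^ Poly_Mapping.lookup m i)"
proof -
  have "(\<Prod>i\<in>B. hvar i ^ f i) = Poly_Mapping.single (\<Sum>i\<in>B. Poly_Mapping.single i (f i)) 1" if "finite B" for B f
    using that by (induction B rule: finite_induct) (simp_all add: hvar_power mult_single)
  moreover have "(\<Sum>i\<in>A. Poly_Mapping.single i (Poly_Mapping.lookup m i)) = m"
    using assms by (intro poly_mapping_eqI) (auto simp: lookup_sum lookup_single when_def in_keys_iff)
  ultimately show ?thesis using assms(2) by simp
qed

lemma hc_fun_cartan_prod: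
  "set xs \<subseteq> {1..r} \<Longrightarrow> hc_fun L r (prod_list (map (\<lambda>i. hgen L i ^ f i) xs) * a)
     = prod_list (map (\<lambda>i. hvar i ^ f i) xs) * hc_fun L r a"
proof (induction xs)
  case (Cons i xs)
  have "hc_fun L r (hgen L i ^ n * b) = hvar i ^ n * hc_fun L r b" for n b
    using Cons.prems by (induction n) (simp_all add: mult.assoc hc_fun_cartan)
  then show ?case using Cons by (simp add: mult.assoc)
qed simp

lemma hc_fun_cartan_poly:
  assumes "p \<in> U0 r"
  shows "hc_fun L r (cartan_poly L r p * a) = p * hc_fun L r a"
proof -
  have "Poly_Mapping.keys p \<subseteq> {m. Poly_Mapping.keys m \<subseteq> {1..r}}" using assms by (auto simp: U0_def)
  then show ?thesis
  proof (induction p rule: poly_mapping_induct_keys)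
    case zero
    then show ?case by (simp add: cartan_poly_def)
  next
    case (single m c)
    have "prod_list (map (\<lambda>i. hvar i ^ Poly_Mapping.lookup m i) [1..<Suc r])
        = (\<Prod>i\<in>set [1..<Suc r]. hvar i ^ Poly_Mapping.lookup m i)"
      by (rule prod.distinct_set_conv_list[symmetric]) (rule distinct_upt)
    also have "\<dots> = Poly_Mapping.single m 1"
      using single unfolding set_upt atLeastLessThanSuc_atLeastAtMost
      by (intro monom_eq_prod_hvar[symmetric]) auto
    finally have "prod_list (map (\<lambda>i. hvar i ^ Poly_Mapping.lookup m i) [1..<Suc r]) = Poly_Mapping.single m 1" .
    moreover have "set [1..<Suc r] \<subseteq> {1..r}"
      by (simp only: set_upt atLeastLessThanSuc_atLeastAtMost order_refl)
    ultimately have P: "hc_fun L r (prod_list (map (\<lambda>i. hgen L i ^ Poly_Mapping.lookup m i) [1..<Suc r]) * a)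
        = Poly_Mapping.single m 1 * hc_fun L r a"
      by (simp only: hc_fun_cartan_prod)
    show ?case
      unfolding cartan_poly_def lext_single[where s = const, OF const_0] mult.assoc hc_fun_const P
      unfolding mult.assoc[symmetric] const_mult_single by simp
  next
    case (add p q)
    then show ?case
      by (simp add: cartan_poly_def lext_add const_add distrib_right hc_fun_add)
  qed
qed

lemma U0_const: "const c \<in> U0 r"
  by (simp add: U0_def const_def)
lemma U0_0: "0 \<in> U0 r"
  by (simp add: U0_def)
lemma U0_hvar: "i \<in> {1..r} \<Longrightarrow> hvar i \<in> U0 r"
  by (simp add: U0_def hvar_def)
lemma U0_add: "p \<in> U0 r \<Longrightarrow> q \<in> U0 r \<Longrightarrow> p + q \<in> U0 r"
  using subsetD[OF Poly_Mapping.keys_add[of p q]] by (auto simp: U0_def)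
lemma U0_mult:
  assumes "p \<in> U0 r" "q \<in> U0 r"
  shows "p * q \<in> U0 r"
  unfolding U0_def
proof (intro CollectI ballI)
  fix m assume "m \<in> Poly_Mapping.keys (p * q)"
  then obtain a b where m: "m = a + b" "a \<in> Poly_Mapping.keys p" "b \<in> Poly_Mapping.keys q"
    using subsetD[OF keys_mult[of p q]] by blast
  then show "Poly_Mapping.keys m \<subseteq> {1..r}"
    using assms subsetD[OF Poly_Mapping.keys_add[of a b]] unfolding U0_def by blast
qed

lemma U0_prod_list_hvar: "set ks \<subseteq> {1..r} \<Longrightarrow> prod_list (map hvar ks) \<in> U0 r"
proof (induction ks)
  case (Cons k ks)
  then have "hvar k \<in> U0 r" by (intro U0_hvar) auto
  then show ?case using Cons by (simp add: U0_mult)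
qed (use U0_const[of 1 r] in simp)

lemma gen_zero_U_ideal: "gen (\<lambda>i j. 0) \<in> U_ideal L r"
  using U_ideal_mscale[where c = 0, OF lie_zero[of L r]] by (simp add: mscale_def)

lemma hgen_commute:
  assumes "i \<in> {1..r}" "k \<in> {1..r}"
  shows "hgen L k * hgen L i ^ n - hgen L i ^ n * hgen L k \<in> U_ideal L r"
proof (induction n)
  case 0
  then show ?case by (simp add: U_ideal_0)
next
  case (Suc n)
  have "mbracket L r (Fmat L (int k) (int k)) (Fmat L (int i) (int i)) = (\<lambda>a b. 0)"
    using assms mbracket_cartan[of k "Fmat L (int i) (int i)" L r] lie_gl[OF Fmat_cartan_lie[of i r L]]
    by (intro ext) (auto simp: Fmat_diag[of i])
  then have c: "hgen L k * hgen L i - hgen L i * hgen L k \<in> U_ideal L r"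
    using U_ideal_add[OF U_ideal_mbracket[OF Fmat_cartan_lie[OF assms(2)] Fmat_cartan_lie[OF assms(1)], of L]
        gen_zero_U_ideal] by simp
  have "hgen L k * hgen L i ^ Suc n - hgen L i ^ Suc n * hgen L k
      = (hgen L k * hgen L i - hgen L i * hgen L k) * hgen L i ^ n
        + hgen L i * (hgen L k * hgen L i ^ n - hgen L i ^ n * hgen L k)"
    by (simp add: algebra_simps)
  then show ?case
    using assms by (simp only:)
      (intro U_ideal_add U_ideal_mult_right[OF c] U_ideal_mult_left[OF Suc] FA_power FA_gen Fmat_cartan_lie)
qed

lemma hgen_mult_cartan_prod:
  assumes "set xs \<subseteq> {1..r}" "distinct xs" "k \<in> set xs"
  shows "hgen L k * prod_list (map (\<lambda>i. hgen L i ^ f i) xs)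
     - prod_list (map (\<lambda>i. hgen L i ^ (f(k := Suc (f k))) i) xs) \<in> U_ideal L r"
  using assms
proof (induction xs)
  case (Cons i xs)
  let ?p = "\<lambda>f. prod_list (map (\<lambda>i. hgen L i ^ f i) xs)" and ?f = "f(k := Suc (f k))"
  show ?case
  proof (cases "i = k")
    case True
    then have "?p ?f = ?p f" using Cons.prems by (intro arg_cong[where f = prod_list] map_cong) auto
    then show ?thesis using True by (simp add: mult.assoc U_ideal_0 del: fun_upd_apply) (simp add: mult.assoc U_ideal_0)
  next
    case False
    then have IH: "hgen L k * ?p f - ?p ?f \<in> U_ideal L r" using Cons by auto
    have "hgen L k * (hgen L i ^ f i * ?p f) - hgen L i ^ f i * ?p ?f
        = (hgen L k * hgen L i ^ f i - hgen L i ^ f i * hgen L k) * ?p f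
          + hgen L i ^ f i * (hgen L k * ?p f - ?p ?f)"
      by (simp add: algebra_simps)
    also have "\<dots> \<in> U_ideal L r"
      using Cons.prems IH
      by (intro U_ideal_add U_ideal_mult_left U_ideal_mult_right hgen_commute FA_cartan_prod FA_power FA_gen Fmat_cartan_lie) auto
    finally show ?thesis using False by simp
  qed
qed simp

lemma cartan_poly_single: "cartan_poly L r (Poly_Mapping.single m c)
    = const c * prod_list (map (\<lambda>i. hgen L i ^ Poly_Mapping.lookup m i) [1..<Suc r])"
  unfolding cartan_poly_def by (rule lext_single) simp

lemma cartan_poly_prod_hvar:
  "set ks \<subseteq> {1..r} \<Longrightarrow> \<exists>m. prod_list (map hvar ks) = Poly_Mapping.single m 1 \<and>
     prod_list (map (hgen L) ks) - cartan_poly L r (Poly_Mapping.single m 1) \<in> U_ideal L r"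
proof (induction ks)
  case Nil
  have "prod_list (map (\<lambda>i. hgen L i ^ Poly_Mapping.lookup 0 i) xs) = 1" for xs
    by (induction xs) simp_all
  then have "cartan_poly L r (Poly_Mapping.single 0 1) = 1"
    by (simp only: cartan_poly_single const_1 mult_1)
  then have "prod_list (map (hgen L) []) - cartan_poly L r (Poly_Mapping.single 0 1) = 0"
    by (simp only: list.map prod_list.Nil diff_self)
  then show ?case using U_ideal_0 by (intro exI[of _ 0]) simp
next
  case (Cons k ks)
  then obtain m where m: "prod_list (map hvar ks) = Poly_Mapping.single m 1"
    "prod_list (map (hgen L) ks) - cartan_poly L r (Poly_Mapping.single m 1) \<in> U_ideal L r" by auto
  let ?m = "Poly_Mapping.single k 1 + m"
  have up: "Poly_Mapping.lookup ?m = (Poly_Mapping.lookup m)(k := Suc (Poly_Mapping.lookup m k))"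
    by (rule ext) (simp add: lookup_add lookup_single when_def)
  have "set [1..<Suc r] \<subseteq> {1..r}" "k \<in> set [1..<Suc r]"
    using Cons.prems unfolding set_upt atLeastLessThanSuc_atLeastAtMost by auto
  then have "hgen L k * cartan_poly L r (Poly_Mapping.single m 1) - cartan_poly L r (Poly_Mapping.single ?m 1) \<in> U_ideal L r"
    unfolding cartan_poly_single up const_1 mult_1 by (intro hgen_mult_cartan_prod distinct_upt)
  moreover have "hgen L k * (prod_list (map (hgen L) ks) - cartan_poly L r (Poly_Mapping.single m 1)) \<in> U_ideal L r"
    using m(2) Cons.prems by (intro U_ideal_mult_left FA_gen Fmat_cartan_lie) auto
  ultimately have "hgen L k * (prod_list (map (hgen L) ks) - cartan_poly L r (Poly_Mapping.single m 1))
     + (hgen L k * cartan_poly L r (Poly_Mapping.single m 1) - cartan_poly L r (Poly_Mapping.single ?m 1)) \<in> U_ideal L r"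
    by (intro U_ideal_add)
  moreover have "prod_list (map hvar (k # ks)) = Poly_Mapping.single ?m 1"
    unfolding list.map prod_list.Cons m(1) by (simp add: hvar_def mult_single)
  ultimately show ?case
    by (intro exI[of _ ?m]) (simp add: right_diff_distrib)
qed

section \<open>Triangular spanning set\<close>

text \<open>The preimage of \<open>U\<^sup>- U\<^sub>0 U\<^sup>+\<close> in the free algebra.\<close>

inductive_set tri :: "lie_kind \<Rightarrow> nat \<Rightarrow> free_alg set" for L r where
  word: "set v \<subseteq> n_minus L r \<Longrightarrow> set m \<subseteq> {1..r} \<Longrightarrow> set w \<subseteq> n_plus L r \<Longrightarrow>
     Poly_Mapping.single (Word (v @ map (\<lambda>k. Fmat L (int k) (int k)) m @ w)) c \<in> tri L r"
| add: "a \<in> tri L r \<Longrightarrow> b \<in> tri L r \<Longrightarrow> a + b \<in> tri L r"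
| cong: "a \<in> tri L r \<Longrightarrow> b \<in> FA L r \<Longrightarrow> a - b \<in> U_ideal L r \<Longrightarrow> b \<in> tri L r"

lemma tri_0: "0 \<in> tri L r"
  using tri.word[of "[]" L r "[]" "[]" 0] by simp

lemma tri_n_minus:
  assumes "x \<in> n_minus L r" "a \<in> tri L r"
  shows "gen x * a \<in> tri L r"
  using assms(2)
proof (induction rule: tri.induct)
  case (word v m w c)
  then show ?case using tri.word[of "x # v" L r m w c] assms(1) by (simp add: gen_mult_single)
next
  case (add a b)
  then show ?case by (simp add: distrib_left tri.add)
next
  case (cong a b)
  have "gen x * (a - b) \<in> U_ideal L r"
    using cong assms(1) by (intro U_ideal_mult_left FA_gen n_minus_lie) auto
  then show ?case
    using cong assms(1) by (intro tri.cong[OF cong.IH]) (auto simp: right_diff_distrib intro!: FA_mult FA_gen n_minus_lie)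
qed

lemma tri_n_plus:
  assumes "x \<in> n_plus L r" "a \<in> tri L r"
  shows "a * gen x \<in> tri L r"
  using assms(2)
proof (induction rule: tri.induct)
  case (word v m w c)
  then show ?case using tri.word[of v L r m "w @ [x]" c] assms(1) by (simp add: single_mult_gen)
next
  case (add a b)
  then show ?case by (simp add: distrib_right tri.add)
next
  case (cong a b)
  have "(a - b) * gen x \<in> U_ideal L r"
    using cong assms(1) by (intro U_ideal_mult_right FA_gen n_plus_lie) auto
  then show ?case
    using cong assms(1) by (intro tri.cong[OF cong.IH]) (auto simp: left_diff_distrib intro!: FA_mult FA_gen n_plus_lie)
qed

lemma single_Word_split:
  "Poly_Mapping.single (Word (v @ x # w)) c = Poly_Mapping.single (Word v) c * gen x * Poly_Mapping.single (Word w) (1::complex)"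
  by (simp add: single_mult_gen mult_single plus_word_def)

lemma single_Word_split2:
  "Poly_Mapping.single (Word (v @ x # y # w)) c =
     Poly_Mapping.single (Word v) c * (gen x * gen y) * Poly_Mapping.single (Word w) (1::complex)"
  by (simp add: single_mult_gen mult.assoc[symmetric] mult_single plus_word_def)

lemma tri_swap:
  assumes "set v \<subseteq> lie L r" "set w \<subseteq> lie L r" "x \<in> lie L r" "z \<in> lie L r"
    and "Poly_Mapping.single (Word (v @ x # z # w)) c \<in> tri L r"
    and "Poly_Mapping.single (Word (v @ mbracket L r z x # w)) c \<in> tri L r"
  shows "Poly_Mapping.single (Word (v @ z # x # w)) c \<in> tri L r"
proof (rule tri.cong[OF tri.add[OF assms(5,6)]])
  show "Poly_Mapping.single (Word (v @ z # x # w)) c \<in> FA L r"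
    using assms by (intro FA_single) auto
  have "- (Poly_Mapping.single (Word v) c * (gen z * gen x - gen x * gen z - gen (mbracket L r z x))
      * Poly_Mapping.single (Word w) 1) \<in> U_ideal L r"
    using assms(1-4)
    by (intro U_ideal_uminus U_ideal_mult_left U_ideal_mult_right U_ideal_mbracket FA_single) auto
  then show "Poly_Mapping.single (Word (v @ x # z # w)) c + Poly_Mapping.single (Word (v @ mbracket L r z x # w)) c
     - Poly_Mapping.single (Word (v @ z # x # w)) c \<in> U_ideal L r"
    unfolding single_Word_split2 unfolding single_Word_split by (simp add: algebra_simps)
qed

lemma tri_mspan:
  assumes "x \<in> mspan S" "S \<subseteq> lie L r" "set v \<subseteq> lie L r" "set w \<subseteq> lie L r"
    and S: "\<And>s c. s \<in> S \<Longrightarrow> Poly_Mapping.single (Word (v @ s # w)) c \<in> tri L r"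
  shows "Poly_Mapping.single (Word (v @ x # w)) c \<in> tri L r"
proof -
  have I: "Poly_Mapping.single (Word v) c * s * Poly_Mapping.single (Word w) 1 \<in> U_ideal L r"
    if "s \<in> U_ideal L r" for s c
    using that assms(3,4) by (intro U_ideal_mult_left U_ideal_mult_right FA_single) auto
  have F: "Poly_Mapping.single (Word (v @ x # w)) c \<in> FA L r" if "x \<in> lie L r" for x c
    using that assms(3,4) by (intro FA_single) auto
  have "x \<in> lie L r \<and> (\<forall>c. Poly_Mapping.single (Word (v @ x # w)) c \<in> tri L r)"
    using assms(1)
  proof (rule mspan_induct)
    fix s assume "s \<in> S"
    then show "s \<in> lie L r \<and> (\<forall>c. Poly_Mapping.single (Word (v @ s # w)) c \<in> tri L r)"
      using assms(2) S by auto
  next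
    have "Poly_Mapping.single (Word (v @ (\<lambda>i j. 0) # w)) c \<in> tri L r" for c
    proof (rule tri.cong[OF tri_0 F[OF lie_zero]])
      show "0 - Poly_Mapping.single (Word (v @ (\<lambda>i j. 0) # w)) c \<in> U_ideal L r"
        unfolding diff_0 single_Word_split by (intro U_ideal_uminus I gen_zero_U_ideal)
    qed
    then show "(\<lambda>i j. 0) \<in> lie L r \<and> (\<forall>c. Poly_Mapping.single (Word (v @ (\<lambda>i j. 0) # w)) c \<in> tri L r)"
      by (simp add: lie_zero)
  next
    fix x y
    assume x: "x \<in> lie L r \<and> (\<forall>c. Poly_Mapping.single (Word (v @ x # w)) c \<in> tri L r)"
      and y: "y \<in> lie L r \<and> (\<forall>c. Poly_Mapping.single (Word (v @ y # w)) c \<in> tri L r)"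
    have "Poly_Mapping.single (Word (v @ madd x y # w)) c \<in> tri L r" for c
    proof (rule tri.cong[OF tri.add F[OF lie_madd]])
      show "Poly_Mapping.single (Word (v @ x # w)) c \<in> tri L r" "Poly_Mapping.single (Word (v @ y # w)) c \<in> tri L r"
        "x \<in> lie L r" "y \<in> lie L r" using x y by auto
      then have "- (Poly_Mapping.single (Word v) c * (gen (madd x y) - gen x - gen y) * Poly_Mapping.single (Word w) 1) \<in> U_ideal L r"
        by (intro U_ideal_uminus I U_ideal_madd)
      then show "Poly_Mapping.single (Word (v @ x # w)) c + Poly_Mapping.single (Word (v @ y # w)) c
         - Poly_Mapping.single (Word (v @ madd x y # w)) c \<in> U_ideal L r"
        unfolding single_Word_split by (simp add: algebra_simps)
    qed
    then show "madd x y \<in> lie L r \<and> (\<forall>c. Poly_Mapping.single (Word (v @ madd x y # w)) c \<in> tri L r)"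
      using x y by (simp add: lie_madd)
  next
    fix d x
    assume x: "x \<in> lie L r \<and> (\<forall>c. Poly_Mapping.single (Word (v @ x # w)) c \<in> tri L r)"
    have "Poly_Mapping.single (Word (v @ mscale d x # w)) c \<in> tri L r" for c
    proof (rule tri.cong[OF _ F[OF lie_mscale]])
      show xx: "Poly_Mapping.single (Word (v @ x # w)) (c * d) \<in> tri L r" "x \<in> lie L r" using x by auto
      then have "- (Poly_Mapping.single (Word v) c * (gen (mscale d x) - const d * gen x) * Poly_Mapping.single (Word w) 1) \<in> U_ideal L r"
        by (intro U_ideal_uminus I U_ideal_mscale)
      moreover have "Poly_Mapping.single (Word v) (c * d) = Poly_Mapping.single (Word v) c * const d"
        by (simp add: single_mult_const)
      ultimately show "Poly_Mapping.single (Word (v @ x # w)) (c * d)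
         - Poly_Mapping.single (Word (v @ mscale d x # w)) c \<in> U_ideal L r"
        unfolding single_Word_split by (simp add: right_diff_distrib left_diff_distrib mult.assoc)
    qed
    then show "mscale d x \<in> lie L r \<and> (\<forall>c. Poly_Mapping.single (Word (v @ mscale d x # w)) c \<in> tri L r)"
      using x by (simp add: lie_mscale)
  qed
  then show ?thesis by blast
qed

text \<open>Modulo shorter words, neighbouring letters commute.  By induction on the length, a letter from
  \<open>n\<^sup>-\<close> can be moved to the front, a letter from \<open>n\<^sup>+\<close> to the end, and what is left are words in the
  Cartan generators.\<close>

lemma tri_word: "set w \<subseteq> lie L r \<Longrightarrow> Poly_Mapping.single (Word w) c \<in> tri L r"
proof (induction "length w" arbitrary: w c rule: less_induct)
  case less
  let ?G = "n_minus L r \<union> cartan L r \<union> n_plus L r"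
  have G: "?G \<subseteq> lie L r" by (auto intro: n_minus_lie cartan_lie n_plus_lie)
  have minus: "Poly_Mapping.single (Word (v @ x # u)) c \<in> tri L r"
    if "x \<in> n_minus L r" "set v \<subseteq> lie L r" "set u \<subseteq> lie L r" "Suc (length v + length u) = length w" for v x u c
    using that
  proof (induction v arbitrary: u rule: rev_induct)
    case Nil
    then show ?case
      using tri_n_minus[OF Nil(1) less.hyps[of u c]] by (simp add: gen_mult_single)
  next
    case (snoc z v)
    have "Poly_Mapping.single (Word (v @ x # z # u)) c \<in> tri L r"
      using snoc by (intro snoc.IH) auto
    moreover have "Poly_Mapping.single (Word (v @ mbracket L r z x # u)) c \<in> tri L r"
      using snoc.prems by (intro less.hyps) (auto intro: lie_mbracket n_minus_lie)
    ultimately show ?case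
      using snoc.prems tri_swap[of v L r u x z c] n_minus_lie by auto
  qed
  have plus: "Poly_Mapping.single (Word (v @ x # u)) c \<in> tri L r"
    if "x \<in> n_plus L r" "set v \<subseteq> lie L r" "set u \<subseteq> lie L r" "Suc (length v + length u) = length w" for v x u c
    using that
  proof (induction u arbitrary: v)
    case Nil
    then show ?case
      using tri_n_plus[OF Nil(1) less.hyps[of v c]] by (simp add: single_mult_gen)
  next
    case (Cons z u)
    have "Poly_Mapping.single (Word ((v @ [z]) @ x # u)) c \<in> tri L r"
      using Cons.prems by (intro Cons.IH) auto
    moreover have "Poly_Mapping.single (Word (v @ mbracket L r x z # u)) c \<in> tri L r"
      using Cons.prems by (intro less.hyps) (auto intro: lie_mbracket n_plus_lie)
    ultimately show ?case
      using Cons.prems tri_swap[of v L r u z x c] n_plus_lie by auto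
  qed
  have base: "Poly_Mapping.single (Word v) c \<in> tri L r" if v: "set v \<subseteq> ?G" "length v = length w" for v c
  proof (cases "set v \<subseteq> cartan L r")
    case True
    then have "\<exists>m. set m \<subseteq> {1..r} \<and> v = map (\<lambda>k. Fmat L (int k) (int k)) m"
    proof (induction v)
      case (Cons x v)
      then obtain m k where "set m \<subseteq> {1..r}" "v = map (\<lambda>k. Fmat L (int k) (int k)) m" "k \<in> {1..r}" "x = Fmat L (int k) (int k)"
        by (auto simp: cartan_def)
      then show ?case by (intro exI[of _ "k # m"]) auto
    qed simp
    then show ?thesis using tri.word[of "[]" L r _ "[]" c] by auto
  next
    case False
    then obtain x where x: "x \<in> set v" "x \<in> n_minus L r \<or> x \<in> n_plus L r" using v(1) by blast
    then obtain v1 v2 where v12: "v = v1 @ x # v2" by (meson split_list)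
    then have "set v1 \<subseteq> lie L r" "set v2 \<subseteq> lie L r" "Suc (length v1 + length v2) = length w"
      using v G by auto
    then show ?thesis using x(2) minus plus v12 by blast
  qed
  have "Poly_Mapping.single (Word (v @ u)) c \<in> tri L r"
    if "set v \<subseteq> ?G" "set u \<subseteq> lie L r" "length v + length u = length w" for v u c
    using that
  proof (induction u arbitrary: v c)
    case Nil
    then show ?case using base by simp
  next
    case (Cons x u)
    show ?case
    proof (rule tri_mspan[OF lie_triangular G])
      show "x \<in> lie L r" "set v \<subseteq> lie L r" "set u \<subseteq> lie L r" using Cons.prems G by auto
      fix s c assume "s \<in> ?G"
      then show "Poly_Mapping.single (Word (v @ s # u)) c \<in> tri L r"
        using Cons.IH[of "v @ [s]" c] Cons.prems by simp
    qed
  qed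
  from this[of "[]" w] show ?case using less.prems by simp
qed

lemma tri_FA: "a \<in> FA L r \<Longrightarrow> a \<in> tri L r"
proof -
  assume "a \<in> FA L r"
  then have "Poly_Mapping.keys a \<subseteq> {w. set (letters w) \<subseteq> lie L r}" by (rule FA_keys)
  then show ?thesis
  proof (induction a rule: poly_mapping_induct_keys)
    case (single k c)
    then show ?case using tri_word[of "letters k" L r c] by simp
  qed (auto intro: tri_0 tri.add)
qed

section \<open>Existence and uniqueness of the Harish-Chandra projection\<close>

lemma prod_list_gen: "prod_list (map gen xs) = Poly_Mapping.single (Word xs) 1"
proof (induction xs)
  case Nil
  then show ?case by (simp add: Word_Nil)
qed (simp add: gen_mult_single)

lemma hc_fun_U0:
  assumes "a \<in> FA L r"
  shows "hc_fun L r a \<in> U0 r"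
  using tri_FA[OF assms]
proof (induction rule: tri.induct)
  case (word v m w c)
  have s: "Poly_Mapping.single (Word (v @ map (\<lambda>k. Fmat L (int k) (int k)) m @ w)) c
      = const c * (prod_list (map gen v) * (prod_list (map (hgen L) m) * prod_list (map gen w)))"
  proof -
    have "prod_list (map gen (v @ map (\<lambda>k. Fmat L (int k) (int k)) m @ w))
        = prod_list (map gen v) * (prod_list (map (hgen L) m) * prod_list (map gen w))"
      by (simp only: map_append prod_list.append map_map comp_def)
    from this[symmetric] show ?thesis
      unfolding \<open>prod_list (map gen v) * _ = _\<close> unfolding prod_list_gen const_mult_single by simp
  qed
  have m: "hc_fun L r (prod_list (map (hgen L) m) * a) = prod_list (map hvar m) * hc_fun L r a" for a
    using word(2) hc_fun_cartan_prod[of m r L "\<lambda>_. 1" a] by simp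
  have w: "hc_fun L r (prod_list (map gen w)) \<in> U0 r"
  proof (cases w rule: rev_cases)
    case Nil
    then show ?thesis using U0_const[of 1 r] by (simp add: hc_fun_1)
  next
    case (snoc w' x)
    then show ?thesis using word(3) by (simp add: hc_fun_n_plus U0_0)
  qed
  show ?case
  proof (cases v)
    case Nil
    then show ?thesis
      unfolding s by (simp add: hc_fun_const m) (intro U0_mult U0_const w U0_prod_list_hvar word(2))
  next
    case (Cons x v')
    then show ?thesis
      using word(1) unfolding s by (simp add: hc_fun_const mult.assoc hc_fun_n_minus U0_0)
  qed
next
  case (add a b)
  then show ?case by (simp add: hc_fun_add U0_add)
next
  case (cong a b)
  then show ?case using hc_fun_cong[OF cong.hyps(3)] by simp
qed

lemma n_minus_sub: "n_minus L r \<subseteq> lie L r" and n_plus_sub: "n_plus L r \<subseteq> lie L r"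
  using n_minus_lie n_plus_lie by blast+

text \<open>The existence of the projection, which is usually read off from the
  Poincare-Birkhoff-Witt theorem: the functional kills \<open>n\<^sup>- U\<close> and \<open>U n\<^sup>+\<close> and turns \<open>F\<^sub>k\<^sub>k\<close> on the left into \<open>h\<^sub>k\<close>.\<close>

lemma is_pi0_hc_map: "is_pi0 L r (hc_map L r)"
  unfolding is_pi0_def
proof (intro conjI ballI allI)
  show "hc_map L r ` carrier (U L r) \<subseteq> U0 r"
    unfolding carrier_U by (auto simp: hc_map_class hc_fun_U0)
  fix A B assume "A \<in> carrier (U L r)" "B \<in> carrier (U L r)"
  then show "hc_map L r (A \<oplus>\<^bsub>U L r\<^esub> B) = hc_map L r A + hc_map L r B"
    unfolding carrier_U by (auto simp: U_class_add hc_map_class hc_fun_add)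
next
  fix c A assume "A \<in> carrier (U L r)"
  then show "hc_map L r (U_scalar L r c \<otimes>\<^bsub>U L r\<^esub> A) = const c * hc_map L r A"
    unfolding carrier_U U_scalar_def by (auto simp: U_class_mult hc_map_class hc_fun_const)
next
  fix A p B assume A: "A \<in> U_subalg L r (n_minus L r)" and p: "p \<in> U0 r" and B: "B \<in> U_subalg L r (n_plus L r)"
  obtain a where a: "a \<in> FA L r" "A = U_class L r a"
    "\<And>b. hc_fun L r (a * b) = const (aug L r (n_minus L r) A) * hc_fun L r b"
    using augmentation_left[OF n_minus_sub is_augmentation_aug[OF n_minus_sub] hc_fun_n_minus A] by blast
  obtain b where b: "b \<in> FA L r" "B = U_class L r b"
    "\<And>a. hc_fun L r (a * b) = const (aug L r (n_plus L r) B) * hc_fun L r a"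
    using augmentation_right[OF n_plus_sub is_augmentation_aug[OF n_plus_sub] hc_fun_n_plus B] by blast
  have "hc_map L r (A \<otimes>\<^bsub>U L r\<^esub> U0_to_U L r p \<otimes>\<^bsub>U L r\<^esub> B) = hc_fun L r (a * cartan_poly L r p * b)"
    unfolding a(2) b(2) U0_to_U_eq by (simp add: U_class_mult hc_map_class a(1) b(1) FA_cartan_poly)
  also have "\<dots> = const (aug L r (n_plus L r) B) * (const (aug L r (n_minus L r) A) * hc_fun L r (cartan_poly L r p * 1))"
    by (simp add: b(3) a(3))
  also have "hc_fun L r (cartan_poly L r p * 1) = p"
    unfolding hc_fun_cartan_poly[OF p] by (simp add: hc_fun_1)
  finally show "hc_map L r (A \<otimes>\<^bsub>U L r\<^esub> U0_to_U L r p \<otimes>\<^bsub>U L r\<^esub> B) =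
      const (aug L r (n_minus L r) A) * p * const (aug L r (n_plus L r) B)"
    by (simp add: mult_ac)
qed

lemma U_subalg_word:
  assumes "S \<subseteq> lie L r" "set v \<subseteq> S"
  shows "U_class L r (Poly_Mapping.single (Word v) c) \<in> U_subalg L r S"
  using assms(2)
proof (induction v)
  case Nil
  have "U_scalar L r c \<in> U_subalg L r S" unfolding U_subalg_def by (intro generate_ring.incl) simp
  then show ?case by (simp add: U_scalar_def const_def Word_Nil)
next
  case (Cons x v)
  have "U_gen L r x \<in> U_subalg L r S"
    using Cons.prems unfolding U_subalg_def by (intro generate_ring.incl) simp
  then have "U_gen L r x \<otimes>\<^bsub>U L r\<^esub> U_class L r (Poly_Mapping.single (Word v) c) \<in> U_subalg L r S"
    using Cons unfolding U_subalg_def by (intro generate_ring.eng_mult) auto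
  also have "U_gen L r x \<otimes>\<^bsub>U L r\<^esub> U_class L r (Poly_Mapping.single (Word v) c)
      = U_class L r (Poly_Mapping.single (Word (x # v)) c)"
    using Cons.prems assms(1) unfolding U_gen_def
    by (subst U_class_mult) (auto simp: gen_mult_single intro!: FA_gen FA_single)
  finally show ?case .
qed

lemma is_pi0_triangular:
  assumes "is_pi0 L r f" "a \<in> U_subalg L r (n_minus L r)" "p \<in> U0 r" "b \<in> U_subalg L r (n_plus L r)"
  shows "f (a \<otimes>\<^bsub>U L r\<^esub> U0_to_U L r p \<otimes>\<^bsub>U L r\<^esub> b)
    = const (aug L r (n_minus L r) a) * p * const (aug L r (n_plus L r) b)"
  using assms unfolding is_pi0_def by blast

lemma is_pi0_add:
  assumes "is_pi0 L r f" "a \<in> FA L r" "b \<in> FA L r"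
  shows "f (U_class L r (a + b)) = f (U_class L r a) + f (U_class L r b)"
proof -
  have "f (U_class L r a \<oplus>\<^bsub>U L r\<^esub> U_class L r b) = f (U_class L r a) + f (U_class L r b)"
    using assms(1) U_class_carrier[OF assms(2)] U_class_carrier[OF assms(3)] unfolding is_pi0_def by blast
  then show ?thesis by (simp add: U_class_add assms(2,3))
qed

text \<open>Both maps have prescribed values on \<open>U\<^sup>- U\<^sub>0 U\<^sup>+\<close>, which is everything.\<close>

lemma is_pi0_unique:
  assumes f: "is_pi0 L r f" and g: "is_pi0 L r g" and a: "a \<in> FA L r"
  shows "f (U_class L r a) = g (U_class L r a)"
proof -
  have "a \<in> FA L r \<and> f (U_class L r a) = g (U_class L r a)"
    using tri_FA[OF a]
  proof (induction rule: tri.induct)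
    case (word v m w c)
    let ?m = "map (\<lambda>k. Fmat L (int k) (int k)) m"
    have ml: "set ?m \<subseteq> lie L r" using word(2) Fmat_cartan_lie by auto
    have vl: "set v \<subseteq> lie L r" and wl: "set w \<subseteq> lie L r" using word n_minus_sub n_plus_sub by blast+
    obtain mm where mm: "prod_list (map hvar m) = Poly_Mapping.single mm 1"
      "prod_list (map (hgen L) m) - cartan_poly L r (Poly_Mapping.single mm 1) \<in> U_ideal L r"
      using cartan_poly_prod_hvar[OF word(2)] by blast
    have U0: "Poly_Mapping.single mm 1 \<in> U0 r" using U0_prod_list_hvar[OF word(2)] mm(1) by simp
    have "U_class L r (Poly_Mapping.single (Word ?m) 1) = U0_to_U L r (Poly_Mapping.single mm 1)"
      unfolding U0_to_U_eq U_class_eq_iff using mm(2) prod_list_gen[of ?m] by (simp add: comp_def)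
    moreover have "U_class L r (Poly_Mapping.single (Word (v @ ?m @ w)) c)
        = U_class L r (Poly_Mapping.single (Word v) c) \<otimes>\<^bsub>U L r\<^esub> U_class L r (Poly_Mapping.single (Word ?m) 1)
           \<otimes>\<^bsub>U L r\<^esub> U_class L r (Poly_Mapping.single (Word w) 1)"
      using vl wl ml by (simp add: U_class_mult FA_single mult_single Word_plus)
    moreover have "Poly_Mapping.single (Word (v @ ?m @ w)) c \<in> FA L r"
      using vl wl ml by (intro FA_single) auto
    moreover note W = U_subalg_word[OF n_minus_sub word(1), of c] U0 U_subalg_word[OF n_plus_sub word(3), of 1]
    ultimately show ?case
      by (simp only: is_pi0_triangular[OF f W] is_pi0_triangular[OF g W])
  next
    case (add a b)
    then show ?case by (simp add: is_pi0_add[OF f] is_pi0_add[OF g])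
  next
    case (cong a b)
    then have "U_class L r a = U_class L r b" by (simp add: U_class_eq_iff)
    then show ?case using cong by simp
  qed
  then show ?thesis by blast
qed

lemma pi0_class: "a \<in> FA L r \<Longrightarrow> pi0 L r (U_class L r a) = hc_fun L r a"
proof -
  assume a: "a \<in> FA L r"
  have "is_pi0 L r (pi0 L r)" unfolding pi0_def using is_pi0_hc_map by (rule someI[of "is_pi0 L r"])
  from is_pi0_unique[OF this is_pi0_hc_map a] show ?thesis by (simp add: hc_map_class a)
qed

section \<open>Matrices over the free algebra\<close>

definition FA2 :: "lie_kind \<Rightarrow> nat \<Rightarrow> free_alg2 set" where
  "FA2 L r = {t. \<forall>(v, w)\<in>Poly_Mapping.keys t. set (letters v) \<subseteq> lie L r \<and> set (letters w) \<subseteq> lie L r}"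

lemma free2_on_eq: "free2_on L r = type_ring (FA2 L r)"
  by (simp add: free2_on_def type_ring_def FA2_def)

lemma FA2_subring: "is_subring (FA2 L r)"
  unfolding is_subring_def
proof (intro conjI ballI)
  fix a b assume ab: "a \<in> FA2 L r" "b \<in> FA2 L r"
  show "- a \<in> FA2 L r" using ab(1) by (simp add: FA2_def in_keys_iff)
  show "a + b \<in> FA2 L r" using ab subsetD[OF Poly_Mapping.keys_add[of a b]] by (fastforce simp: FA2_def)
  show "a * b \<in> FA2 L r"
    unfolding FA2_def
  proof (intro CollectI ballI)
    fix p assume "p \<in> Poly_Mapping.keys (a * b)"
    then obtain u v where uv: "p = u + v" "u \<in> Poly_Mapping.keys a" "v \<in> Poly_Mapping.keys b"
      using subsetD[OF keys_mult[of a b]] by blast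
    obtain u1 u2 v1 v2 where u: "u = (u1, u2)" "v = (v1, v2)" by fastforce
    then show "case p of (v, w) \<Rightarrow> set (letters v) \<subseteq> lie L r \<and> set (letters w) \<subseteq> lie L r"
      using ab uv unfolding FA2_def by (auto simp: letters_plus)
  qed
qed (auto simp: FA2_def letters_0 zero_prod_def)

lemma FA2_single: "set (letters v) \<subseteq> lie L r \<Longrightarrow> set (letters w) \<subseteq> lie L r \<Longrightarrow> Poly_Mapping.single (v, w) c \<in> FA2 L r"
  by (auto simp: FA2_def split: if_splits)

lemma FA2_sum: "(\<And>x. x \<in> A \<Longrightarrow> f x \<in> FA2 L r) \<Longrightarrow> sum f A \<in> FA2 L r"
  using FA2_subring[of L r] by (induction A rule: infinite_finite_induct) (auto simp: is_subring_def)

lemma FA2_power: "a \<in> FA2 L r \<Longrightarrow> a ^ n \<in> FA2 L r"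
  using FA2_subring[of L r] by (induction n) (auto simp: is_subring_def)

lemma FA2_const: "const c \<in> FA2 L r"
  unfolding const_def zero_prod_def by (rule FA2_single) (simp_all add: letters_0)

text \<open>The map \<open>id \<otimes> \<rho>\<^sub>V\<close> into matrices over the free algebra, where \<open>\<rho>\<^sub>V\<close> is the action on \<open>V\<close>.\<close>

definition tmat :: "lie_kind \<Rightarrow> nat \<Rightarrow> free_alg2 \<Rightarrow> int \<Rightarrow> int \<Rightarrow> free_alg" where
  "tmat L r t i j = lext const (\<lambda>(v, w). Poly_Mapping.single v (word_on_V L r w i j)) t"

lemma tmat_0: "tmat L r 0 i j = 0"
  by (simp add: tmat_def)

lemma tmat_add: "tmat L r (s + t) i j = tmat L r s i j + tmat L r t i j"
  unfolding tmat_def by (rule lext_add) (simp_all add: const_add)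

lemma tmat_sum: "tmat L r (sum f A) i j = (\<Sum>a\<in>A. tmat L r (f a) i j)"
  by (induction A rule: infinite_finite_induct) (simp_all add: tmat_0 tmat_add)

lemma tmat_single: "tmat L r (Poly_Mapping.single (v, w) c) i j = Poly_Mapping.single v (c * word_on_V L r w i j)"
  by (simp add: tmat_def lext_single const_mult_single)

lemma word_on_V_0: "word_on_V L r 0 = mone L r"
  by (simp add: word_on_V_def letters_0)

lemma word_on_V_plus:
  "i \<in> hatV L r \<Longrightarrow> word_on_V L r (v + w) i j = (\<Sum>k\<in>hatV L r. word_on_V L r v i k * word_on_V L r w k j)"
  unfolding word_on_V_def letters_plus foldr_append by (rule foldr_mmul)

lemma tmat_const: "i \<in> hatV L r \<Longrightarrow> tmat L r (const c) i j = const (if i = j then c else 0)"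
  by (simp add: const_def zero_prod_def tmat_single word_on_V_0 mone_def)

lemma tmat_tens_gen: "j \<in> hatV L r \<Longrightarrow> tmat L r (tens (gen x) (gen y)) i j = const (y i j) * gen x"
proof -
  assume "j \<in> hatV L r"
  then have "word_on_V L r (Word [y]) i j = y i j" by (simp add: word_on_V_def mmul_mone_right)
  moreover have "tens (gen x) (gen y) = Poly_Mapping.single (Word [x], Word [y]) 1"
    by (simp add: tens_def gen_def)
  ultimately show ?thesis by (simp add: tmat_single gen_def const_mult_single)
qed

lemma single_sum: "Poly_Mapping.single k (sum f A) = (\<Sum>a\<in>A. Poly_Mapping.single k (f a))"
  by (induction A rule: infinite_finite_induct) (simp_all add: single_add)

lemma tmat_mult:
  assumes i: "i \<in> hatV L r"
  shows "tmat L r (s * t) i j = (\<Sum>k\<in>hatV L r. tmat L r s i k * tmat L r t k j)"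
proof (induction s rule: poly_mapping_induct)
  case (single p c)
  obtain v w where p: "p = (v, w)" by fastforce
  show ?case
  proof (induction t rule: poly_mapping_induct)
    case (single q d)
    obtain v' w' where q: "q = (v', w')" by fastforce
    have "tmat L r (Poly_Mapping.single p c * Poly_Mapping.single q d) i j
        = Poly_Mapping.single (v + v') (\<Sum>k\<in>hatV L r. (c * word_on_V L r w i k) * (d * word_on_V L r w' k j))"
      by (simp add: p q mult_single tmat_single word_on_V_plus[OF i] sum_distrib_left mult_ac)
    then show ?case by (simp add: p q tmat_single mult_single single_sum)
  qed (simp_all add: tmat_0 tmat_add distrib_left sum.distrib)
qed (simp_all add: tmat_0 tmat_add distrib_right sum.distrib)

lemma tmat_FA: "t \<in> FA2 L r \<Longrightarrow> tmat L r t i j \<in> FA L r"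
  unfolding tmat_def lext_def FA2_def
  by (rule FA_sum) (auto intro!: FA_mult FA_const FA_single)

section \<open>The defining representation and the partial trace\<close>

definition rep_V :: "lie_kind \<Rightarrow> nat \<Rightarrow> free_alg \<Rightarrow> int \<Rightarrow> int \<Rightarrow> complex" where
  "rep_V L r a i j = lext (\<lambda>c. c) (\<lambda>w. word_on_V L r w i j) a"

lemma rep_V_0: "rep_V L r 0 i j = 0"
  by (simp add: rep_V_def)

lemma rep_V_add: "rep_V L r (a + b) i j = rep_V L r a i j + rep_V L r b i j"
  unfolding rep_V_def by (rule lext_add) simp_all

lemma rep_V_diff: "rep_V L r (a - b) i j = rep_V L r a i j - rep_V L r b i j"
  using rep_V_add[of L r "a - b" b i j] by simp

lemma rep_V_single: "rep_V L r (Poly_Mapping.single w c) i j = c * word_on_V L r w i j"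
  by (simp add: rep_V_def lext_single)

lemma rep_V_mult:
  assumes i: "i \<in> hatV L r"
  shows "rep_V L r (a * b) i j = (\<Sum>k\<in>hatV L r. rep_V L r a i k * rep_V L r b k j)"
proof (induction a rule: poly_mapping_induct)
  case (single v c)
  show ?case
    by (induction b rule: poly_mapping_induct)
       (simp_all add: mult_single rep_V_single rep_V_0 rep_V_add word_on_V_plus[OF i] sum_distrib_left mult_ac
          distrib_left sum.distrib)
qed (simp_all add: rep_V_0 rep_V_add distrib_right sum.distrib)

lemma rep_V_gen: "j \<in> hatV L r \<Longrightarrow> rep_V L r (gen x) i j = x i j"
  by (simp add: gen_def rep_V_single word_on_V_def mmul_mone_right)

lemma rep_V_const: "rep_V L r (const c) i j = c * mone L r i j"
  by (simp add: const_def rep_V_single word_on_V_0)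

lemma rep_V_U_ideal:
  assumes "a \<in> U_ideal L r" "i \<in> hatV L r" "j \<in> hatV L r"
  shows "rep_V L r a i j = 0"
proof -
  have "\<forall>i\<in>hatV L r. \<forall>j\<in>hatV L r. rep_V L r a i j = 0"
    using assms(1)
  proof (rule U_ideal_induct)
    fix u s v :: free_alg
    assume s: "s \<in> U_rels L r"
    have "rep_V L r s i j = 0" if ij: "i \<in> hatV L r" "j \<in> hatV L r" for i j
    proof -
      from s consider x y where "s = gen (madd x y) - gen x - gen y"
        | e x where "s = gen (mscale e x) - const e * gen x"
        | x y where "s = gen x * gen y - gen y * gen x - gen (mbracket L r x y)"
        unfolding U_rels_def by blast
      then show ?thesis
      proof cases
        case (1 x y)
        then show ?thesis using ij by (simp add: rep_V_diff rep_V_gen madd_def)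
      next
        case (2 e x)
        have "(\<Sum>k\<in>hatV L r. e * mone L r i k * x k j) = e * mmul L r (mone L r) x i j"
          by (simp add: mmul_def sum_distrib_left mult.assoc)
        then show ?thesis using 2 ij
          by (simp add: rep_V_diff rep_V_gen rep_V_mult rep_V_const mscale_def mmul_mone_left)
      next
        case (3 x y)
        then show ?thesis using ij
          by (simp add: rep_V_diff rep_V_gen rep_V_mult mbracket_def mmul_def)
      qed
    qed
    then show "\<forall>i\<in>hatV L r. \<forall>j\<in>hatV L r. rep_V L r (u * s * v) i j = 0"
      by (simp add: rep_V_mult)
  qed (simp_all add: rep_V_0 rep_V_add)
  then show ?thesis using assms by blast
qed

definition UU_gens :: "lie_kind \<Rightarrow> nat \<Rightarrow> free_alg2 set" where
  "UU_gens L r = {tens a 1 | a. a \<in> U_ideal L r} \<union> {tens 1 a | a. a \<in> U_ideal L r}"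

lemma tens_1_right: "tens a 1 = (\<Sum>v\<in>Poly_Mapping.keys a. Poly_Mapping.single (v, 0) (Poly_Mapping.lookup a v))"
  by (simp add: tens_def)

lemma tens_1_left: "tens 1 a = (\<Sum>w\<in>Poly_Mapping.keys a. Poly_Mapping.single (0, w) (Poly_Mapping.lookup a w))"
  by (simp add: tens_def)

lemma tens_gen: "tens (gen x) (gen y) = Poly_Mapping.single (Word [x], Word [y]) 1"
  by (simp add: tens_def gen_def)

lemma UU_gens_FA2: "UU_gens L r \<subseteq> FA2 L r"
proof -
  have "tens a 1 \<in> FA2 L r \<and> tens 1 a \<in> FA2 L r" if "a \<in> U_ideal L r" for a
    using subsetD[OF U_ideal_subset that] unfolding tens_1_right tens_1_left FA_def
    by (auto intro!: FA2_sum FA2_single simp: letters_0)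
  then show ?thesis unfolding UU_gens_def by blast
qed

lemma UU_ideal_eq: "UU_ideal L r = genideal (type_ring (FA2 L r)) (UU_gens L r)"
  by (simp add: UU_ideal_def free2_on_eq UU_gens_def)

lemma ideal_UU_ideal: "ideal (UU_ideal L r) (type_ring (FA2 L r))"
proof -
  interpret ring "type_ring (FA2 L r)" by (rule ring_type_ring[OF FA2_subring])
  show ?thesis
    unfolding UU_ideal_eq using UU_gens_FA2 by (intro genideal_ideal) (simp add: type_ring_def)
qed

lemma ring_hom_UU_class: "ring_hom_ring (type_ring (FA2 L r)) (UU L r) (UU_class L r)"
proof -
  interpret ideal "UU_ideal L r" "type_ring (FA2 L r)" by (rule ideal_UU_ideal)
  have "UU_class L r = (+>\<^bsub>type_ring (FA2 L r)\<^esub>) (UU_ideal L r)"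
    by (rule ext) (simp add: UU_class_def free2_on_eq)
  then show ?thesis using rcos_ring_hom_ring by (simp add: UU_def free2_on_eq)
qed

lemma U_ideal_sum: "(\<And>x. x \<in> A \<Longrightarrow> f x \<in> U_ideal L r) \<Longrightarrow> sum f A \<in> U_ideal L r"
  by (induction A rule: infinite_finite_induct) (auto intro: U_ideal_0 U_ideal_add)

text \<open>The ideal of \<open>U \<otimes> U\<close> is generated by the relations in either factor.  The first ones give scalar
  matrices over the ideal of \<open>U\<close>, the second ones act by zero on \<open>V\<close>.\<close>

lemma tmat_UU_ideal:
  assumes "t \<in> UU_ideal L r" "i \<in> hatV L r" "j \<in> hatV L r"
  shows "tmat L r t i j \<in> U_ideal L r"
proof -
  have "\<forall>i\<in>hatV L r. \<forall>j\<in>hatV L r. tmat L r t i j \<in> U_ideal L r"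
    using FA2_subring UU_gens_FA2 assms(1)[unfolded UU_ideal_eq]
  proof (rule genideal_induct)
    fix u s v :: free_alg2
    assume uv: "u \<in> FA2 L r" "v \<in> FA2 L r" and s: "s \<in> UU_gens L r"
    have g: "tmat L r s i j \<in> U_ideal L r" if ij: "i \<in> hatV L r" "j \<in> hatV L r" for i j
    proof -
      from s consider a where "a \<in> U_ideal L r" "s = tens a 1" | a where "a \<in> U_ideal L r" "s = tens 1 a"
        unfolding UU_gens_def by blast
      then show ?thesis
      proof cases
        case (1 a)
        have "tmat L r s i j = const (mone L r i j) * (\<Sum>v\<in>Poly_Mapping.keys a. Poly_Mapping.single v (Poly_Mapping.lookup a v))"
          by (simp add: 1 tens_1_right tmat_sum tmat_single word_on_V_0 sum_distrib_left const_mult_single mult.commute)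
        also have "(\<Sum>v\<in>Poly_Mapping.keys a. Poly_Mapping.single v (Poly_Mapping.lookup a v)) = a"
          by (rule poly_mapping_eqI) (auto simp: lookup_sum lookup_single when_def in_keys_iff)
        finally show ?thesis using 1 by (simp add: U_ideal_mult_left)
      next
        case (2 a)
        have "tmat L r s i j = const (rep_V L r a i j)"
          by (simp add: 2 tens_1_left tmat_sum tmat_single rep_V_def lext_def const_def single_sum)
        then show ?thesis using rep_V_U_ideal[OF 2(1) ij] by (simp add: U_ideal_0)
      qed
    qed
    show "\<forall>i\<in>hatV L r. \<forall>j\<in>hatV L r. tmat L r (u * s * v) i j \<in> U_ideal L r"
    proof (intro ballI)
      fix i j assume "i \<in> hatV L r" "j \<in> hatV L r"
      then show "tmat L r (u * s * v) i j \<in> U_ideal L r"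
        using uv by (simp add: tmat_mult) (intro U_ideal_sum U_ideal_mult_right tmat_FA U_ideal_mult_left g)
    qed
  qed (auto simp: tmat_0 tmat_add intro: U_ideal_0 U_ideal_add)
  then show ?thesis using assms by blast
qed

lemma free_id_tr_eq: "free_id_tr L r t = (\<Sum>i\<in>hatV L r. tmat L r t i i)"
proof -
  have "(\<Sum>i\<in>hatV L r. tmat L r t i i) = (\<Sum>p\<in>Poly_Mapping.keys t. \<Sum>i\<in>hatV L r.
      const (Poly_Mapping.lookup t p) * (case p of (v, w) \<Rightarrow> Poly_Mapping.single v (word_on_V L r w i i)))"
    unfolding tmat_def lext_def by (rule sum.swap)
  also have "\<dots> = free_id_tr L r t"
    unfolding free_id_tr_def mtrace_def
    by (intro sum.cong refl) (auto simp: const_mult_single single_sum sum_distrib_left)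
  finally show ?thesis by simp
qed

lemma id_tr_class:
  assumes "t \<in> FA2 L r"
  shows "id_tr L r (UU_class L r t) = U_class L r (\<Sum>i\<in>hatV L r. tmat L r t i i)"
proof -
  have eq: "U_class L r (free_id_tr L r (h + t)) = U_class L r (free_id_tr L r t)" if h: "h \<in> UU_ideal L r" for h
  proof -
    have "(\<Sum>i\<in>hatV L r. tmat L r h i i) \<in> U_ideal L r"
      by (intro U_ideal_sum tmat_UU_ideal[OF h])
    then show ?thesis
      unfolding U_class_eq_iff free_id_tr_eq tmat_add sum.distrib by simp
  qed
  have "0 \<in> UU_ideal L r" by (rule type_ring_idealD(2)[OF FA2_subring ideal_UU_ideal])
  then have t: "t \<in> {h + t | h. h \<in> UU_ideal L r}" by (intro CollectI exI[of _ 0]) simp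
  have "(\<lambda>t. U_class L r (free_id_tr L r t)) ` {h + t | h. h \<in> UU_ideal L r} = {U_class L r (free_id_tr L r t)}"
  proof (intro equalityI subsetI)
    fix x assume "x \<in> (\<lambda>t. U_class L r (free_id_tr L r t)) ` {h + t | h. h \<in> UU_ideal L r}"
    then obtain h where "h \<in> UU_ideal L r" "x = U_class L r (free_id_tr L r (h + t))" by blast
    then show "x \<in> {U_class L r (free_id_tr L r t)}" by (simp add: eq)
  next
    fix x assume "x \<in> {U_class L r (free_id_tr L r t)}"
    then have "x = (\<lambda>t. U_class L r (free_id_tr L r t)) t" by simp
    then show "x \<in> (\<lambda>t. U_class L r (free_id_tr L r t)) ` {h + t | h. h \<in> UU_ideal L r}"
      using t by (rule image_eqI)
  qed
  then show ?thesis
    by (simp add: id_tr_def UU_class_def free2_on_eq type_ring_coset free_id_tr_eq)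
qed

section \<open>The powers of the Casimir matrix\<close>

definition ucong :: "lie_kind \<Rightarrow> nat \<Rightarrow> free_alg \<Rightarrow> free_alg \<Rightarrow> bool" where
  "ucong L r a b \<longleftrightarrow> a - b \<in> U_ideal L r"

lemma ucong_refl: "ucong L r a a" by (simp add: ucong_def U_ideal_0)
lemma ucong_trans [trans]: "ucong L r a b \<Longrightarrow> ucong L r b c \<Longrightarrow> ucong L r a c"
  using U_ideal_add[of "a - b" L r "b - c"] by (simp add: ucong_def)
lemma ucong_sym: "ucong L r a b \<Longrightarrow> ucong L r b a"
  using U_ideal_uminus[of "a - b" L r] by (simp add: ucong_def)
lemma ucong_add: "ucong L r a b \<Longrightarrow> ucong L r c d \<Longrightarrow> ucong L r (a + c) (b + d)"
  using U_ideal_add[of "a - b" L r "c - d"] by (simp add: ucong_def algebra_simps)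
lemma ucong_sum: "(\<And>x. x \<in> A \<Longrightarrow> ucong L r (f x) (g x)) \<Longrightarrow> ucong L r (sum f A) (sum g A)"
  by (induction A rule: infinite_finite_induct) (auto intro: ucong_refl ucong_add)
lemma ucong_mult_left: "ucong L r a b \<Longrightarrow> c \<in> FA L r \<Longrightarrow> ucong L r (c * a) (c * b)"
  using U_ideal_mult_left[of "a - b" L r c] by (simp add: ucong_def right_diff_distrib)
lemma ucong_mult_right: "ucong L r a b \<Longrightarrow> c \<in> FA L r \<Longrightarrow> ucong L r (a * c) (b * c)"
  using U_ideal_mult_right[of "a - b" L r c] by (simp add: ucong_def left_diff_distrib)
lemma hc_fun_ucong: "ucong L r a b \<Longrightarrow> hc_fun L r a = hc_fun L r b"
  unfolding ucong_def by (rule hc_fun_cong)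

lemma gen_lincomb:
  assumes "finite S" "\<And>s. s \<in> S \<Longrightarrow> f s \<in> lie L r"
  shows "(\<lambda>i j. \<Sum>s\<in>S. c s * f s i j) \<in> lie L r \<and>
    ucong L r (gen (\<lambda>i j. \<Sum>s\<in>S. c s * f s i j)) (\<Sum>s\<in>S. const (c s) * gen (f s))"
  using assms
proof (induction S rule: finite_induct)
  case empty
  then show ?case using gen_zero_U_ideal by (simp add: lie_zero ucong_def)
next
  case (insert s S)
  let ?y = "\<lambda>i j. \<Sum>s\<in>S. c s * f s i j"
  have y: "?y \<in> lie L r" "ucong L r (gen ?y) (\<Sum>s\<in>S. const (c s) * gen (f s))" using insert by auto
  have s: "mscale (c s) (f s) \<in> lie L r" "ucong L r (gen (mscale (c s) (f s))) (const (c s) * gen (f s))"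
    using insert.prems by (auto intro: lie_mscale U_ideal_mscale simp: ucong_def)
  have eq: "(\<lambda>i j. \<Sum>s\<in>insert s S. c s * f s i j) = madd (mscale (c s) (f s)) ?y"
    using insert.hyps by (simp add: madd_def mscale_def)
  have "ucong L r (gen (madd (mscale (c s) (f s)) ?y)) (gen (mscale (c s) (f s)) + gen ?y)"
    using U_ideal_madd[OF s(1) y(1)] by (simp add: ucong_def diff_diff_eq)
  also have "ucong L r (gen (mscale (c s) (f s)) + gen ?y) (const (c s) * gen (f s) + (\<Sum>s\<in>S. const (c s) * gen (f s)))"
    by (rule ucong_add[OF s(2) y(2)])
  finally show ?case
    using insert.hyps s y unfolding eq by (simp add: lie_madd)
qed

text \<open>The coordinate of \<open>F\<^sub>j\<^sub>i\<close> at a basis vector \<open>x\<close> is its pairing with the dual vector.  The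
  trace form pairs \<open>F\<^sub>j\<^sub>i\<close> with an element \<open>z\<close> of the Lie algebra to \<open>z\<^sub>i\<^sub>j\<close>, because the two matrix
  units of \<open>F\<^sub>j\<^sub>i\<close> contribute equally; this is where the factor 1/2 of the form goes.\<close>

lemma dual_basis_expansion:
  assumes B: "is_lie_basis L r B" and D: "is_dual_basis L r B bstar" and ij: "i \<in> hatV L r" "j \<in> hatV L r"
  shows "Fmat L j i = (\<lambda>a b. \<Sum>x\<in>B. bstar x i j * x a b)"
proof -
  have fin: "finite B" and sub: "B \<subseteq> lie L r" and span: "lie L r \<subseteq> mspan B"
    using B by (auto simp: is_lie_basis_def)
  have "Fmat L j i \<in> mspan B" using span Fmat_lie[OF ij(2,1)] by blast
  then obtain T c where T: "Fmat L j i = mlincomb T c" "finite T" "T \<subseteq> B" by (auto simp: mspan_def)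
  define d where "d x = (if x \<in> T then c x else 0)" for x
  have F: "Fmat L j i a b = (\<Sum>x\<in>B. d x * x a b)" for a b
  proof -
    have "Fmat L j i a b = (\<Sum>x\<in>T. d x * x a b)" by (simp add: T(1) mlincomb_def d_def)
    also have "\<dots> = (\<Sum>x\<in>B. d x * x a b)"
      using T(3) fin by (intro sum.mono_neutral_left) (auto simp: d_def)
    finally show ?thesis .
  qed
  have "d y = bstar y i j" if y: "y \<in> B" for y
  proof -
    have yl: "bstar y \<in> lie L r" using D y by (auto simp: is_dual_basis_def)
    have tr: "lie_form L r x z = (\<Sum>a\<in>hatV L r. \<Sum>b\<in>hatV L r. x a b * z b a) / 2" for x z
      by (simp add: lie_form_def mtrace_def mmul_def)
    have "lie_form L r (Fmat L j i) (bstar y) = (\<Sum>a\<in>hatV L r. \<Sum>b\<in>hatV L r. \<Sum>x\<in>B. d x * (x a b * bstar y b a)) / 2"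
      unfolding tr F sum_distrib_right mult.assoc ..
    also have "\<dots> = (\<Sum>x\<in>B. d x * lie_form L r x (bstar y))"
      unfolding tr sum_divide_distrib sum_distrib_left
      by (simp add: sum.swap[of _ B "hatV L r"] sum_distrib_left times_divide_eq_right)
    also have "\<dots> = (\<Sum>x\<in>B. if x = y then d y else 0)"
      using D y by (intro sum.cong) (auto simp: is_dual_basis_def)
    also have "\<dots> = d y" using y fin by simp
    finally have 1: "lie_form L r (Fmat L j i) (bstar y) = d y" .
    have "(\<Sum>b\<in>hatV L r. Fmat L j i a b * bstar y b a)
        = (if a = j then bstar y i j else 0) - (if a = - i then theta L j i * bstar y (- j) (- i) else 0)"
      for a
    proof -
      have "(\<Sum>b\<in>hatV L r. Fmat L j i a b * bstar y b a) =
         (\<Sum>b\<in>hatV L r. (if b = i then (if a = j then bstar y i j else 0) else 0)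
            - (if b = - j then (if a = - i then theta L j i * bstar y (- j) (- i) else 0) else 0))"
        unfolding Fmat_def Emat_def by (intro sum.cong) (simp_all add: left_diff_distrib split: if_split)
      also have "\<dots> = (if a = j then bstar y i j else 0) - (if a = - i then theta L j i * bstar y (- j) (- i) else 0)"
        using ij by (simp add: sum_subtractf)
      finally show ?thesis .
    qed
    then have "lie_form L r (Fmat L j i) (bstar y) = (bstar y i j - theta L j i * bstar y (- j) (- i)) / 2"
      unfolding tr using ij by (simp add: sum_subtractf)
    also have "theta L j i * bstar y (- j) (- i) = - bstar y i j"
    proof -
      have "theta L j i = theta L i j" by (simp add: theta_def mult.commute)
      then show ?thesis using lie_sym[OF yl ij] by simp
    qed
    finally show ?thesis using 1 by simp
  qed
  then show ?thesis using F by (intro ext) simp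
qed

text \<open>The matrix of \<open>y/2 + \<gamma>\<close>.  Since \<open>\<gamma>\<close> is the sum of all \<open>F\<^sub>j\<^sub>i \<otimes> E\<^sub>i\<^sub>j\<close>, the indices are exchanged.\<close>

definition casimir :: "lie_kind \<Rightarrow> nat \<Rightarrow> int \<Rightarrow> int \<Rightarrow> free_alg" where
  "casimir L r i j = const (if i = j then y_val L r / 2 else 0) + gen (Fmat L j i)"

primrec cpow :: "lie_kind \<Rightarrow> nat \<Rightarrow> nat \<Rightarrow> int \<Rightarrow> int \<Rightarrow> free_alg" where
  "cpow L r 0 i j = (if i = j then 1 else 0)"
| "cpow L r (Suc l) i j = (\<Sum>k\<in>hatV L r. casimir L r i k * cpow L r l k j)"

lemma casimir_FA: "i \<in> hatV L r \<Longrightarrow> j \<in> hatV L r \<Longrightarrow> casimir L r i j \<in> FA L r"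
  unfolding casimir_def by (intro FA_add FA_const FA_gen Fmat_lie)

lemma cpow_FA: "i \<in> hatV L r \<Longrightarrow> j \<in> hatV L r \<Longrightarrow> cpow L r l i j \<in> FA L r"
  by (induction l arbitrary: i) (auto intro!: FA_sum FA_mult casimir_FA)

lemma zV_class:
  assumes B: "is_lie_basis L r B" and D: "is_dual_basis L r B bstar"
  shows "\<exists>a\<in>FA L r. zV L r B bstar l = U_class L r a \<and>
     ucong L r a (const (eps_val L) * (\<Sum>i\<in>hatV L r. cpow L r l i i))"
proof -
  have fin: "finite B" and sub: "B \<subseteq> lie L r" and bs: "\<And>b. b \<in> B \<Longrightarrow> bstar b \<in> lie L r"
    using B D by (auto simp: is_lie_basis_def is_dual_basis_def)
  define t where "t = (\<Sum>b\<in>B. tens (gen b) (gen (bstar b)))"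
  define g where "g = const (y_val L r / 2) + t"
  have t: "t \<in> FA2 L r"
    unfolding t_def tens_gen using sub bs by (intro FA2_sum FA2_single) auto
  have g: "g \<in> FA2 L r"
    using FA2_subring[of L r] t FA2_const unfolding g_def is_subring_def by blast
  interpret h: ring_hom_ring "type_ring (FA2 L r)" "UU L r" "UU_class L r" by (rule ring_hom_UU_class)
  have pow: "x [^]\<^bsub>type_ring (FA2 L r)\<^esub> n = x ^ n" for x and n :: nat
    by (induction n) (simp_all add: nat_pow_def type_ring_def power_commutes)
  have "UU_class L r (const (y_val L r / 2)) \<oplus>\<^bsub>UU L r\<^esub> gamma L r B bstar = UU_class L r g"
    using h.hom_add[of "const (y_val L r / 2)" t] t FA2_const[of _ L r]
    by (simp add: gamma_def t_def[symmetric] g_def type_ring_def)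
  then have "(UU_class L r (const (y_val L r / 2)) \<oplus>\<^bsub>UU L r\<^esub> gamma L r B bstar) [^]\<^bsub>UU L r\<^esub> l = UU_class L r (g ^ l)"
    using h.hom_nat_pow[of g l] g by (simp add: pow) (simp add: type_ring_def)
  then have zV: "zV L r B bstar l = U_class L r (const (eps_val L) * (\<Sum>i\<in>hatV L r. tmat L r (g ^ l) i i))"
    unfolding zV_def U_scalar_def
    by (simp add: id_tr_class FA2_power g U_class_mult FA_sum tmat_FA)
  have M: "ucong L r (tmat L r g i j) (casimir L r i j)" if ij: "i \<in> hatV L r" "j \<in> hatV L r" for i j
  proof -
    have "tmat L r g i j = const (if i = j then y_val L r / 2 else 0) + (\<Sum>b\<in>B. const (bstar b i j) * gen b)"
      using ij by (simp add: g_def t_def tmat_add tmat_sum tmat_tens_gen tmat_const)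
    moreover have "ucong L r (gen (Fmat L j i)) (\<Sum>b\<in>B. const (bstar b i j) * gen b)"
      unfolding dual_basis_expansion[OF B D ij]
      by (rule conjunct2[OF gen_lincomb[where f = "\<lambda>b. b" and c = "\<lambda>b. bstar b i j"]]) (use fin sub in auto)
    ultimately show ?thesis
      unfolding casimir_def by (simp add: ucong_add ucong_refl ucong_sym)
  qed
  have "ucong L r (tmat L r (g ^ l) i j) (cpow L r l i j)" if "i \<in> hatV L r" "j \<in> hatV L r" for i j
    using that
  proof (induction l arbitrary: i)
    case 0
    have "tmat L r (g ^ 0) i j = cpow L r 0 i j"
      using 0 tmat_const[of i L r 1 j] by (simp add: if_distrib[where f = const] cong: if_cong)
    then show ?case by (simp add: ucong_refl)
  next
    case (Suc l)
    have "ucong L r (tmat L r g i k * tmat L r (g ^ l) k j) (casimir L r i k * cpow L r l k j)" if k: "k \<in> hatV L r" for k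
      using ucong_trans[OF ucong_mult_right[OF M[OF Suc.prems(1) k] tmat_FA[OF FA2_power[OF g]]]
          ucong_mult_left[OF Suc.IH[OF k Suc.prems(2)] casimir_FA[OF Suc.prems(1) k]]] .
    then show ?case using Suc.prems by (simp add: tmat_mult ucong_sum)
  qed
  then have "ucong L r (const (eps_val L) * (\<Sum>i\<in>hatV L r. tmat L r (g ^ l) i i))
      (const (eps_val L) * (\<Sum>i\<in>hatV L r. cpow L r l i i))"
    by (intro ucong_mult_left ucong_sum FA_const) auto
  moreover have "const (eps_val L) * (\<Sum>i\<in>hatV L r. tmat L r (g ^ l) i i) \<in> FA L r"
    by (intro FA_mult FA_sum FA_const tmat_FA FA2_power g)
  ultimately show ?thesis using zV by blast
qed

text \<open>\<open>F\<^sub>b\<^sub>a\<close> is \<open>E\<^sub>b\<^sub>a\<close> minus its image under an anti-involution that sends \<open>x\<close> to \<open>-x\<close>.  So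
  bracketing with \<open>x\<close> commutes with the passage from \<open>E\<close> to \<open>F\<close>, and the formula is the one for
  matrix units.\<close>

lemma mbracket_Fmat:
  assumes x: "x \<in> lie L r" and ab: "a \<in> hatV L r" "b \<in> hatV L r" and pq: "p \<in> hatV L r" "q \<in> hatV L r"
  shows "mbracket L r x (Fmat L b a) p q
    = (\<Sum>c\<in>hatV L r. x c b * Fmat L c a p q) - (\<Sum>c\<in>hatV L r. x a c * Fmat L b c p q)"
proof -
  have F: "Fmat L i j k l = (if k = i then (if l = j then 1 else 0) else 0)
      - theta L i j * (if k = - j then (if l = - i then 1 else 0) else 0)" for i j k l
    by (simp add: Fmat_def Emat_def)
  have F': "Fmat L i j k l = (if i = k then (if l = j then 1 else 0) else 0)
      - theta L i j * (if i = - l then (if k = - j then 1 else 0) else 0)" for i j k l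
    unfolding F by (auto simp: equation_minus_iff)
  have F'': "Fmat L i j k l = (if j = l then (if k = i then 1 else 0) else 0)
      - theta L i j * (if j = - k then (if l = - i then 1 else 0) else 0)" for i j k l
    unfolding F by (auto simp: equation_minus_iff)
  have pick: "(\<Sum>c\<in>hatV L r. f c * (if c = d then e else 0)) = (if d \<in> hatV L r then f d * e else 0)"
    for f :: "int \<Rightarrow> complex" and d e
    by (simp add: if_distrib[where f = "\<lambda>t. _ * t"] cong: if_cong)
  have 1: "mmul L r x (Fmat L b a) p q = x p b * (if q = a then 1 else 0) - x p (- a) * (theta L b a * (if q = - b then 1 else 0))"
  proof -
    have "mmul L r x (Fmat L b a) p q = (\<Sum>c\<in>hatV L r. x p c * (if c = b then (if q = a then 1 else 0) else 0))
       - (\<Sum>c\<in>hatV L r. x p c * (if c = - a then theta L b a * (if q = - b then 1 else 0) else 0))"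
      unfolding mmul_def F sum_subtractf[symmetric] by (intro sum.cong) (simp_all add: right_diff_distrib)
    then show ?thesis unfolding pick using ab by simp
  qed
  have 2: "mmul L r (Fmat L b a) x p q = (if p = b then 1 else 0) * x a q - theta L b a * (if p = - a then 1 else 0) * x (- b) q"
  proof -
    have "mmul L r (Fmat L b a) x p q = (\<Sum>c\<in>hatV L r. x c q * (if c = a then (if p = b then 1 else 0) else 0))
       - (\<Sum>c\<in>hatV L r. x c q * (if c = - b then theta L b a * (if p = - a then 1 else 0) else 0))"
      unfolding mmul_def F sum_subtractf[symmetric] by (intro sum.cong) (simp_all add: left_diff_distrib)
    then show ?thesis unfolding pick using ab by (simp add: mult_ac)
  qed
  have 3: "(\<Sum>c\<in>hatV L r. x c b * Fmat L c a p q)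
      = x p b * (if q = a then 1 else 0) - x (- q) b * (theta L (- q) a * (if p = - a then 1 else 0))"
  proof -
    have "(\<Sum>c\<in>hatV L r. x c b * Fmat L c a p q) = (\<Sum>c\<in>hatV L r. x c b * (if c = p then (if q = a then 1 else 0) else 0))
       - (\<Sum>c\<in>hatV L r. x c b * (if c = - q then theta L (- q) a * (if p = - a then 1 else 0) else 0))"
      unfolding F' sum_subtractf[symmetric] by (intro sum.cong) (simp_all add: right_diff_distrib)
    then show ?thesis unfolding pick using pq by simp
  qed
  have 4: "(\<Sum>c\<in>hatV L r. x a c * Fmat L b c p q)
      = x a q * (if p = b then 1 else 0) - x a (- p) * (theta L b (- p) * (if q = - b then 1 else 0))"
  proof -
    have "(\<Sum>c\<in>hatV L r. x a c * Fmat L b c p q) = (\<Sum>c\<in>hatV L r. x a c * (if c = q then (if p = b then 1 else 0) else 0))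
       - (\<Sum>c\<in>hatV L r. x a c * (if c = - p then theta L b (- p) * (if q = - b then 1 else 0) else 0))"
      unfolding F'' sum_subtractf[symmetric] by (intro sum.cong) (simp_all add: right_diff_distrib)
    then show ?thesis unfolding pick using pq by simp
  qed
  have sym: "theta L i j = theta L j i" for i j by (simp add: theta_def mult.commute)
  have 5: "x p (- a) * theta L b a = - (x a (- p) * theta L b (- p))"
  proof -
    have "x a (- p) = - theta L a (- p) * x p (- a)" using lie_sym[OF x, of a "- p"] ab pq by simp
    moreover have "theta L b (- p) * theta L (- p) a = theta L b a" using theta_mult[of b L r a "- p"] ab pq by simp
    moreover have "theta L a (- p) = theta L (- p) a" by (rule sym)
    ultimately show ?thesis by (simp add: mult_ac)
  qed
  have 6: "theta L b a * x (- b) q = - (x (- q) b * theta L (- q) a)"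
  proof -
    have "x (- b) q = - theta L (- b) q * x (- q) b" using lie_sym[OF x, of "- b" q] ab pq by simp
    moreover have "theta L (- b) q = theta L (- q) b" by (simp add: theta_def mult.commute)
    ultimately have "theta L b a * x (- b) q = - ((theta L (- q) b * theta L b a) * x (- q) b)"
      by (simp add: mult_ac)
    moreover have "theta L (- q) b * theta L b a = theta L (- q) a"
      using theta_mult[of "- q" L r a b] ab pq by simp
    ultimately show ?thesis by (simp add: mult.commute)
  qed
  show ?thesis
  proof -
    have 5: "x p (- a) * (theta L b a * e) = - (x a (- p) * (theta L b (- p) * e))" for e
      unfolding mult.assoc[symmetric] 5 by simp
    have 6: "theta L b a * e * x (- b) q = - (x (- q) b * (theta L (- q) a * e))" for e
    proof -
      have "theta L b a * e * x (- b) q = (theta L b a * x (- b) q) * e" by (simp add: mult_ac)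
      then show ?thesis unfolding 6 by (simp add: mult.assoc)
    qed
    show ?thesis unfolding mbracket_def 1 2 3 4 5 6 by (simp only: mult.commute diff_conv_add_uminus minus_add_distrib minus_minus add_ac)
  qed
qed

text \<open>\<open>\<gamma>\<close> commutes with \<open>x \<otimes> 1 + 1 \<otimes> x\<close>, hence so do the powers of \<open>y/2 + \<gamma>\<close>.\<close>

lemma cpow_invariant:
  assumes x: "x \<in> lie L r" and ab: "a \<in> hatV L r" "b \<in> hatV L r"
  shows "ucong L r (gen x * cpow L r l a b - cpow L r l a b * gen x)
    ((\<Sum>c\<in>hatV L r. const (x c b) * cpow L r l a c) - (\<Sum>c\<in>hatV L r. const (x a c) * cpow L r l c b))"
  using ab(1)
proof (induction l arbitrary: a)
  case 0
  have "(\<Sum>c\<in>hatV L r. const (x c b) * cpow L r 0 a c) = const (x a b)"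
    using 0 by (simp add: if_distrib[where f = "\<lambda>t. _ * t"] cong: if_cong)
  moreover have "(\<Sum>c\<in>hatV L r. const (x a c) * cpow L r 0 c b) = const (x a b)"
    using ab by (simp add: if_distrib[where f = "\<lambda>t. _ * t"] cong: if_cong)
  ultimately show ?case by (simp add: ucong_refl)
next
  case (Suc l)
  let ?V = "hatV L r" and ?N = "casimir L r" and ?P = "cpow L r l"
  have N: "ucong L r (gen x * ?N a k - ?N a k * gen x)
    ((\<Sum>c\<in>?V. const (x c k) * ?N a c) - (\<Sum>c\<in>?V. const (x a c) * ?N c k))" if k: "k \<in> ?V" for k
  proof -
    have gl: "mbracket L r x (Fmat L k a) \<in> gl L r"
      by (intro lie_gl lie_mbracket x Fmat_lie k Suc.prems)
    have br: "mbracket L r x (Fmat L k a) = (\<lambda>p q. \<Sum>c\<in>?V \<times> {False, True}.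
        (if snd c then - x a (fst c) else x (fst c) k) * (if snd c then Fmat L k (fst c) else Fmat L (fst c) a) p q)" (is "_ = ?R")
    proof (intro ext)
      fix p q
      have R: "?R p q = (\<Sum>c\<in>?V. x c k * Fmat L c a p q) - (\<Sum>c\<in>?V. x a c * Fmat L k c p q)"
        by (simp add: sum.cartesian_product' sum.distrib sum_negf sum_subtractf)
      show "mbracket L r x (Fmat L k a) p q = ?R p q"
      proof (cases "p \<in> ?V \<and> q \<in> ?V")
        case True
        then show ?thesis unfolding R by (intro mbracket_Fmat x Suc.prems k) auto
      next
        case False
        have F: "Fmat L i j p q = 0" if "i \<in> ?V" "j \<in> ?V" for i j
          using gl_0[OF lie_gl[OF Fmat_lie[OF that]], of p q] False by blast
        have "(\<Sum>c\<in>?V. x c k * Fmat L c a p q) = 0" "(\<Sum>c\<in>?V. x a c * Fmat L k c p q) = 0"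
          by (intro sum.neutral ballI, simp add: F k Suc.prems)+
        moreover have "mbracket L r x (Fmat L k a) p q = 0"
          using gl_0[OF gl, of p q] False by blast
        ultimately show ?thesis unfolding R by simp
      qed
    qed
    have "ucong L r (gen x * gen (Fmat L k a) - gen (Fmat L k a) * gen x) (gen (mbracket L r x (Fmat L k a)))"
      unfolding ucong_def by (intro U_ideal_mbracket x Fmat_lie k Suc.prems)
    also have "ucong L r (gen (mbracket L r x (Fmat L k a)))
      (\<Sum>c\<in>?V \<times> {False, True}. const (if snd c then - x a (fst c) else x (fst c) k) * gen (if snd c then Fmat L k (fst c) else Fmat L (fst c) a))"
      unfolding br by (rule conjunct2[OF gen_lincomb]) (auto intro!: Fmat_lie k Suc.prems)
    also have "(\<Sum>c\<in>?V \<times> {False, True}. const (if snd c then - x a (fst c) else x (fst c) k) * gen (if snd c then Fmat L k (fst c) else Fmat L (fst c) a))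
      = (\<Sum>c\<in>?V. const (x c k) * gen (Fmat L c a)) - (\<Sum>c\<in>?V. const (x a c) * gen (Fmat L k c))"
      by (simp add: sum.cartesian_product' sum.distrib sum_subtractf const_minus)
    finally have g: "ucong L r (gen x * gen (Fmat L k a) - gen (Fmat L k a) * gen x)
      ((\<Sum>c\<in>?V. const (x c k) * gen (Fmat L c a)) - (\<Sum>c\<in>?V. const (x a c) * gen (Fmat L k c)))" .
    have "(\<Sum>c\<in>?V. const (x c k) * const (if a = c then y_val L r / 2 else 0)) = (\<Sum>c\<in>?V. if c = a then const (x a k) * (const (y_val L r / 2) :: free_alg) else 0)"
      by (intro sum.cong) auto
    moreover have "(\<Sum>c\<in>?V. const (x a c) * const (if c = k then y_val L r / 2 else 0)) = (\<Sum>c\<in>?V. if c = k then const (x a k) * (const (y_val L r / 2) :: free_alg) else 0)"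
      by (intro sum.cong) auto
    ultimately have R: "(\<Sum>c\<in>?V. const (x c k) * ?N a c) - (\<Sum>c\<in>?V. const (x a c) * ?N c k)
      = (\<Sum>c\<in>?V. const (x c k) * gen (Fmat L c a)) - (\<Sum>c\<in>?V. const (x a c) * gen (Fmat L k c))"
      using k Suc.prems by (simp add: casimir_def distrib_left sum.distrib)
    have "gen x * ?N a k - ?N a k * gen x = gen x * gen (Fmat L k a) - gen (Fmat L k a) * gen x"
      by (simp add: casimir_def distrib_left distrib_right const_commute[of _ "gen x"])
    then show ?thesis using g unfolding R by simp
  qed
  have E: "gen x * cpow L r (Suc l) a b - cpow L r (Suc l) a b * gen x
     = (\<Sum>k\<in>?V. (gen x * ?N a k - ?N a k * gen x) * ?P k b + ?N a k * (gen x * ?P k b - ?P k b * gen x))"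
    unfolding cpow.simps sum_distrib_left sum_distrib_right sum_subtractf[symmetric]
    by (intro sum.cong refl) (simp only: left_diff_distrib right_diff_distrib mult.assoc, simp)
  have C: "ucong L r (\<Sum>k\<in>?V. (gen x * ?N a k - ?N a k * gen x) * ?P k b + ?N a k * (gen x * ?P k b - ?P k b * gen x))
    (\<Sum>k\<in>?V. ((\<Sum>c\<in>?V. const (x c k) * ?N a c) - (\<Sum>c\<in>?V. const (x a c) * ?N c k)) * ?P k b
     + ?N a k * ((\<Sum>c\<in>?V. const (x c b) * ?P k c) - (\<Sum>c\<in>?V. const (x k c) * ?P c b)))"
    by (rule ucong_sum)
      (rule ucong_add[OF ucong_mult_right[OF N cpow_FA[OF _ ab(2)]] ucong_mult_left[OF Suc.IH casimir_FA[OF Suc.prems]]])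
  have G: "(\<Sum>k\<in>?V. ((\<Sum>c\<in>?V. const (x c k) * ?N a c) - (\<Sum>c\<in>?V. const (x a c) * ?N c k)) * ?P k b
     + ?N a k * ((\<Sum>c\<in>?V. const (x c b) * ?P k c) - (\<Sum>c\<in>?V. const (x k c) * ?P c b)))
    = (\<Sum>c\<in>?V. const (x c b) * cpow L r (Suc l) a c) - (\<Sum>c\<in>?V. const (x a c) * cpow L r (Suc l) c b)"
  proof -
    have cl: "?N a k * (const c * f) = const c * (?N a k * f)" for k c f
      by (simp only: mult.assoc[symmetric] const_commute[of c "casimir L r a k"])
    have A: "(\<Sum>k\<in>?V. (\<Sum>c\<in>?V. const (x c k) * ?N a c) * ?P k b) = (\<Sum>k\<in>?V. ?N a k * (\<Sum>c\<in>?V. const (x k c) * ?P c b))"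
      unfolding sum_distrib_left sum_distrib_right cl mult.assoc by (rule sum.swap)
    have B: "(\<Sum>k\<in>?V. (\<Sum>c\<in>?V. const (x a c) * ?N c k) * ?P k b) = (\<Sum>c\<in>?V. const (x a c) * cpow L r (Suc l) c b)"
      unfolding cpow.simps sum_distrib_left sum_distrib_right mult.assoc by (rule sum.swap)
    have C: "(\<Sum>k\<in>?V. ?N a k * (\<Sum>c\<in>?V. const (x c b) * ?P k c)) = (\<Sum>c\<in>?V. const (x c b) * cpow L r (Suc l) a c)"
      unfolding cpow.simps sum_distrib_left cl by (rule sum.swap)
    show ?thesis
      unfolding left_diff_distrib right_diff_distrib sum.distrib sum_subtractf A B C by simp
  qed
  show ?case using C by (simp only: E G)
qed

section \<open>The triangular recursion\<close>

text \<open>The coordinate of the formal highest weight along the weight of \<open>v\<^sub>i\<close>, the projection of \<open>F\<^sub>i\<^sub>i\<close>.\<close>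

definition hcoord :: "int \<Rightarrow> hpoly" where
  "hcoord i = (if i > 0 then hvar (nat i) else if i < 0 then - hvar (nat (- i)) else 0)"

text \<open>The entry of \<open>F\<^sub>k\<^sub>i\<close> at \<open>(k, i)\<close>.  It differs from 1 only if \<open>F\<^sub>k\<^sub>i\<close> is a multiple of one matrix unit.\<close>

definition mixc :: "lie_kind \<Rightarrow> int \<Rightarrow> int \<Rightarrow> complex" where
  "mixc L k i = (if k = - i then 1 - theta L k i else 1)"

text \<open>The projection of the diagonal entries of the powers of \<open>y/2 + \<gamma>\<close>.\<close>

primrec tau :: "lie_kind \<Rightarrow> nat \<Rightarrow> nat \<Rightarrow> int \<Rightarrow> hpoly" where
  "tau L r 0 i = 1"
| "tau L r (Suc l) i = (const (y_val L r / 2) + hcoord i) * tau L r l i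
     + (\<Sum>k\<in>{k \<in> hatV L r. pos r k < pos r i}. const (mixc L k i) * (tau L r l k - tau L r l i))"

lemma hc_fun_diag:
  assumes i: "i \<in> hatV L r"
  shows "hc_fun L r (gen (Fmat L i i) * a) = hcoord i * hc_fun L r a"
proof (rule hc_fun_gen_mult)
  have th: "theta L i i = 1" using i by (auto simp: theta_def hatV_def sgn_if)
  have "Dl (Fmat L i i) (hcf L r) = scal (\<Sum>j=1..r. const (Fmat L i i (int j) (int j)) * hvar j) * hcf L r"
    by (rule Dl_hcf) (auto simp: Fmat_def Emat_def split: if_splits)
  also have "(\<Sum>j=1..r. const (Fmat L i i (int j) (int j)) * hvar j) = hcoord i"
  proof -
    consider "i > 0" | "i = 0" | "i < 0" by linarith
    then show ?thesis
    proof cases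
      case 1
      then have n: "nat i \<in> {1..r}" using i by (auto simp: hatV_def split: if_splits)
      have "(\<Sum>j=1..r. const (Fmat L i i (int j) (int j)) * hvar j) = (\<Sum>j=1..r. if j = nat i then hvar (nat i) else 0)"
        using 1 by (intro sum.cong refl) (auto simp: Fmat_def Emat_def)
      then show ?thesis using 1 n by (simp add: hcoord_def)
    next
      case 2
      then show ?thesis by (simp add: Fmat_def Emat_def hcoord_def)
    next
      case 3
      then have n: "nat (- i) \<in> {1..r}" using i by (auto simp: hatV_def split: if_splits)
      have "(\<Sum>j=1..r. const (Fmat L i i (int j) (int j)) * hvar j) = (\<Sum>j=1..r. if j = nat (- i) then - hvar (nat (- i)) else 0)"
        using 3 th by (intro sum.cong refl) (auto simp: Fmat_def Emat_def const_minus)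
      then show ?thesis using 3 n by (simp add: hcoord_def)
    qed
  qed
  finally show "Dl (Fmat L i i) (hcf L r) = scal (hcoord i) * hcf L r" .
qed

text \<open>\<open>F\<^sub>k\<^sub>i\<close> lies in \<open>n\<^sup>+\<close>, so the functional only sees its commutator with the entry at \<open>(k, i)\<close>, and by
  invariance this is a combination of the diagonal entries at \<open>k\<close> and \<open>i\<close>.\<close>

lemma hc_fun_casimir_upper:
  assumes ki: "k \<in> hatV L r" "i \<in> hatV L r" and lt: "pos r k < pos r i"
  shows "hc_fun L r (gen (Fmat L k i) * cpow L r l k i)
    = const (mixc L k i) * (hc_fun L r (cpow L r l k k) - hc_fun L r (cpow L r l i i))"
proof -
  let ?P = "cpow L r l" and ?F = "Fmat L k i" and ?V = "hatV L r"
  have "hc_fun L r (gen ?F * ?P k i) = hc_fun L r (?P k i * gen ?F) + hc_fun L r (gen ?F * ?P k i - ?P k i * gen ?F)"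
    by (simp add: hc_fun_diff)
  also have "hc_fun L r (?P k i * gen ?F) = 0"
    by (rule hc_fun_n_plus[OF Fmat_n_plus[OF ki lt]])
  also have "hc_fun L r (gen ?F * ?P k i - ?P k i * gen ?F)
    = hc_fun L r ((\<Sum>c\<in>?V. const (?F c i) * ?P k c) - (\<Sum>c\<in>?V. const (?F k c) * ?P c i))"
    by (rule hc_fun_ucong[OF cpow_invariant[OF Fmat_lie[OF ki] ki]])
  also have "(\<Sum>c\<in>?V. const (?F c i) * ?P k c) = const (mixc L k i) * ?P k k"
  proof -
    have "const (?F c i) * ?P k c = (if c = k then const (mixc L k i) * ?P k k else 0)" for c
    proof (cases "k = - i")
      case True
      then show ?thesis by (auto simp: Fmat_def Emat_def mixc_def)
    next
      case False
      then have "i \<noteq> - k" by auto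
      then show ?thesis using False by (simp add: Fmat_def Emat_def mixc_def)
    qed
    then show ?thesis using ki by simp
  qed
  also have "(\<Sum>c\<in>?V. const (?F k c) * ?P c i) = const (mixc L k i) * ?P i i"
  proof -
    have "const (?F k c) * ?P c i = (if c = i then const (mixc L k i) * ?P i i else 0)" for c
    proof (cases "k = - i")
      case True
      then show ?thesis by (simp add: Fmat_def Emat_def mixc_def)
    next
      case False
      then show ?thesis by (simp add: Fmat_def Emat_def mixc_def)
    qed
    then show ?thesis using ki by simp
  qed
  finally show ?thesis by (simp add: hc_fun_diff hc_fun_const right_diff_distrib)
qed

text \<open>In the row by column product for the next power, the terms with \<open>k\<close> after \<open>i\<close> start with an element
  of \<open>n\<^sup>-\<close> and are killed, and those with \<open>k\<close> before \<open>i\<close> are computed by invariance.\<close>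

lemma hc_fun_cpow:
  assumes i: "i \<in> hatV L r"
  shows "hc_fun L r (cpow L r l i i) = tau L r l i"
  using i
proof (induction l arbitrary: i)
  case 0
  then show ?case by (simp add: hc_fun_1)
next
  case (Suc l)
  let ?V = "hatV L r" and ?P = "cpow L r l"
  let ?U = "{k \<in> ?V. pos r k < pos r i}"
  have "cpow L r (Suc l) i i = (\<Sum>k\<in>?V. (if k = i then const (y_val L r / 2) * ?P i i else 0)) + (\<Sum>k\<in>?V. gen (Fmat L k i) * ?P k i)"
    unfolding cpow.simps sum.distrib[symmetric]
    by (intro sum.cong) (auto simp: casimir_def distrib_right)
  then have "hc_fun L r (cpow L r (Suc l) i i)
      = const (y_val L r / 2) * tau L r l i + (\<Sum>k\<in>?V. hc_fun L r (gen (Fmat L k i) * ?P k i))"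
    using Suc by (simp add: hc_fun_add hc_fun_const hc_fun_sum)
  also have "(\<Sum>k\<in>?V. hc_fun L r (gen (Fmat L k i) * ?P k i))
      = (\<Sum>k\<in>?V. (if k = i then hcoord i * tau L r l i else 0)
          + (if pos r k < pos r i then const (mixc L k i) * (tau L r l k - tau L r l i) else 0))"
  proof (rule sum.cong[OF refl])
    fix k assume k: "k \<in> ?V"
    consider "pos r k < pos r i" | "pos r i < pos r k" | "k = i" using pos_inj[OF k Suc.prems] by linarith
    then show "hc_fun L r (gen (Fmat L k i) * ?P k i) = (if k = i then hcoord i * tau L r l i else 0)
          + (if pos r k < pos r i then const (mixc L k i) * (tau L r l k - tau L r l i) else 0)"
    proof cases
      case 1
      then show ?thesis using hc_fun_casimir_upper[OF k Suc.prems 1] Suc.IH[OF k] Suc.IH[OF Suc.prems] by auto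
    next
      case 2
      then show ?thesis using hc_fun_n_minus[OF Fmat_n_minus[OF k Suc.prems 2]] by auto
    next
      case 3
      then show ?thesis using hc_fun_diag[OF Suc.prems] Suc.IH[OF Suc.prems] by simp
    qed
  qed
  also have "\<dots> = hcoord i * tau L r l i + (\<Sum>k\<in>?U. const (mixc L k i) * (tau L r l k - tau L r l i))"
    using Suc.prems by (simp add: sum.distrib sum.inter_filter)
  finally show ?case by (simp add: distrib_right add.assoc)
qed

lemma pi0_series_coeff:
  assumes B: "is_lie_basis L r B" and D: "is_dual_basis L r B bstar"
  shows "pi0 L r (zV_series L r B bstar n \<oplus>\<^bsub>U L r\<^esub> lin_series L r c1 c0 n)
    = (if n \<ge> 0 then const (eps_val L) * (\<Sum>i\<in>hatV L r. tau L r (nat n) i) else 0)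
      + const (if n = - 1 then c1 else if n = 0 then c0 else 0)"
proof -
  let ?c = "if n = - 1 then c1 else if n = 0 then c0 else 0"
  have c: "hc_fun L r (const ?c) = const ?c"
    using hc_fun_const[of L r ?c 1] by (simp add: hc_fun_1)
  show ?thesis
  proof (cases "n \<ge> 0")
    case True
    obtain a where a: "a \<in> FA L r" "zV L r B bstar (nat n) = U_class L r a"
      "ucong L r a (const (eps_val L) * (\<Sum>i\<in>hatV L r. cpow L r (nat n) i i))"
      using zV_class[OF B D, of "nat n"] by blast
    have "zV_series L r B bstar n \<oplus>\<^bsub>U L r\<^esub> lin_series L r c1 c0 n = U_class L r (a + const ?c)"
      using True a(1,2) by (simp add: zV_series_def lin_series_def U_scalar_def U_class_add)
    then have "pi0 L r (zV_series L r B bstar n \<oplus>\<^bsub>U L r\<^esub> lin_series L r c1 c0 n) = hc_fun L r a + const ?c"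
      using a(1) c by (simp only: pi0_class FA_add FA_const hc_fun_add)
    also have "hc_fun L r a = const (eps_val L) * (\<Sum>i\<in>hatV L r. tau L r (nat n) i)"
      unfolding hc_fun_ucong[OF a(3)] by (simp add: hc_fun_const hc_fun_sum hc_fun_cpow)
    finally show ?thesis using True by simp
  next
    case False
    have "zV_series L r B bstar n \<oplus>\<^bsub>U L r\<^esub> lin_series L r c1 c0 n = U_class L r (0 + const ?c)"
      using False by (simp only: zV_series_def lin_series_def U_scalar_def U_class_zero U_class_add FA_0 FA_const if_False)
    then have "pi0 L r (zV_series L r B bstar n \<oplus>\<^bsub>U L r\<^esub> lin_series L r c1 c0 n) = const ?c"
      using c by (simp only: pi0_class FA_add FA_const FA_0 hc_fun_add hc_fun_0 add_0)
    then show ?thesis using False by simp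
  qed
qed

section \<open>The half-sum of positive roots\<close>

text \<open>For each pair \<open>i < j\<close> the roots \<open>\<epsilon>\<^sub>i + \<epsilon>\<^sub>j\<close> and \<open>\<epsilon>\<^sub>i - \<epsilon>\<^sub>j\<close> add up to \<open>2 \<epsilon>\<^sub>i\<close>.  The sum of the other
  positive roots has all coefficients equal to 1, 2 or 0, depending on the type.\<close>

lemma rho_eq:
  assumes k: "k \<in> {1..r}"
  shows "rho L r k = y_val L r / 2 - of_nat k + 1 / 2"
proof -
  define A where "A = Sigma {1..r} (\<lambda>i. {i<..r})"
  define pl mi :: "nat \<times> nat \<Rightarrow> weight" where
    "pl p = (\<lambda>k. epsw (fst p) k + epsw (snd p) k)" and "mi p = (\<lambda>k. epsw (fst p) k - epsw (snd p) k)" for p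
  define c :: complex where "c = (case L of SO_odd \<Rightarrow> 1 | SP \<Rightarrow> 2 | SO_even \<Rightarrow> 0)"
  define X where "X = (if L = SO_even then {} else (\<lambda>i k. c * epsw i k) ` {1..r})"
  have A: "finite A" "\<And>p. p \<in> A \<Longrightarrow> 1 \<le> fst p \<and> fst p < snd p \<and> snd p \<le> r" by (auto simp: A_def)
  have pos: "pos_roots L r = (pl ` A \<union> mi ` A) \<union> X"
  proof -
    have "pl ` A = {\<lambda>k. epsw i k + epsw j k | i j. 1 \<le> i \<and> i < j \<and> j \<le> r}"
      by (force simp: A_def pl_def image_iff)
    moreover have "mi ` A = {\<lambda>k. epsw i k - epsw j k | i j. 1 \<le> i \<and> i < j \<and> j \<le> r}"
      by (force simp: A_def mi_def image_iff)
    moreover have "X = (case L of SO_odd \<Rightarrow> {epsw i | i. 1 \<le> i \<and> i \<le> r}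
              | SP \<Rightarrow> {\<lambda>k. 2 * epsw i k | i. 1 \<le> i \<and> i \<le> r} | SO_even \<Rightarrow> {})"
      by (cases L) (auto simp: X_def c_def)
    ultimately show ?thesis by (simp only: pos_roots_def)
  qed
  \<comment> \<open>The sum of the coefficients is 2 for \<open>pl\<close>, 0 for \<open>mi\<close> and \<open>c\<close> for the remaining roots.  If
    \<open>c = 2\<close>, the first and the last kind are told apart by a coefficient 1.\<close>
  define s where "s \<alpha> = (\<Sum>k=1..r. \<alpha> k)" for \<alpha> :: weight
  have se: "s (epsw i) = 1" if "1 \<le> i" "i \<le> r" for i
    using that by (simp add: s_def epsw_def)
  have s_pl: "s (pl p) = 2" if "p \<in> A" for p
  proof -
    have "s (pl p) = s (epsw (fst p)) + s (epsw (snd p))" by (simp add: s_def pl_def sum.distrib)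
    then show ?thesis using A(2)[OF that] by (simp add: se)
  qed
  have s_mi: "s (mi p) = 0" if "p \<in> A" for p
  proof -
    have "s (mi p) = s (epsw (fst p)) - s (epsw (snd p))" by (simp add: s_def mi_def sum_subtractf)
    then show ?thesis using A(2)[OF that] by (simp add: se)
  qed
  have s_x: "s \<alpha> = c \<and> c \<noteq> 0 \<and> (\<exists>i\<in>{1..r}. \<alpha> = (\<lambda>k. c * epsw i k))" if "\<alpha> \<in> X" for \<alpha>
  proof -
    obtain i where i: "i \<in> {1..r}" "\<alpha> = (\<lambda>k. c * epsw i k)" "L \<noteq> SO_even"
      using \<open>\<alpha> \<in> X\<close> by (auto simp: X_def split: if_splits)
    have "s \<alpha> = c * s (epsw i)" by (simp add: s_def i sum_distrib_left)
    moreover have "c \<noteq> 0" using i(3) by (cases L) (auto simp: c_def)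
    ultimately show ?thesis using i se[of i] by auto
  qed
  have pl_mi: "pl ` A \<inter> mi ` A = {}"
  proof -
    have False if "p \<in> A" "q \<in> A" "pl p = mi q" for p q
      using s_pl[OF that(1)] s_mi[OF that(2)] that(3) by simp
    then show ?thesis by blast
  qed
  have pm_X: "(pl ` A \<union> mi ` A) \<inter> X = {}"
  proof -
    have False if p: "p \<in> A" and x: "pl p \<in> X" for p
    proof -
      obtain i where i: "pl p = (\<lambda>k. c * epsw i k)" using s_x[OF x] by auto
      have c2: "c = 2" using s_x[OF x] s_pl[OF p] by simp
      have "pl p (fst p) = 1" using A(2)[OF p] by (simp add: pl_def epsw_def)
      then show False unfolding i c2 by (simp add: epsw_def split: if_splits)
    qed
    moreover have False if p: "p \<in> A" and x: "mi p \<in> X" for p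
    proof -
      have "s (mi p) = c" "c \<noteq> 0" using s_x[OF x] by blast+
      then show False using s_mi[OF p] by simp
    qed
    ultimately show ?thesis by blast
  qed
  have inj_pl: "inj_on pl A"
  proof (rule inj_onI)
    fix p q assume p: "p \<in> A" and q: "q \<in> A" and e: "pl p = pl q"
    have "fst p = fst q \<or> fst p = snd q"
      using fun_cong[OF e, of "fst p"] A(2)[OF p] by (simp add: pl_def epsw_def split: if_splits)
    moreover have "snd p = fst q \<or> snd p = snd q"
      using fun_cong[OF e, of "snd p"] A(2)[OF p] by (simp add: pl_def epsw_def split: if_splits)
    ultimately show "p = q" using A(2)[OF p] A(2)[OF q] by (auto simp: prod_eq_iff)
  qed
  have inj_mi: "inj_on mi A"
  proof (rule inj_onI)
    fix p q assume p: "p \<in> A" and q: "q \<in> A" and e: "mi p = mi q"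
    have "fst p = fst q"
      using fun_cong[OF e, of "fst p"] A(2)[OF p] by (simp add: mi_def epsw_def split: if_splits)
    moreover have "snd p = snd q"
      using fun_cong[OF e, of "snd p"] A(2)[OF p] by (simp add: mi_def epsw_def split: if_splits)
    ultimately show "p = q" by (simp add: prod_eq_iff)
  qed
  have "finite X" by (simp add: X_def)
  then have "(\<Sum>\<alpha>\<in>pos_roots L r. \<alpha> k) = (\<Sum>\<alpha>\<in>pl ` A. \<alpha> k) + (\<Sum>\<alpha>\<in>mi ` A. \<alpha> k) + (\<Sum>\<alpha>\<in>X. \<alpha> k)"
    unfolding pos using A(1) pl_mi pm_X by (simp add: sum.union_disjoint)
  also have "(\<Sum>\<alpha>\<in>pl ` A. \<alpha> k) = (\<Sum>p\<in>A. pl p k)" by (simp add: sum.reindex[OF inj_pl])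
  also have "(\<Sum>\<alpha>\<in>mi ` A. \<alpha> k) = (\<Sum>p\<in>A. mi p k)" by (simp add: sum.reindex[OF inj_mi])
  also have "(\<Sum>p\<in>A. pl p k) + (\<Sum>p\<in>A. mi p k) = (\<Sum>p\<in>A. 2 * epsw (fst p) k)"
    by (simp add: sum.distrib[symmetric] pl_def mi_def)
  also have "\<dots> = (\<Sum>i=1..r. \<Sum>j\<in>{i<..r}. 2 * epsw i k)"
    unfolding A_def by (subst sum.Sigma) (auto simp: case_prod_unfold)
  also have "\<dots> = (\<Sum>i=1..r. if i = k then 2 * of_nat (r - k) else 0)"
    by (intro sum.cong) (auto simp: epsw_def)
  also have "\<dots> = 2 * of_nat (r - k)" using k by simp
  also have "(\<Sum>\<alpha>\<in>X. \<alpha> k) = c"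
  proof (cases "L = SO_even")
    case True
    then show ?thesis by (simp add: X_def c_def)
  next
    case False
    then have c0: "c \<noteq> 0" by (cases L) (auto simp: c_def)
    have "inj_on (\<lambda>i k. c * epsw i k) {1..r}"
    proof (rule inj_onI)
      fix i j assume "(\<lambda>k. c * epsw i k) = (\<lambda>k. c * epsw j k)"
      from fun_cong[OF this, of i] c0 show "i = j" by (simp add: epsw_def split: if_splits)
    qed
    then have "(\<Sum>\<alpha>\<in>X. \<alpha> k) = (\<Sum>i=1..r. c * epsw i k)"
      using False by (simp add: X_def sum.reindex)
    also have "\<dots> = (\<Sum>i=1..r. if i = k then c else 0)" by (intro sum.cong) (auto simp: epsw_def)
    finally show ?thesis using k by simp
  qed
  finally have "rho L r k = (2 * of_nat (r - k) + c) / 2" by (simp add: rho_def)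
  moreover have "2 * of_nat (r - k) + c = y_val L r - 2 * of_nat k + 1"
    using k by (cases L) (simp_all add: c_def y_val_def of_nat_diff)
  ultimately show ?thesis by (simp add: diff_divide_distrib add_divide_distrib)
qed

section \<open>The shift automorphism\<close>

abbreviation rho_sub :: "lie_kind \<Rightarrow> nat \<Rightarrow> nat \<Rightarrow> hpoly" where
  "rho_sub L r i \<equiv> hvar i + const (weight_form r (rho L r) (epsw i))"

lemma sigma_rho_eq:
  "sigma_rho L r = lext const (\<lambda>m. \<Prod>i\<in>Poly_Mapping.keys m. rho_sub L r i ^ Poly_Mapping.lookup m i)"
  by (rule ext) (simp add: sigma_rho_def lext_def)

lemma sigma_rho_0 [simp]: "sigma_rho L r 0 = 0"
  by (simp add: sigma_rho_eq)

lemma sigma_rho_add: "sigma_rho L r (p + q) = sigma_rho L r p + sigma_rho L r q"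
  unfolding sigma_rho_eq by (rule lext_add) (simp_all add: const_add)

lemma sigma_rho_uminus: "sigma_rho L r (- p) = - sigma_rho L r p"
proof -
  have "sigma_rho L r (- p) + sigma_rho L r p = 0"
    by (simp flip: sigma_rho_add)
  then show ?thesis by (rule eq_neg_iff_add_eq_0[THEN iffD2])
qed

lemma sigma_rho_diff: "sigma_rho L r (p - q) = sigma_rho L r p - sigma_rho L r q"
  using sigma_rho_add[of L r p "- q"] by (simp add: sigma_rho_uminus)

lemma sigma_rho_single:
  assumes "finite A" "Poly_Mapping.keys m \<subseteq> A"
  shows "sigma_rho L r (Poly_Mapping.single m c) = const c * (\<Prod>i\<in>A. rho_sub L r i ^ Poly_Mapping.lookup m i)"
proof -
  have "(\<Prod>i\<in>Poly_Mapping.keys m. rho_sub L r i ^ Poly_Mapping.lookup m i)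
      = (\<Prod>i\<in>A. rho_sub L r i ^ Poly_Mapping.lookup m i)"
    using assms by (intro prod.mono_neutral_left) (auto simp: in_keys_iff)
  then show ?thesis by (simp add: sigma_rho_eq lext_single)
qed

lemma sigma_rho_mult: "sigma_rho L r (p * q) = sigma_rho L r p * sigma_rho L r q"
proof (induction p rule: poly_mapping_induct)
  case (single m c)
  show ?case
  proof (induction q rule: poly_mapping_induct)
    case (single n d)
    let ?A = "Poly_Mapping.keys m \<union> Poly_Mapping.keys n"
    have "Poly_Mapping.keys (m + n) \<subseteq> ?A" by (rule Poly_Mapping.keys_add)
    then have "sigma_rho L r (Poly_Mapping.single (m + n) (c * d))
        = const (c * d) * (\<Prod>i\<in>?A. rho_sub L r i ^ Poly_Mapping.lookup (m + n) i)"
      by (intro sigma_rho_single) auto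
    also have "(\<Prod>i\<in>?A. rho_sub L r i ^ Poly_Mapping.lookup (m + n) i)
        = (\<Prod>i\<in>?A. rho_sub L r i ^ Poly_Mapping.lookup m i) * (\<Prod>i\<in>?A. rho_sub L r i ^ Poly_Mapping.lookup n i)"
      by (simp only: lookup_add power_add prod.distrib)
    finally show ?case
      using sigma_rho_single[of ?A m L r c] sigma_rho_single[of ?A n L r d]
      by (simp add: mult_single const_mult mult_ac)
  qed (simp_all add: distrib_left sigma_rho_add)
qed (simp_all add: distrib_right sigma_rho_add)

lemma sigma_rho_const: "sigma_rho L r (const c) = const c"
  using sigma_rho_single[of "{}" 0 L r c] by (simp add: const_def)

lemma sigma_rho_hvar:
  assumes i: "i \<in> {1..r}"
  shows "sigma_rho L r (hvar i) = hvar i + const (y_val L r / 2 - of_nat i + 1 / 2)"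
proof -
  have "sigma_rho L r (hvar i) = rho_sub L r i"
    unfolding hvar_def by (subst sigma_rho_single[of "{i}"]) (auto simp: hvar_def)
  moreover have "weight_form r (rho L r) (epsw i) = rho L r i"
    using i by (simp add: weight_form_def epsw_def if_distrib[where f = "\<lambda>t. _ * t"] cong: if_cong)
  ultimately show ?thesis using rho_eq[OF i] by simp
qed

section \<open>Division by monic linear series\<close>

lemma monic_right_inverse:
  "(u + fls_const p) * fls_right_inverse (u + fls_const p) 1 = (1 :: hpoly fls)"
proof (rule fls_right_inverse)
  have "fls_subdegree (u + fls_const p) = - 1"
    by (rule fls_subdegree_eqI) auto
  then show "fls_nth (u + fls_const p) (fls_subdegree (u + fls_const p)) * 1 = (1 :: hpoly)"
    by simp
qed

lemma eq_mult_inverse_iff: "w * v = (1::'a::comm_ring_1) \<Longrightarrow> f = g * v \<longleftrightarrow> f * w = g"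
  by (metis mult.assoc mult.commute mult.right_neutral)

lemma monic_div_eq_iff: "f = monic_div g (u + fls_const p) \<longleftrightarrow> f * (u + fls_const p) = g"
  unfolding monic_div_def by (rule eq_mult_inverse_iff[OF monic_right_inverse])

lemma monic_div_mult: "x * monic_div g (u + fls_const p) = monic_div (x * g) (u + fls_const p)"
  by (simp add: monic_div_def mult.assoc)

lemma sigma_rho_series_nth: "fls_nth (sigma_rho_series L r f) n = sigma_rho L r (fls_nth f n)"
  unfolding sigma_rho_series_def
  by (rule nth_Abs_fls_ex_lower_bound) (intro exI[of _ "fls_subdegree f"], auto)

lemma sigma_rho_series_mult_linear:
  "sigma_rho_series L r (f * (u + fls_const p)) = sigma_rho_series L r f * (u + fls_const (sigma_rho L r p))"
  by (rule fls_eqI)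
     (simp add: sigma_rho_series_nth distrib_left fls_X_inv_times_conv_shift sigma_rho_add sigma_rho_mult)

text \<open>The expansion of a quotient is determined by its product with the denominator, and multiplication by
  a linear series only involves two neighbouring coefficients.\<close>

lemma sigma_rho_series_monic_div:
  "sigma_rho_series L r (f * monic_div (u + fls_const p) (u + fls_const q))
    = sigma_rho_series L r f * monic_div (u + fls_const (sigma_rho L r p)) (u + fls_const (sigma_rho L r q))"
proof -
  have "f * monic_div (u + fls_const p) (u + fls_const q) * (u + fls_const q) = f * (u + fls_const p)"
    unfolding monic_div_mult using monic_div_eq_iff by blast
  from arg_cong[OF this, of "sigma_rho_series L r"]
  show ?thesis unfolding sigma_rho_series_mult_linear monic_div_mult monic_div_eq_iff .
qed

lemma sigma_rho_series_1: "sigma_rho_series L r 1 = 1"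
  using sigma_rho_const[of L r 1] by (intro fls_eqI) (simp add: sigma_rho_series_nth)

section \<open>Solving the recursion\<close>

text \<open>The projected diagonal entry at \<open>i\<close> of the resolvent of \<open>y/2 + \<gamma>\<close>.  The exponent of \<open>u\<^sup>-\<^sup>1\<close> is one
  more than the power of the matrix.\<close>

definition tser :: "lie_kind \<Rightarrow> nat \<Rightarrow> int \<Rightarrow> hpoly fls" where
  "tser L r i = Abs_fls (\<lambda>n. if n \<ge> 1 then tau L r (nat (n - 1)) i else 0)"

lemma tser_nth: "fls_nth (tser L r i) n = (if n \<ge> 1 then tau L r (nat (n - 1)) i else 0)"
  unfolding tser_def by (rule nth_Abs_fls_ex_lower_bound) (intro exI[of _ 0], auto)

definition before :: "lie_kind \<Rightarrow> nat \<Rightarrow> int \<Rightarrow> int set" where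
  "before L r i = {k \<in> hatV L r. pos r k < pos r i}"

lemma tser_rec:
  "u * tser L r i = 1 + (hc (y_val L r / 2) + fls_const (hcoord i)) * tser L r i
     + (\<Sum>k\<in>before L r i. hc (mixc L k i) * (tser L r k - tser L r i))"
proof (rule fls_eqI)
  fix n
  have c: "(hc (y_val L r / 2) + fls_const (hcoord i)) * tser L r i
      = fls_const (const (y_val L r / 2) + hcoord i) * tser L r i"
    by (simp add: hc_def fls_plus_const)
  consider "n < 0" | "n = 0" | l where "n = int (Suc l)"
  proof -
    have "n = int (Suc (nat (n - 1)))" if "n > 0" using that by simp
    then show ?thesis using that by (metis linorder_neqE)
  qed
  then show "fls_nth (u * tser L r i) n = fls_nth (1 + (hc (y_val L r / 2) + fls_const (hcoord i)) * tser L r i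
     + (\<Sum>k\<in>before L r i. hc (mixc L k i) * (tser L r k - tser L r i))) n"
    unfolding c
    by cases (simp_all add: fls_X_inv_times_conv_shift tser_nth fls_nth_sum hc_def before_def nat_add_distrib)
qed

lemma hatV_split:
  "hatV L r = int ` {1..r} \<union> (if L = SO_odd then {0} else {}) \<union> (\<lambda>k. - int k) ` {1..r}"
proof (intro equalityI subsetI)
  fix i assume i: "i \<in> hatV L r"
  consider "i > 0" | "i = 0" | "i < 0" by linarith
  then show "i \<in> int ` {1..r} \<union> (if L = SO_odd then {0} else {}) \<union> (\<lambda>k. - int k) ` {1..r}"
  proof cases
    case 1
    then have "i = int (nat i)" "nat i \<in> {1..r}" using i by (auto simp: hatV_def split: if_splits)
    then show ?thesis by blast
  next
    case 2
    then show ?thesis using i by (auto simp: hatV_def split: if_splits)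
  next
    case 3
    then have "i = - int (nat (- i))" "nat (- i) \<in> {1..r}" using i by (auto simp: hatV_def split: if_splits)
    then show ?thesis by blast
  qed
qed (auto simp: hatV_def split: if_splits)

lemma before_pos: "1 \<le> j \<Longrightarrow> j \<le> r \<Longrightarrow> before L r (int j) = int ` {1..j - 1}"
  unfolding before_def hatV_split by (auto simp: pos_def split: if_splits)

lemma before_zero: "before L r 0 = int ` {1..r}"
  unfolding before_def hatV_split by (auto simp: pos_def split: if_splits)

lemma before_neg: "1 \<le> j \<Longrightarrow> j \<le> r \<Longrightarrow>
  before L r (- int j) = int ` {1..r} \<union> (if L = SO_odd then {0} else {}) \<union> (\<lambda>k. - int k) ` {Suc j..r}"
  unfolding before_def hatV_split by (auto simp: pos_def split: if_splits)

lemma sum_signed: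
  "(\<Sum>k\<in>int ` {1..n} \<union> (if L = SO_odd then {0} else {}) \<union> (\<lambda>k. - int k) ` {m..r}. f k)
    = (\<Sum>k=1..n. f (int k)) + (if L = SO_odd then f 0 else 0) + (\<Sum>k=m..r. f (- int k))"
  if "1 \<le> m" for f :: "int \<Rightarrow> 'a::comm_monoid_add"
proof -
  have i: "inj_on int {1..n}" "inj_on (\<lambda>k. - int k) {m..r}" by (auto simp: inj_on_def)
  have "(\<Sum>k\<in>(int ` {1..n} \<union> (if L = SO_odd then {0} else {})) \<union> (\<lambda>k. - int k) ` {m..r}. f k)
     = (\<Sum>k\<in>int ` {1..n} \<union> (if L = SO_odd then {0} else {}). f k) + (\<Sum>k\<in>(\<lambda>k. - int k) ` {m..r}. f k)"
    using that by (intro sum.union_disjoint) auto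
  also have "(\<Sum>k\<in>int ` {1..n} \<union> (if L = SO_odd then {0} else {}). f k)
     = (\<Sum>k\<in>int ` {1..n}. f k) + (\<Sum>k\<in>(if L = SO_odd then {0} else {}). f k)"
    by (intro sum.union_disjoint) auto
  finally show ?thesis by (simp add: sum.reindex i)
qed

text \<open>The partial sums of the trace of the resolvent along the order of the basis, increased by 1:
  \<open>Pser L r n\<close> ends with the index \<open>n\<close>, and \<open>Qser L r j\<close> with the index \<open>-j\<close>.\<close>

definition Pser :: "lie_kind \<Rightarrow> nat \<Rightarrow> nat \<Rightarrow> hpoly fls" where
  "Pser L r n = 1 + (\<Sum>k=1..n. tser L r (int k))"

definition Qser :: "lie_kind \<Rightarrow> nat \<Rightarrow> nat \<Rightarrow> hpoly fls" where
  "Qser L r j = Pser L r r + (if L = SO_odd then tser L r 0 else 0) + (\<Sum>k=j..r. tser L r (- int k))"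

lemma fls_const_uminus: "- fls_const c = fls_const (- c :: 'a::group_add)"
  by (rule fls_eqI) simp

lemma hc_add: "hc a + hc b = hc (a + b)"
  by (simp only: hc_def fls_plus_const const_add)
lemma hc_diff: "hc a - hc b = hc (a - b)"
  by (simp only: hc_def fls_minus_const const_diff)
lemma hc_uminus: "- hc a = hc (- a)"
  by (simp only: hc_def fls_const_uminus const_minus)
lemma hc_mult: "hc a * hc b = hc (a * b)"
  by (simp only: hc_def fls_const_mult_const const_mult)
lemma hc_0: "hc 0 = 0"
  by (simp add: hc_def)
lemma hc_1: "hc 1 = 1"
  by (simp add: hc_def)
lemma hc_of_nat: "of_nat n = hc (of_nat n)"
  by (simp only: hc_def const_of_nat fls_of_nat)

text \<open>The coordinate \<open>l\<^sub>j = h\<^sub>j + \<rho>\<^sub>j\<close> of the shifted weight.\<close>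

abbreviation lser :: "lie_kind \<Rightarrow> nat \<Rightarrow> nat \<Rightarrow> hpoly fls" where
  "lser L r j \<equiv> fls_const (sigma_rho L r (hvar j))"

lemma lser_eq:
  assumes "j \<in> {1..r}"
  shows "lser L r j = hv j + hc (y_val L r / 2) - of_nat j + hc (1 / 2)"
  unfolding sigma_rho_hvar[OF assms] hc_of_nat hv_def hc_def fls_plus_const fls_minus_const
  by (rule arg_cong[where f = fls_const]) (simp add: const_add const_diff)

text \<open>Before \<open>j\<close> there are \<open>j - 1\<close> indices, all with coefficient 1.  The recursion reads
  \<open>(u - y/2 - h\<^sub>j + j - 1) t\<^sub>j = P\<^sub>j\<^sub>-\<^sub>1\<close>, and the constants combine to \<open>-l\<^sub>j - 1/2\<close>.\<close>

lemma Pser_step: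
  assumes j: "j \<in> {1..r}"
  shows "(u - lser L r j - hc (1 / 2)) * Pser L r j = (u - lser L r j + hc (1 / 2)) * Pser L r (j - 1)"
proof -
  let ?t = "\<lambda>k. tser L r (int k)"
  have m: "mixc L (int k) (int j) = 1" for k using j by (simp add: mixc_def)
  have "(\<Sum>k\<in>before L r (int j). hc (mixc L k (int j)) * (tser L r k - ?t j)) = (\<Sum>k=1..j - 1. ?t k - ?t j)"
    using j by (subst before_pos) (auto simp: sum.reindex m hc_1)
  then have "u * ?t j = 1 + (hc (y_val L r / 2) + hv j) * ?t j + ((\<Sum>k=1..j - 1. ?t k) - of_nat (j - 1) * ?t j)"
    using tser_rec[of L r "int j"] j by (simp add: hcoord_def hv_def sum_subtractf)
  then have a: "(u - hc (y_val L r / 2) - hv j + of_nat (j - 1)) * ?t j = Pser L r (j - 1)"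
    by (simp add: Pser_def algebra_simps)
  have "hc (1 / 2) + hc (1 / 2) = 1" by (simp add: hc_add hc_1)
  moreover have "of_nat (j - 1) = (of_nat j - 1 :: hpoly fls)" using j by (simp add: of_nat_diff)
  ultimately have l: "u - hc (y_val L r / 2) - hv j + of_nat (j - 1) = u - lser L r j - hc (1 / 2)"
    unfolding lser_eq[OF j] by (simp add: algebra_simps)
  have P: "Pser L r j = Pser L r (j - 1) + ?t j"
    using j by (cases j) (auto simp: Pser_def)
  have "(u - lser L r j - hc (1 / 2)) * Pser L r j
      = (u - lser L r j - hc (1 / 2)) * Pser L r (j - 1) + Pser L r (j - 1)"
    unfolding P distrib_left a[unfolded l] ..
  also have "\<dots> = (u - lser L r j - hc (1 / 2) + (hc (1 / 2) + hc (1 / 2))) * Pser L r (j - 1)"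
    unfolding \<open>hc (1 / 2) + hc (1 / 2) = 1\<close> by (simp add: distrib_right)
  finally show ?thesis by (simp add: algebra_simps)
qed

lemma Qser_middle: "L = SO_odd \<Longrightarrow> u * Qser L r (Suc r) = (u + 1) * Pser L r r"
proof -
  assume L: "L = SO_odd"
  have "(\<Sum>k\<in>before L r 0. hc (mixc L k 0) * (tser L r k - tser L r 0)) = (\<Sum>k=1..r. tser L r (int k) - tser L r 0)"
    unfolding before_zero by (simp add: sum.reindex mixc_def hc_1)
  then have "u * tser L r 0 = 1 + hc (y_val L r / 2) * tser L r 0 + ((\<Sum>k=1..r. tser L r (int k)) - of_nat r * tser L r 0)"
    using tser_rec[of L r 0] by (simp add: hcoord_def sum_subtractf)
  also have "hc (y_val L r / 2) = of_nat r" using L by (simp add: y_val_def hc_of_nat)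
  finally have "u * tser L r 0 = Pser L r r" by (simp add: Pser_def)
  then show ?thesis using L by (simp add: Qser_def distrib_left distrib_right)
qed

text \<open>The index \<open>j\<close> is the only one before \<open>-j\<close> with a coefficient other than 1, namely \<open>1 - \<epsilon>\<close>.  It
  causes the term with \<open>P\<^sub>j - P\<^sub>j\<^sub>-\<^sub>1 = t\<^sub>j\<close>.  The number of indices before \<open>-j\<close>, less \<open>\<epsilon>\<close>, is
  \<open>y - j\<close> in each of the three types.\<close>

lemma Qser_step:
  assumes j: "j \<in> {1..r}"
  shows "(u + lser L r j - hc (1 / 2)) * (Qser L r j - Qser L r (Suc j))
    = Qser L r (Suc j) - hc (eps_val L) * (Pser L r j - Pser L r (j - 1))"
proof -
  let ?t = "tser L r" and ?j = "- int j"
  define od :: complex where "od = (if L = SO_odd then 1 else 0)"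
  have th: "theta L (int j) ?j = eps_val L" using j by (cases L) (auto simp: theta_def eps_val_def)
  have m: "mixc L (int k) ?j = 1 - (if k = j then eps_val L else 0)" for k using th by (auto simp: mixc_def)
  have m0: "mixc L 0 ?j = 1" using j by (simp add: mixc_def)
  have mm: "mixc L (- int k) ?j = 1" for k using j by (simp add: mixc_def)
  have "(\<Sum>k\<in>before L r ?j. hc (mixc L k ?j) * (?t k - ?t ?j))
    = (\<Sum>k=1..r. hc (mixc L (int k) ?j) * (?t (int k) - ?t ?j)) + (if L = SO_odd then ?t 0 - ?t ?j else 0)
      + (\<Sum>k=Suc j..r. ?t (- int k) - ?t ?j)"
  proof -
    have b: "before L r ?j = int ` {1..r} \<union> (if L = SO_odd then {0} else {}) \<union> (\<lambda>k. - int k) ` {Suc j..r}"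
      by (rule before_neg) (use j in auto)
    have "1 \<le> Suc j" by simp
    then show ?thesis unfolding b by (simp only: sum_signed m0 mm hc_1 mult_1)
  qed
  also have "(\<Sum>k=1..r. hc (mixc L (int k) ?j) * (?t (int k) - ?t ?j))
    = (\<Sum>k=1..r. (?t (int k) - ?t ?j) - (if k = j then hc (eps_val L) * (?t (int j) - ?t ?j) else 0))"
    by (intro sum.cong refl) (simp add: m hc_0 hc_1 left_diff_distrib flip: hc_diff)
  also have "\<dots> = (\<Sum>k=1..r. ?t (int k)) - of_nat r * ?t ?j - hc (eps_val L) * (?t (int j) - ?t ?j)"
    using j by (simp add: sum_subtractf)
  also have "(if L = SO_odd then ?t 0 - ?t ?j else 0) = (if L = SO_odd then ?t 0 else 0) - hc od * ?t ?j"
    by (simp add: od_def hc_1 hc_0)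
  also have "(\<Sum>k=Suc j..r. ?t (- int k) - ?t ?j) = (\<Sum>k=Suc j..r. ?t (- int k)) - of_nat (r - j) * ?t ?j"
    by (simp add: sum_subtractf)
  finally have "u * ?t ?j = 1 + (hc (y_val L r / 2) - hv j) * ?t ?j
     + ((\<Sum>k=1..r. ?t (int k)) - of_nat r * ?t ?j - hc (eps_val L) * (?t (int j) - ?t ?j)
     + ((if L = SO_odd then ?t 0 else 0) - hc od * ?t ?j) + ((\<Sum>k=Suc j..r. ?t (- int k)) - of_nat (r - j) * ?t ?j))"
    using tser_rec[of L r ?j] j by (simp add: hcoord_def hv_def)
  then have a: "(u - hc (y_val L r / 2) + hv j + of_nat r + hc od + of_nat (r - j) - hc (eps_val L)) * ?t ?j
     = Qser L r (Suc j) - hc (eps_val L) * ?t (int j)"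
    by (simp add: Qser_def Pser_def algebra_simps)
  have l: "u - hc (y_val L r / 2) + hv j + of_nat r + hc od + of_nat (r - j) - hc (eps_val L) = u + lser L r j - hc (1 / 2)"
  proof -
    have "hc (of_nat r + od + of_nat (r - j) - eps_val L) = hc (y_val L r - of_nat j)"
      using j by (intro arg_cong[where f = hc], cases L) (simp_all add: od_def eps_val_def y_val_def of_nat_diff)
    then have "of_nat r + hc od + of_nat (r - j) - hc (eps_val L) = hc (y_val L r / 2) + hc (y_val L r / 2) - of_nat j"
      unfolding hc_of_nat hc_add hc_diff by simp
    then show ?thesis unfolding lser_eq[OF j] by (simp add: algebra_simps)
  qed
  have Q: "Qser L r j - Qser L r (Suc j) = ?t ?j"
    using j by (simp add: Qser_def sum.atLeast_Suc_atMost)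
  have P: "Pser L r j - Pser L r (j - 1) = ?t (int j)"
    using j by (cases j) (auto simp: Pser_def)
  show ?thesis unfolding Q P using a unfolding l .
qed

text \<open>In this combination the coupled recursions for \<open>P\<close> and \<open>Q\<close> become a single multiplicative one.
  At \<open>j = 0\<close> it is the projection of \<open>z\<^sub>V(u) + \<epsilon> u - 1/2\<close>.\<close>

definition Yser :: "lie_kind \<Rightarrow> nat \<Rightarrow> nat \<Rightarrow> hpoly fls" where
  "Yser L r j = hc (eps_val L) * u * Qser L r (Suc j) - hc (1 / 2) * Pser L r j"

lemma Yser_step:
  assumes j: "j \<in> {1..r}"
  shows "(u + lser L r j - hc (1 / 2)) * Yser L r (j - 1) = (u + lser L r j + hc (1 / 2)) * Yser L r j"
proof -
  define e h l P P' Q Q' where "e = hc (eps_val L)" and "h = hc (1 / 2)" and "l = lser L r j"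
    and "P = Pser L r j" and "P' = Pser L r (j - 1)" and "Q = Qser L r j" and "Q' = Qser L r (Suc j)"
  \<comment> \<open>The recursion for \<open>Q\<close> brings in \<open>e P\<close>, and \<open>e\<^sup>2 = 1 = 2 h\<close> is what makes the coefficients match.\<close>
  have e: "e * e = 1" by (cases L) (simp_all add: e_def hc_mult eps_val_def hc_1)
  have h: "h + h = 1" by (simp add: h_def hc_add hc_1)
  have p: "(u - l - h) * P = (u - l + h) * P'"
    unfolding h_def l_def P_def P'_def by (rule Pser_step[OF j])
  have q: "(u + l - h) * (Q - Q') = Q' - e * (P - P')"
    unfolding h_def l_def P_def P'_def Q_def Q'_def e_def by (rule Qser_step[OF j])
  have "(u + l - h) * (e * u * Q - h * P') - (u + l + h) * (e * u * Q' - h * P)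
      = e * u * ((u + l - h) * (Q - Q')) - (h + h) * (e * u * Q') + h * ((u + l + h) * P - (u + l - h) * P')"
    by (simp add: algebra_simps)
  also have "\<dots> = - ((e * e) * u * (P - P')) + h * ((u + l + h) * P - (u + l - h) * P')"
    unfolding q h by (simp add: algebra_simps)
  also have "\<dots> = - ((h + h) * u * (P - P')) + h * ((u + l + h) * P - (u + l - h) * P')"
    unfolding e h ..
  also have "\<dots> = h * ((u - l + h) * P' - (u - l - h) * P)"
    by (simp add: algebra_simps)
  also have "\<dots> = 0" unfolding p by simp
  finally have "(u + l - h) * (e * u * Q - h * P') = (u + l + h) * (e * u * Q' - h * P)" by simp
  then show ?thesis using j by (simp add: Yser_def e_def h_def l_def P_def P'_def Q_def Q'_def)
qed

abbreviation factor_minus :: "lie_kind \<Rightarrow> nat \<Rightarrow> nat \<Rightarrow> hpoly fls" where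
  "factor_minus L r i \<equiv> monic_div (u - lser L r i + hc (1 / 2)) (u - lser L r i - hc (1 / 2))"

abbreviation factor_plus :: "lie_kind \<Rightarrow> nat \<Rightarrow> nat \<Rightarrow> hpoly fls" where
  "factor_plus L r i \<equiv> monic_div (u + lser L r i + hc (1 / 2)) (u + lser L r i - hc (1 / 2))"

lemma linear_forms:
  "u + fls_const p + hc c = u + fls_const (p + const c)"
  "u + fls_const p - hc c = u + fls_const (p - const c)"
  "u - fls_const p + hc c = u + fls_const (- p + const c)"
  "u - fls_const p - hc c = u + fls_const (- p - const c)"
  unfolding hc_def fls_plus_const[symmetric] fls_minus_const[symmetric] fls_const_uminus[symmetric]
  by (simp_all only: add.assoc add_diff_eq diff_conv_add_uminus)

lemma Pser_prod: "n \<le> r \<Longrightarrow> Pser L r n = (\<Prod>i=1..n. factor_minus L r i)"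
proof (induction n)
  case 0
  then show ?case by (simp add: Pser_def)
next
  case (Suc n)
  have "Pser L r (Suc n) = Pser L r n * factor_minus L r (Suc n)"
    using Pser_step[of "Suc n" r L] Suc.prems
    unfolding monic_div_mult linear_forms monic_div_eq_iff by (simp add: mult.commute)
  then show ?case using Suc by simp
qed

lemma Yser_prod: "n \<le> r \<Longrightarrow> Yser L r 0 = (\<Prod>i=1..n. factor_plus L r i) * Yser L r n"
proof (induction n)
  case (Suc n)
  have "Yser L r n = Yser L r (Suc n) * factor_plus L r (Suc n)"
    using Yser_step[of "Suc n" r L] Suc.prems
    unfolding monic_div_mult linear_forms monic_div_eq_iff by (simp add: mult.commute)
  then show ?case using Suc by (simp add: mult_ac)
qed simp

text \<open>Between the positive and the negative indices the three types differ: only the odd orthogonal one has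
  the index 0 there.  In the others \<open>y/2 - r\<close> is \<open>1/2\<close> or \<open>-1/2\<close>, and the quotient changes the
  factor \<open>\<epsilon> u + 1/2\<close> to \<open>\<epsilon> u - 1/2\<close>.\<close>

lemma Yser_middle:
  "Yser L r r = (hc (eps_val L) * u + hc (1 / 2)) *
    monic_div (u + hc (y_val L r / 2) - hc (of_nat r)) (u - hc (y_val L r / 2) + hc (of_nat r)) * Pser L r r"
proof -
  have d: "u + hc (y_val L r / 2) - hc (of_nat r) = u + hc (y_val L r / 2 - of_nat r)"
    "u - hc (y_val L r / 2) + hc (of_nat r) = u + hc (of_nat r - y_val L r / 2)"
    by (simp_all flip: hc_diff)
  have "(hc (eps_val L) * u + hc (1 / 2)) * monic_div (u + hc (y_val L r / 2 - of_nat r)) (u + hc (of_nat r - y_val L r / 2))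
    = hc (eps_val L) * u + (if L = SO_odd then 1 else 0) - hc (1 / 2)"
  proof -
    have h: "hc (1 / 2) + hc (1 / 2) = 1" "hc (- 1 / 2) = - hc (1 / 2)" "hc (- 1) = - 1"
      using hc_add[of "1 / 2" "1 / 2"] hc_uminus[of "1 / 2"] hc_uminus[of 1] by (simp_all add: hc_1)
    have "(hc (eps_val L) * u + (if L = SO_odd then 1 else 0) - hc (1 / 2)) * (u + hc (of_nat r - y_val L r / 2))
       = (hc (eps_val L) * u + hc (1 / 2)) * (u + hc (y_val L r / 2 - of_nat r))"
    proof (cases L)
      case SO_odd
      have "1 - hc (1 / 2) = hc (1 / 2)" using h(1) by (simp add: algebra_simps)
      then show ?thesis using SO_odd by (simp add: y_val_def eps_val_def hc_0 hc_1 add_diff_eq[symmetric])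
    next
      case SP
      have y: "of_nat r - y_val L r / 2 = - 1 / 2" "y_val L r / 2 - of_nat r = 1 / 2"
        using SP by (simp_all add: y_val_def add_divide_distrib)
      have e: "hc (eps_val L) = - 1" using SP h(3) by (simp add: eps_val_def)
      show ?thesis unfolding y e h(2) using SP by (simp add: algebra_simps)
    next
      case SO_even
      have y: "of_nat r - y_val L r / 2 = 1 / 2" "y_val L r / 2 - of_nat r = - 1 / 2"
        using SO_even by (simp_all add: y_val_def diff_divide_distrib)
      have e: "hc (eps_val L) = 1" using SO_even by (simp add: eps_val_def hc_1)
      show ?thesis unfolding y e h(2) using SO_even by (simp add: algebra_simps)
    qed
    then show ?thesis
      unfolding monic_div_mult hc_def[of "of_nat r - y_val L r / 2"]
      by (intro monic_div_eq_iff[THEN iffD2, symmetric]) 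
  qed
  moreover have "Yser L r r = (hc (eps_val L) * u + (if L = SO_odd then 1 else 0) - hc (1 / 2)) * Pser L r r"
  proof (cases "L = SO_odd")
    case True
    then have "hc (eps_val L) = 1" by (simp add: eps_val_def hc_1)
    then show ?thesis using Qser_middle[OF True, of r] True by (simp add: Yser_def algebra_simps)
  next
    case False
    then show ?thesis by (simp add: Yser_def Qser_def algebra_simps)
  qed
  ultimately show ?thesis unfolding d by simp
qed

lemma sigma_rho_series_prod:
  assumes "n \<le> r"
  shows "sigma_rho_series L r (\<Prod>i=1..n. monic_div (u + hv i + hc (1 / 2)) (u + hv i - hc (1 / 2)) *
      monic_div (u - hv i + hc (1 / 2)) (u - hv i - hc (1 / 2)))
    = (\<Prod>i=1..n. factor_plus L r i * factor_minus L r i)"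
  using assms
proof (induction n)
  case 0
  then show ?case by (simp add: sigma_rho_series_1)
next
  case (Suc n)
  then show ?case
    unfolding hv_def linear_forms
    by (simp add: mult.assoc[symmetric] sigma_rho_series_monic_div sigma_rho_add sigma_rho_diff
        sigma_rho_uminus sigma_rho_const)
qed

theorem theorem3p3:
  fixes L :: lie_kind and r :: nat and B :: "cmat set" and bstar :: "cmat \<Rightarrow> cmat"
  assumes "r \<ge> 1"
    and "is_lie_basis L r B"
    and "is_dual_basis L r B bstar"
  shows "pi0_series L r (\<lambda>n. zV_series L r B bstar n \<oplus>\<^bsub>U L r\<^esub> lin_series L r (eps_val L) (- 1/2) n) =
    (hc (eps_val L) * u + hc (1/2)) *
    monic_div (u + hc (y_val L r / 2) - hc (of_nat r)) (u - hc (y_val L r / 2) + hc (of_nat r)) *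
    sigma_rho_series L r (\<Prod>i=1..r.
      monic_div (u + hv i + hc (1/2)) (u + hv i - hc (1/2)) *
      monic_div (u - hv i + hc (1/2)) (u - hv i - hc (1/2)))"
proof -
  have Q1: "Qser L r 1 = 1 + (\<Sum>i\<in>hatV L r. tser L r i)"
    unfolding hatV_split sum_signed[OF order_refl] by (simp add: Qser_def Pser_def)
  have "pi0_series L r (\<lambda>n. zV_series L r B bstar n \<oplus>\<^bsub>U L r\<^esub> lin_series L r (eps_val L) (- 1/2) n)
      = hc (eps_val L) * (u * (\<Sum>i\<in>hatV L r. tser L r i)) + (hc (eps_val L) * u + hc (- 1 / 2))"
  proof (rule fls_eqI)
    fix n
    have "fls_nth (pi0_series L r (\<lambda>n. zV_series L r B bstar n \<oplus>\<^bsub>U L r\<^esub> lin_series L r (eps_val L) (- 1/2) n)) n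
      = (if n \<ge> 0 then const (eps_val L) * (\<Sum>i\<in>hatV L r. tau L r (nat n) i) else 0)
        + const (if n = - 1 then eps_val L else if n = 0 then - 1 / 2 else 0)"
      unfolding pi0_series_def pi0_series_coeff[OF assms(2,3)]
      by (rule nth_Abs_fls_ex_lower_bound) (intro exI[of _ "- 1"], auto)
    then show "fls_nth (pi0_series L r (\<lambda>n. zV_series L r B bstar n \<oplus>\<^bsub>U L r\<^esub> lin_series L r (eps_val L) (- 1/2) n)) n
      = fls_nth (hc (eps_val L) * (u * (\<Sum>i\<in>hatV L r. tser L r i)) + (hc (eps_val L) * u + hc (- 1 / 2))) n"
      by (simp add: hc_def fls_X_inv_times_conv_shift fls_nth_sum tser_nth)
  qed
  also have "\<dots> = Yser L r 0"
  proof -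
    have "hc (- 1 / 2) = - hc (1 / 2)" by (simp add: hc_uminus)
    moreover have "Pser L r 0 = 1" by (simp add: Pser_def)
    ultimately show ?thesis
      unfolding Yser_def One_nat_def[symmetric] Q1 by (simp add: distrib_left mult.assoc)
  qed
  also have "\<dots> = (\<Prod>i=1..r. factor_plus L r i) * Yser L r r"
    by (rule Yser_prod) simp
  finally show ?thesis
    unfolding sigma_rho_series_prod[OF order_refl] unfolding Yser_middle Pser_prod[OF order_refl] prod.distrib
    by (simp only: mult_ac)
qed

end
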